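(* For all real $(\lambda,\mu)$ with $\frac52\le\lambda\le150$ and $0\le\mu\le\frac{22}{25}\lambda$, $$\mathcal{P}(\lambda,\mu)<\frac{\lambda^2-\mu^2}{4},\qquad\text{where}\quad\mathcal{P}(\lambda,\mu):=2\,\mathbf{T}\left(G_\lambda-F_\mu,0,\lfloor\lambda\rfloor+1\right).$$
   Context: For integers $a<b$ and $g:[a,b]\to\mathbb{R}$, $\mathbf{T}(g,a,b)=\frac12\sum_{m=a}^{b-1}\left(\lfloor g(m)\rfloor+\lfloor g(m+1)\rfloor\right)$. For $\lambda>0$, $\mu\ge0$ and $z\ge0$: $$G_\lambda(z):=\begin{cases}\frac1\pi\left(\sqrt{\lambda^2-z^2}-z\arccos\frac z\lambda\right),&z\in[0,\lambda],\\0,&z>\lambda,\end{cases}\qquad H_\mu(z):=\frac{3\mu^2+2z^2}{24\pi(\mu^2-z^2)^{3/2}}\quad(z\in[0,\mu)),$$ $$F_\mu(z):=\begin{cases}\max\left\{G_\mu(z)-H_\mu(z),-\frac14\right\},&z\in[0,\mu),\\-\frac14,&z\ge\mu.\end{cases}$$ In particular $F_0\equiv-\frac14$. *)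

theory Defs
  imports "HOL-Analysis.Analysis"
begin

definition trap_floor :: "(real \<Rightarrow> real) \<Rightarrow> int \<Rightarrow> int \<Rightarrow> real" where
  "trap_floor g a b =
     1 / 2 * (\<Sum>m\<in>{a..b - 1}. real_of_int (\<lfloor>g (real_of_int m)\<rfloor> + \<lfloor>g (real_of_int (m + 1))\<rfloor>))"

text \<open>The functions below are only meant for arguments \<open>z \<ge> 0\<close>, with \<open>l > 0\<close> in \<open>G_fun l\<close>.\<close>

definition G_fun :: "real \<Rightarrow> real \<Rightarrow> real" where
  "G_fun l z =
     (if z \<le> l then 1 / pi * (sqrt (l\<^sup>2 - z\<^sup>2) - z * arccos (z / l)) else 0)"

definition H_fun :: "real \<Rightarrow> real \<Rightarrow> real" where
  "H_fun \<mu> z = (3 * \<mu>\<^sup>2 + 2 * z\<^sup>2) / (24 * pi * (\<mu>\<^sup>2 - z\<^sup>2) powr (3 / 2))"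

definition F_fun :: "real \<Rightarrow> real \<Rightarrow> real" where
  "F_fun \<mu> z = (if z < \<mu> then max (G_fun \<mu> z - H_fun \<mu> z) (- 1 / 4) else - 1 / 4)"

definition P_fun :: "real \<Rightarrow> real \<Rightarrow> real" where
  "P_fun l \<mu> = 2 * trap_floor (\<lambda>z. G_fun l z - F_fun \<mu> z) 0 (\<lfloor>l\<rfloor> + 1)"

end

theory Submission
  imports Defs
begin

text \<open>Put \<open>\<phi> = G_l - G_m\<close>; then \<open>2 \<integral>\<phi> = (l\<^sup>2 - m\<^sup>2) / 4\<close>. Slicing horizontally, the trapezoidal sum is at
  most the sum of \<open>2 M k + 1\<close> over the levels \<open>k \<ge> 1\<close>, where \<open>M k\<close> is the last integer at which the
  counted function reaches \<open>k\<close>, so it suffices to compare \<open>M k + 1/2\<close> with the area \<open>A k\<close> of the part of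
  the region under \<open>\<phi>\<close> between the heights \<open>k - 1\<close> and \<open>k\<close>. Relative to the strip \<open>[0, M k]\<close> this
  area has a gain to the right of \<open>M k\<close> and a loss to the left, the latter only because
  \<open>\<phi> (M k) \<ge> k - s\<close> with a shift \<open>s\<close>.
  On the convex part \<open>z \<ge> m\<close> one has \<open>s \<le> 1/4\<close>, and tangents of slope at most \<open>1/2\<close> give
  \<open>A k > M k + 1/2\<close>. On the part \<open>z < m\<close>, where \<open>\<phi>\<close> is concave in \<open>z\<^sup>2\<close>, the shift is bounded
  by \<open>H_m\<close> and negligible except near \<open>m\<close>. At most one level has \<open>M k\<close> in the critical range around
  \<open>m\<close>; its possible deficit is smaller than the surplus of the first level, and if it is
  itself the first level, a sharper bound for the tail \<open>\<integral>G_l\<close> makes up for the loss.\<close>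

section \<open>The function G\<close>

text \<open>The cut-off \<open>- 1 / 4\<close> in \<open>F_fun\<close> is the break-even point of
  the convex estimate: a tangent of slope \<open>- c\<close> at \<open>M\<close> gains (1 - s)^2 /
  (2 c) and loses s^2 / (2 c), together (1 - 2 s) / (2 c), which for s \<le> 1/4 exceeds 1/2 because
  c < 1/2. The obstacle is the neighbourhood of \<open>m\<close>, where \<open>H_fun m\<close> blows
  up: the shift is then limited only by 1/4 + \<open>G_fun m M\<close>, and there is no convexity.
  The way out is that both functions are governed by m y^3 with y = sqrt (1 - (M / m)^2):
  \<open>H_fun m M\<close> is of the order of its reciprocal, \<open>G_fun m M\<close> of the order
  of the quantity itself. A large H therefore makes G_m small, and the two bounds for the shift meet
  at 0.2812. Shifts up to 0.19 are absorbed by a uniform estimate in which m / l \<le> 22/25 is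
  used. Larger ones are treated numerically, in half-angle coordinates that turn \<open>sqrt\<close>
  and \<open>arccos\<close> into rational functions and \<open>arctan\<close>. In that treatment M
  is forced to grow as M / l approaches 1, and l \<le> 150 ends the chain of cases.\<close>

lemma arccos_unit:
  assumes "0 \<le> (q::real)" "q \<le> 1"
  shows "0 \<le> arccos q" "arccos q \<le> pi / 2" "arccos q \<le> pi" "cos (arccos q) = q"
    "arccos q = pi / 2 - arcsin q"
  using assms arccos_lbound[of q] arccos_ubound[of q] arccos_le_pi2[of q] arcsin_plus_arccos[of q]
  by auto

lemma G_fun_eq_0:
  assumes "0 \<le> l" "l \<le> z"
  shows "G_fun l z = 0"
  using assms by (cases "z = l"; cases "l = 0") (auto simp: G_fun_def)

text \<open>The terms from the square root and from differentiating \<open>arccos\<close> cancel, so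
  only \<open>arccos\<close> itself survives. Its decrease in \<open>z\<close> is the convexity of
  \<open>G_fun l\<close>, and its range puts the slopes between -1/2 and 0.\<close>

lemma G_fun_has_derivative:
  assumes "0 < z" "z < l"
  shows "(G_fun l has_real_derivative - (arccos (z / l) / pi)) (at z)"
proof -
  have q: "\<bar>z / l\<bar> < 1" using assms by simp
  have pos: "0 < l\<^sup>2 - z\<^sup>2" using assms by (simp add: power_strict_mono)
  have sq: "sqrt (1 - (z / l)\<^sup>2) = sqrt (l\<^sup>2 - z\<^sup>2) / l"
  proof -
    have "1 - (z / l)\<^sup>2 = (l\<^sup>2 - z\<^sup>2) / l\<^sup>2" using assms by (simp add: field_simps)
    then show ?thesis using assms by (simp add: real_sqrt_divide)
  qed
  have "((\<lambda>z. 1 / pi * (sqrt (l\<^sup>2 - z\<^sup>2) - z * arccos (z / l))) has_real_derivative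
      1 / pi * (- z / sqrt (l\<^sup>2 - z\<^sup>2) - (arccos (z / l) + z * (inverse (- sqrt (1 - (z / l)\<^sup>2)) * (1 / l))))) (at z)"
    using q pos assms by (auto intro!: derivative_eq_intros simp: divide_simps)
  moreover have "1 / pi * (- z / sqrt (l\<^sup>2 - z\<^sup>2) - (arccos (z / l) + z * (inverse (- sqrt (1 - (z / l)\<^sup>2)) * (1 / l))))
      = - (arccos (z / l) / pi)"
    unfolding sq using pos assms by (simp add: field_simps)
  ultimately have "((\<lambda>z. 1 / pi * (sqrt (l\<^sup>2 - z\<^sup>2) - z * arccos (z / l))) has_real_derivative
      - (arccos (z / l) / pi)) (at z)" by metis
  moreover have "\<forall>\<^sub>F w in nhds z. 1 / pi * (sqrt (l\<^sup>2 - w\<^sup>2) - w * arccos (w / l)) = G_fun l w"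
    using eventually_nhds_in_open[of "{..<l}" z] assms
    by (auto elim!: eventually_mono simp: G_fun_def)
  ultimately show ?thesis
    using DERIV_cong_ev[OF refl _ refl] by metis
qed

lemma G_fun_continuous:
  assumes "0 \<le> l"
  shows "continuous_on {0..} (G_fun l)"
proof (cases "l = 0")
  case True
  then show ?thesis
    by (intro continuous_on_eq[OF continuous_on_const[of _ 0]]) (simp add: G_fun_eq_0)
next
  case False
  have eq: "{0..} = {0..l} \<union> {l..}" using assms by auto
  show ?thesis unfolding eq
  proof (rule continuous_on_closed_Un)
    have "continuous_on {0..l} (\<lambda>z. 1 / pi * (sqrt (l\<^sup>2 - z\<^sup>2) - z * arccos (z / l)))"
      using False assms
      by (intro continuous_intros) (auto simp: divide_simps)
    then show "continuous_on {0..l} (G_fun l)"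
      by (rule continuous_on_eq) (simp add: G_fun_def)
    show "continuous_on {l..} (G_fun l)"
      by (rule continuous_on_eq[OF continuous_on_const[of _ 0]]) (use assms in \<open>simp add: G_fun_eq_0\<close>)
  qed auto
qed

lemma mono_by_deriv:
  fixes f f' :: "real \<Rightarrow> real"
  assumes "a \<le> b" "continuous_on {a..b} f"
    and "\<And>x. a < x \<Longrightarrow> x < b \<Longrightarrow> (f has_real_derivative f' x) (at x)"
    and "\<And>x. a < x \<Longrightarrow> x < b \<Longrightarrow> 0 \<le> f' x"
  shows "f a \<le> f b"
  using DERIV_nonneg_imp_increasing_open[of a b f] assms by blast

lemma antimono_by_deriv:
  fixes f f' :: "real \<Rightarrow> real"
  assumes "a \<le> b" "continuous_on {a..b} f"
    and "\<And>x. a < x \<Longrightarrow> x < b \<Longrightarrow> (f has_real_derivative f' x) (at x)"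
    and "\<And>x. a < x \<Longrightarrow> x < b \<Longrightarrow> f' x \<le> 0"
  shows "f b \<le> f a"
  using DERIV_nonpos_imp_decreasing_open[of a b f] assms by blast

lemma G_fun_continuous_on [continuous_intros]:
  "0 \<le> l \<Longrightarrow> A \<subseteq> {0..} \<Longrightarrow> continuous_on A (G_fun l)"
  using G_fun_continuous continuous_on_subset by blast

text \<open>Convexity: after adding the linear term, the derivative changes sign at
  \<open>x\<close>, so \<open>F\<close> has its minimum there. Beyond \<open>l\<close> the function
  is 0 and \<open>F\<close> still does not decrease, which makes the tangent usable at every
  \<open>y \<ge> 0\<close>.\<close>

lemma G_fun_tangent:
  assumes "0 < l" "0 \<le> x" "x \<le> l" "0 \<le> y"
  shows "G_fun l y \<ge> G_fun l x - arccos (x / l) / pi * (y - x)"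
proof -
  define F where "F = (\<lambda>z. G_fun l z + arccos (x / l) / pi * z)"
  have c: "continuous_on {a..b} F" if "0 \<le> a" for a b
    unfolding F_def using assms that by (intro continuous_intros) auto
  have d: "(F has_real_derivative (- (arccos (z / l) / pi) + arccos (x / l) / pi)) (at z)"
    if "0 < z" "z < l" for z
    unfolding F_def using that
    by (auto intro!: derivative_eq_intros G_fun_has_derivative)
  have le: "arccos (b / l) \<le> arccos (a / l)" if "0 \<le> a" "a \<le> b" "b \<le> l" for a b
    using that assms by (intro arccos_le_arccos) (auto simp: divide_simps)
  have 1: "F x \<le> F y" if "x \<le> y" "y \<le> l" for y
    by (rule mono_by_deriv[OF that(1) c d]) (use assms that le in \<open>auto simp: divide_right_mono\<close>)
  have "F x \<le> F y"
  proof (cases "y \<le> x")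
    case True
    show ?thesis
      by (rule antimono_by_deriv[OF True c d]) (use assms True le in \<open>auto simp: divide_right_mono\<close>)
  next
    case False
    show ?thesis
    proof (cases "y \<le> l")
      case True
      then show ?thesis using 1 False by simp
    next
      case f: False
      have "F x \<le> F l" using 1 assms by simp
      also have "F l \<le> F y"
        unfolding F_def using f assms arccos_unit(1)[of "x / l"]
        by (auto simp: G_fun_eq_0 intro!: mult_left_mono divide_right_mono)
      finally show ?thesis .
    qed
  qed
  then show ?thesis by (simp add: F_def right_diff_distrib)
qed

lemma arccos_div_bounds:
  assumes "0 < l" "0 \<le> x" "x \<le> l"
  shows "0 \<le> arccos (x / l) / pi" "arccos (x / l) / pi \<le> 1 / 2 - x / (l * pi)"
    "arccos (x / l) / pi \<le> 1 / 2"
proof -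
  show "0 \<le> arccos (x / l) / pi" using assms arccos_unit(1)[of "x / l"] by simp
  have "x / l \<le> arcsin (x / l)"
    using sin_x_le_x[of "arcsin (x / l)"] assms arcsin_le_arcsin[of 0 "x/l"]
      sin_arcsin[of "x / l"] by (simp add: order_trans[of "-1" 0 "x / l"])
  moreover have "arccos (x / l) = pi / 2 - arcsin (x / l)"
    using arccos_unit(5)[of "x / l"] assms by simp
  ultimately have "arccos (x / l) \<le> pi / 2 - x / l" by simp
  then have "arccos (x / l) / pi \<le> (pi / 2 - x / l) / pi" by (rule divide_right_mono) simp
  also have "\<dots> = 1 / 2 - x / (l * pi)" by (simp add: field_simps)
  finally show *: "arccos (x / l) / pi \<le> 1 / 2 - x / (l * pi)" .
  show "arccos (x / l) / pi \<le> 1 / 2"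
    using * assms by (smt (verit, best) divide_nonneg_nonneg mult_nonneg_nonneg pi_ge_zero)
qed

lemma arccos_mono_scale:
  assumes "0 < m" "m \<le> l" "0 \<le> z" "z \<le> m"
  shows "arccos (z / m) \<le> arccos (z / l)"
  using assms by (intro arccos_le_arccos frac_le) (auto simp: divide_simps)

text \<open>Below \<open>m\<close> the slope is \<open>arccos (z / m) - arccos (z / l)\<close> over
  \<open>pi\<close>, nonpositive since z / m \<ge> z / l. From \<open>m\<close> on only
  \<open>G_fun l\<close> is left, and beyond \<open>l\<close> nothing.\<close>

lemma G_diff_antimono:
  assumes "0 \<le> m" "m \<le> l" "0 < l" "0 \<le> x" "x \<le> y"
  shows "G_fun l y - G_fun m y \<le> G_fun l x - G_fun m x"
proof -
  have c: "continuous_on {a..b} (\<lambda>z. G_fun l z - G_fun m z)" if "0 \<le> a" for a b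
    using assms that by (intro continuous_intros) auto
  have lo: "G_fun l b - G_fun m b \<le> G_fun l a - G_fun m a" if "0 \<le> a" "a \<le> b" "b \<le> m" for a b
  proof (rule antimono_by_deriv[OF that(2) c])
    show "0 \<le> a" by fact
    fix z assume z: "a < z" "z < b"
    show "((\<lambda>z. G_fun l z - G_fun m z) has_real_derivative
        (- (arccos (z / l) / pi) - (- (arccos (z / m) / pi)))) (at z)"
      using z that assms by (intro derivative_intros G_fun_has_derivative) auto
    show "- (arccos (z / l) / pi) - (- (arccos (z / m) / pi)) \<le> 0"
      using arccos_mono_scale[of m l z] z that assms by (simp add: divide_right_mono)
  qed
  have G: "G_fun l b \<le> G_fun l a" if "0 \<le> a" "a \<le> b" "b \<le> l" for a b
  proof (rule antimono_by_deriv[OF that(2)])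
    show "continuous_on {a..b} (G_fun l)" using assms that by (intro continuous_intros) auto
    fix z assume z: "a < z" "z < b"
    show "(G_fun l has_real_derivative (- (arccos (z / l) / pi))) (at z)"
      using z that by (intro G_fun_has_derivative) auto
    show "- (arccos (z / l) / pi) \<le> 0" using z that arccos_unit(1)[of "z / l"] by simp
  qed
  have hi: "G_fun l b \<le> G_fun l a" if "0 \<le> a" "a \<le> b" for a b
  proof (cases "b \<le> l")
    case True then show ?thesis using G that by simp
  next
    case False
    then show ?thesis
      using G[of a l] that assms by (cases "a \<le> l") (auto simp: G_fun_eq_0)
  qed
  consider "y \<le> m" | "x \<le> m" "m \<le> y" | "m \<le> x" by linarith
  then show ?thesis
  proof cases
    case 1 then show ?thesis using lo assms by simp
  next
    case 2 then show ?thesis using lo[of x m] hi[of m y] assms by (simp add: G_fun_eq_0)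
  next
    case 3 then show ?thesis using hi[of x y] assms by (simp add: G_fun_eq_0)
  qed
qed

lemma G_fun_antimono:
  assumes "0 < l" "0 \<le> x" "x \<le> y"
  shows "G_fun l y \<le> G_fun l x"
  using G_diff_antimono[of 0 l x y] assms by (simp add: G_fun_eq_0)

lemma G_fun_nonneg:
  assumes "0 \<le> l" "0 \<le> z"
  shows "0 \<le> G_fun l z"
proof (cases "z \<le> l \<and> 0 < l")
  case True
  then show ?thesis using G_fun_antimono[of l z l] assms by (simp add: G_fun_eq_0)
qed (use assms in \<open>auto simp: G_fun_eq_0\<close>)

lemma G_fun_mono_radius:
  assumes "0 \<le> m" "m \<le> l" "0 \<le> z"
  shows "G_fun m z \<le> G_fun l z"
proof (cases "l = 0")
  case False
  then have "0 < l" using assms by simp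
  then show ?thesis
    using G_diff_antimono[of m l z "max z l"] assms by (simp add: G_fun_eq_0)
qed (use assms in \<open>simp add: G_fun_eq_0\<close>)

text \<open>With \<open>arccos (z/m) \<ge> 1 - z/m\<close> and \<open>arcsin (z/l) \<ge> z/l\<close>
  the slope of \<open>G_l - G_m\<close> is bounded away from \<open>1/2\<close> by \<open>m/(pi l)\<close>.\<close>

lemma G_diff_lipschitz:
  assumes "0 \<le> m" "m \<le> l" "0 < l" "0 \<le> x" "x \<le> y" "y \<le> l"
  shows "G_fun l x - G_fun m x - (1 / 2 - m / (l * pi)) * (y - x) \<le> G_fun l y - G_fun m y"
proof -
  define s where "s = 1 / 2 - m / (l * pi)"
  define F where "F = (\<lambda>z. G_fun l z - G_fun m z + s * z)"
  have c: "continuous_on {a..b} F" if "0 \<le> a" for a b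
    unfolding F_def using assms that by (intro continuous_intros) auto
  have lo: "F a \<le> F b" if "0 \<le> a" "a \<le> b" "b \<le> m" for a b
  proof (rule mono_by_deriv[OF that(2) c])
    show "0 \<le> a" by fact
    fix z assume z: "a < z" "z < b"
    show "(F has_real_derivative
        (- (arccos (z / l) / pi) - (- (arccos (z / m) / pi)) + s * 1)) (at z)"
      unfolding F_def using z that assms by (intro derivative_intros G_fun_has_derivative) auto
    have zm: "0 < z" "z < m" using z that by auto
    \<comment> \<open>With t = arccos (z / m): (1 - cos t)^2 \<le> (1 - cos t) (1 + cos t) = (sin
      t)^2, hence 1 - cos t \<le> sin t \<le> t.\<close>
    have A: "1 - z / m \<le> arccos (z / m)"
    proof -
      define t where "t = arccos (z / m)"
      have t: "0 \<le> t" "t \<le> pi" "cos t = z / m"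
        using zm assms arccos_unit[of "z / m"] by (auto simp: t_def)
      have "t \<le> pi / 2" using zm arccos_unit(2)[of "z / m"] by (simp add: t_def)
      then have s0: "0 \<le> sin t" "sin t \<le> 1" "sin t \<le> t" "0 \<le> cos t"
        using t zm by (auto simp: sin_ge_zero sin_x_le_x)
      have "(1 - cos t) * (1 - cos t) \<le> (1 - cos t) * (1 + cos t)"
        using s0 by (intro mult_left_mono) auto
      also have "\<dots> = (sin t)\<^sup>2" by (simp add: sin_squared_eq power2_eq_square algebra_simps)
      finally have "(1 - cos t)\<^sup>2 \<le> (sin t)\<^sup>2" by (simp add: power2_eq_square)
      then have "1 - cos t \<le> sin t" using s0(1) by (rule power2_le_imp_le)
      then show ?thesis using s0 t by (simp add: t_def)
    qed
    have "arccos (z / l) / pi \<le> 1 / 2 - z / (l * pi)" using arccos_div_bounds(2)[of l z] zm assms by simp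
    moreover have "(1 - z / m) / pi \<le> arccos (z / m) / pi" using A by (simp add: divide_right_mono)
    moreover have "m / l * (1 - z / m) \<le> 1 * (1 - z / m)"
      using zm assms by (intro mult_right_mono) auto
    then have "(m / l - z / l) / pi \<le> (1 - z / m) / pi"
      using zm by (intro divide_right_mono) (auto simp: right_diff_distrib)
    moreover have "(m / l - z / l) / pi = m / (l * pi) - z / (l * pi)"
      by (simp add: diff_divide_distrib)
    ultimately show "0 \<le> - (arccos (z / l) / pi) - (- (arccos (z / m) / pi)) + s * 1"
      by (simp add: s_def)
  qed
  have hi: "F a \<le> F b" if "0 \<le> a" "m \<le> a" "a \<le> b" "b \<le> l" for a b
  proof (rule mono_by_deriv[OF that(3)])
    show "continuous_on {a..b} F" using c that by simp
    fix z assume z: "a < z" "z < b"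
    have "((\<lambda>z. G_fun l z + s * z) has_real_derivative (- (arccos (z / l) / pi) + s * 1)) (at z)"
      using z that assms by (intro derivative_intros G_fun_has_derivative) auto
    moreover have "\<forall>\<^sub>F w in nhds z. G_fun l w + s * w = F w"
      using eventually_nhds_in_open[of "{m<..}" z] that assms z
      by (auto elim!: eventually_mono simp: F_def G_fun_eq_0)
    ultimately show "(F has_real_derivative (- (arccos (z / l) / pi) + s * 1)) (at z)"
      using DERIV_cong_ev[OF refl _ refl] by metis
    have "m / (l * pi) \<le> z / (l * pi)" using z that assms by (intro divide_right_mono) auto
    then show "0 \<le> - (arccos (z / l) / pi) + s * 1"
      using arccos_div_bounds(2)[of l z] z that assms by (simp add: s_def)
  qed
  consider "y \<le> m" | "x \<le> m" "m \<le> y" | "m \<le> x" by linarith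
  then have "F x \<le> F y"
  proof cases
    case 1 then show ?thesis using lo assms by simp
  next
    case 2 then show ?thesis using lo[of x m] hi[of m y] assms by simp
  next
    case 3 then show ?thesis using hi[of x y] assms by simp
  qed
  then show ?thesis unfolding s_def[symmetric] by (simp add: F_def right_diff_distrib)
qed

text \<open>Here t is the tangent of half of arcsin q, so that q = sin (2 arctan t). It increases
  with q and equals 1 exactly at q = 1.\<close>

lemma half_angle_param:
  assumes "0 < q" "q \<le> (1::real)"
  obtains t where "0 < t" "t \<le> 1" "q = 2 * t / (1 + t\<^sup>2)"
    "sqrt (1 - q\<^sup>2) = (1 - t\<^sup>2) / (1 + t\<^sup>2)" "arccos q = pi / 2 - 2 * arctan t"
proof -
  define r where "r = sqrt (1 - q\<^sup>2)"
  define t where "t = q / (1 + r)"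
  have q2: "q\<^sup>2 \<le> 1" using assms by (simp add: power_le_one)
  have r: "0 \<le> r" "r\<^sup>2 = 1 - q\<^sup>2" using q2 by (auto simp: r_def)
  have r1: "1 + r \<noteq> 0" using r by simp
  have t0: "0 < t" using assms r by (simp add: t_def)
  have t1: "t \<le> 1" using assms r by (simp add: t_def divide_le_eq)
  have tt: "1 + t\<^sup>2 = 2 / (1 + r)" "1 - t\<^sup>2 = 2 * r / (1 + r)"
  proof -
    have "t\<^sup>2 = (1 - r) * (1 + r) / ((1 + r) * (1 + r))"
      using r(2) by (simp add: t_def power_divide power2_eq_square algebra_simps)
    then have "t\<^sup>2 = (1 - r) / (1 + r)" using r1 by simp
    then show "1 + t\<^sup>2 = 2 / (1 + r)" "1 - t\<^sup>2 = 2 * r / (1 + r)" using r1 by (simp_all add: field_simps)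
  qed
  have q: "q = 2 * t / (1 + t\<^sup>2)" using r1 by (simp add: tt) (simp add: t_def)
  have s: "r = (1 - t\<^sup>2) / (1 + t\<^sup>2)" using r1 by (simp add: tt)
  define a where "a = arctan t"
  have a: "0 \<le> a" "a \<le> pi / 4"
    using t0 t1 arctan_le_iff[of t 1] by (auto simp: a_def arctan_one)
  have "sin (2 * a) = q"
  proof -
    have "sin (2 * a) = 2 * (t / sqrt (1 + t\<^sup>2)) * (1 / sqrt (1 + t\<^sup>2))"
      by (simp add: a_def sin_double sin_arctan cos_arctan)
    also have "\<dots> = 2 * t / (sqrt (1 + t\<^sup>2))\<^sup>2" by (simp add: power2_eq_square)
    also have "\<dots> = q" by (simp add: q add_nonneg_nonneg)
    finally show ?thesis .
  qed
  then have "arccos q = arccos (cos (pi / 2 - 2 * a))" by (simp add: cos_diff)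
  also have "\<dots> = pi / 2 - 2 * a" using a by (intro arccos_cos) auto
  finally show ?thesis using that[of t] t0 t1 q s by (simp add: r_def a_def)
qed

lemma G_fun_half_angle:
  assumes "0 < t" "t \<le> 1" "0 < M" "M \<le> L" "M / L = 2 * t / (1 + t\<^sup>2)"
    "sqrt (1 - (M / L)\<^sup>2) = (1 - t\<^sup>2) / (1 + t\<^sup>2)" "arccos (M / L) = pi / 2 - 2 * arctan t"
  shows "G_fun L M = M / pi * ((1 - t\<^sup>2) / (2 * t) - pi / 2 + 2 * arctan t)"
    "G_fun L 0 - G_fun L M = M / pi * (pi / 2 - (2 * arctan t - t))"
proof -
  have L: "0 < L" using assms by simp
  have t2: "1 + t\<^sup>2 \<noteq> 0" by (simp add: add_nonneg_eq_0_iff)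
  have LM: "L = M * ((1 + t\<^sup>2) / (2 * t))"
    using assms(1,5) L t2 by (simp add: field_simps)
  have "L\<^sup>2 - M\<^sup>2 = L\<^sup>2 * (1 - (M / L)\<^sup>2)" using L by (simp add: field_simps)
  then have "sqrt (L\<^sup>2 - M\<^sup>2) = L * ((1 - t\<^sup>2) / (1 + t\<^sup>2))"
    using L by (simp add: real_sqrt_mult assms(6))
  also have "\<dots> = M * ((1 - t\<^sup>2) / (2 * t))"
  proof -
    have "(M * (T / (2 * t))) * (X / T) = M * (X / (2 * t))" if "T \<noteq> 0" for T X :: real
      using that assms(1) by (simp add: field_simps)
    then show ?thesis unfolding LM using t2 by blast
  qed
  finally have sq: "sqrt (L\<^sup>2 - M\<^sup>2) = M * ((1 - t\<^sup>2) / (2 * t))" .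
  show G: "G_fun L M = M / pi * ((1 - t\<^sup>2) / (2 * t) - pi / 2 + 2 * arctan t)"
    using assms(4) by (simp add: G_fun_def sq assms(7) field_simps)
  have G0: "G_fun L 0 = L / pi" using L by (simp add: G_fun_def)
  have "G_fun L 0 - G_fun L M = M / pi * ((1 + t\<^sup>2) / (2 * t) - ((1 - t\<^sup>2) / (2 * t) - pi / 2 + 2 * arctan t))"
    unfolding G G0 by (subst LM) (simp add: right_diff_distrib)
  also have "(1 + t\<^sup>2) / (2 * t) - (1 - t\<^sup>2) / (2 * t) = t"
    using assms(1) by (simp add: field_simps power2_eq_square)
  then have "(1 + t\<^sup>2) / (2 * t) - ((1 - t\<^sup>2) / (2 * t) - pi / 2 + 2 * arctan t) = pi / 2 - (2 * arctan t - t)"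
    by simp
  finally show "G_fun L 0 - G_fun L M = M / pi * (pi / 2 - (2 * arctan t - t))" .
qed

lemma arccos_scale_has_derivative:
  assumes "0 \<le> z" "z < l"
  shows "((\<lambda>z. arccos (z / l)) has_real_derivative - (1 / sqrt (l\<^sup>2 - z\<^sup>2))) (at z)"
proof -
  have q: "\<bar>z / l\<bar> < 1" "- 1 < z / l" using assms by (auto simp: order_less_le_trans[of "-1" 0])
  have "1 - (z / l)\<^sup>2 = (l\<^sup>2 - z\<^sup>2) / l\<^sup>2" using assms by (simp add: field_simps)
  then have sq: "sqrt (1 - (z / l)\<^sup>2) = sqrt (l\<^sup>2 - z\<^sup>2) / l"
    using assms by (simp add: real_sqrt_divide)
  have "((\<lambda>z. arccos (z / l)) has_real_derivative inverse (- sqrt (1 - (z / l)\<^sup>2)) * (1 / l)) (at z)"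
    using q assms by (auto intro!: derivative_eq_intros)
  then show ?thesis unfolding sq using assms by (simp add: field_simps)
qed

text \<open>The difference \<open>w\<close> vanishes at 0 and is convex, so its quotient by the
  argument increases.\<close>

lemma arccos_diff_superlinear:
  assumes "0 < m" "m \<le> l" "0 < a" "a \<le> b" "b < m"
  shows "(arccos (a / l) - arccos (a / m)) / a \<le> (arccos (b / l) - arccos (b / m)) / b"
proof -
  define w where "w = (\<lambda>z. arccos (z / l) - arccos (z / m))"
  define w' where "w' = (\<lambda>z. 1 / sqrt (m\<^sup>2 - z\<^sup>2) - 1 / sqrt (l\<^sup>2 - z\<^sup>2))"
  have "convex_on {0..<m} w"
  proof (rule convex_on_realI[where f' = w'])
    show "connected {0..<m}" by simp
    fix x assume x: "x \<in> {0..<m}"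
    show "(w has_real_derivative w' x) (at x)"
      unfolding w_def w'_def
      using DERIV_diff[OF arccos_scale_has_derivative[of x l] arccos_scale_has_derivative[of x m]] x assms
      by simp
  next
    fix x y assume xy: "x \<in> {0..<m}" "y \<in> {0..<m}" "x \<le> y"
    \<comment> \<open>Rationalising the difference of reciprocals makes its monotonicity visible:
      the numerator is constant and every factor of the denominator decreases in
      \<open>z\<close>.\<close>
    have e: "w' z = (l\<^sup>2 - m\<^sup>2) / (sqrt (m\<^sup>2 - z\<^sup>2) * sqrt (l\<^sup>2 - z\<^sup>2) * (sqrt (m\<^sup>2 - z\<^sup>2) + sqrt (l\<^sup>2 - z\<^sup>2)))"
      if "z \<in> {0..<m}" for z
    proof -
      define A B where "A = sqrt (m\<^sup>2 - z\<^sup>2)" and "B = sqrt (l\<^sup>2 - z\<^sup>2)"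
      have "z\<^sup>2 < m\<^sup>2" using that by (simp add: power_strict_mono)
      moreover have "m\<^sup>2 \<le> l\<^sup>2" using assms by (simp add: power_mono)
      ultimately have "0 < A" "0 < B" "A\<^sup>2 = m\<^sup>2 - z\<^sup>2" "B\<^sup>2 = l\<^sup>2 - z\<^sup>2" by (auto simp: A_def B_def)
      moreover have "l\<^sup>2 - m\<^sup>2 = (B - A) * (A + B)" using calculation by (simp add: power2_eq_square algebra_simps)
      ultimately have "1 / A - 1 / B = (l\<^sup>2 - m\<^sup>2) / (A * B * (A + B))" by (simp add: divide_simps)
      then show ?thesis by (simp add: w'_def A_def B_def)
    qed
    have "y\<^sup>2 < m\<^sup>2" using xy by (simp add: power_strict_mono)
    moreover have "m\<^sup>2 \<le> l\<^sup>2" using assms by (simp add: power_mono)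
    moreover have "x\<^sup>2 \<le> y\<^sup>2" using xy by (simp add: power_mono)
    ultimately show "w' x \<le> w' y"
      unfolding e[OF xy(1)] e[OF xy(2)]
      by (intro divide_left_mono mult_mono add_mono mult_nonneg_nonneg mult_pos_pos add_pos_pos) auto
  qed
  then have "w ((1 - a / b) *\<^sub>R 0 + (a / b) *\<^sub>R b) \<le> (1 - a / b) * w 0 + a / b * w b"
    by (rule convex_onD) (use assms in auto)
  then have "w a \<le> a / b * w b" using assms by (simp add: w_def)
  then show ?thesis using assms by (simp add: w_def field_simps)
qed

text \<open>\<open>G_l - G_m\<close> is concave as a function of \<open>z\<^sup>2\<close> on \<open>[0, m]\<close>, since its slope divided by \<open>z\<close>
  increases in absolute value; this is its chord in the variable \<open>z\<^sup>2\<close>.\<close>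

lemma G_diff_quadratic_chord:
  fixes l m M z :: real
  defines "p \<equiv> \<lambda>z. G_fun l z - G_fun m z"
  assumes "0 < M" "M \<le> m" "m \<le> l" "0 \<le> z" "z \<le> M"
  shows "p z \<ge> p M + (p 0 - p M) * (1 - (z / M)\<^sup>2)"
proof (cases "z = 0")
  case True
  then show ?thesis by simp
next
  case False
  then have z0: "0 < z" using assms by simp
  define D where "D = p 0 - p M"
  \<comment> \<open>\<open>E\<close> takes the value \<open>p M\<close> at both ends 0 and
    \<open>M\<close>, and its derivative is \<open>x\<close> times a decreasing factor. So it first
    rises and then falls; the sign of the factor at \<open>z\<close> decides with which end to
    compare.\<close>
  define E where "E = (\<lambda>z. p z - D * (1 - (z / M)\<^sup>2))"
  have cont: "continuous_on {a..b} E" if "0 \<le> a" for a b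
    unfolding E_def p_def using assms that by (intro continuous_intros) auto
  define w where "w = (\<lambda>z. arccos (z / l) - arccos (z / m))"
  have der: "(E has_real_derivative (x * (2 * D / M\<^sup>2 - w x / x / pi))) (at x)" if "0 < x" "x < M" for x
  proof -
    have "(E has_real_derivative (- (arccos (x / l) / pi) - (- (arccos (x / m) / pi)) - D * (0 - 2 * (x / M) * (1 / M)))) (at x)"
      unfolding E_def p_def using that assms
      by (auto intro!: derivative_eq_intros G_fun_has_derivative)
    moreover have "- (arccos (x / l) / pi) - (- (arccos (x / m) / pi)) - D * (0 - 2 * (x / M) * (1 / M))
        = x * (2 * D / M\<^sup>2 - w x / x / pi)"
      using that by (simp add: w_def field_simps power2_eq_square)
    ultimately show ?thesis by metis
  qed
  have mono: "w a / a / pi \<le> w b / b / pi" if "0 < a" "a \<le> b" "b < M" for a b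
    using arccos_diff_superlinear[of m l a b] that assms unfolding w_def by (intro divide_right_mono) auto
  have E0: "E 0 = p M" "E M = p M" using assms by (simp_all add: E_def D_def)
  have "p M \<le> E z"
  proof (cases "z = M")
    case False
    then have zM: "z < M" using assms by simp
    show ?thesis
    proof (cases "w z / z / pi \<le> 2 * D / M\<^sup>2")
      case True
      have "E 0 \<le> E z"
      proof (rule mono_by_deriv[OF assms(5) cont der])
        fix x assume x: "0 < x" "x < z"
        show "0 \<le> x * (2 * D / M\<^sup>2 - w x / x / pi)"
          using mono[of x z] x zM True by (intro mult_nonneg_nonneg) auto
      qed (use zM in auto)
      then show ?thesis by (simp add: E0)
    next
      case False
      have "E M \<le> E z"
      proof (rule antimono_by_deriv[OF assms(6) cont der])
        fix x assume x: "z < x" "x < M"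
        show "x * (2 * D / M\<^sup>2 - w x / x / pi) \<le> 0"
          using mono[of z x] x z0 False by (intro mult_nonneg_nonpos) auto
      qed (use z0 in auto)
      then show ?thesis by (simp add: E0)
    qed
  qed (simp add: E0)
  then show ?thesis by (simp add: E_def D_def algebra_simps)
qed

section \<open>Tail integrals of G\<close>

lemma sin_minus_cos_bounds:
  fixes x :: real
  assumes "0 \<le> x" "x \<le> pi / 2"
  shows "x\<^sup>2 * sin x / 3 \<le> sin x - x * cos x" "0 \<le> sin x - x * cos x"
proof -
  have *: "0 \<le> sin x - x * cos x" if "0 \<le> x" "x \<le> pi / 2" for x :: real
    using mono_by_deriv[of 0 x "\<lambda>x. sin x - x * cos x" "\<lambda>x. x * sin x"] that
    by (fastforce intro!: derivative_eq_intros continuous_intros mult_nonneg_nonneg sin_ge_zero)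
  then show "0 \<le> sin x - x * cos x" using assms by simp
  have "(\<lambda>x. sin x - x * cos x - x\<^sup>2 * sin x / 3) 0 \<le> (\<lambda>x. sin x - x * cos x - x\<^sup>2 * sin x / 3) x"
  proof (rule mono_by_deriv[of 0 x _ "\<lambda>x. x / 3 * (sin x - x * cos x)"])
    fix y assume y: "0 < y" "y < x"
    show "((\<lambda>x. sin x - x * cos x - x\<^sup>2 * sin x / 3) has_real_derivative y / 3 * (sin y - y * cos y)) (at y)"
      by (auto intro!: derivative_eq_intros simp: field_simps power2_eq_square)
    show "0 \<le> y / 3 * (sin y - y * cos y)" using *[of y] y assms by simp
  qed (use assms in \<open>auto intro!: continuous_intros\<close>)
  then show "x\<^sup>2 * sin x / 3 \<le> sin x - x * cos x" by simp
qed

text \<open>The tail integral of \<open>G_fun l\<close> after substituting z = l cos x, where G_l is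
  l / pi times sin x - x cos x: the primitive of (sin x - x cos x) sin x that vanishes at 0.\<close>

definition J_fun :: "real \<Rightarrow> real" where
  "J_fun x = x / 4 + x * (cos x)\<^sup>2 / 2 - 3 / 4 * sin x * cos x"

lemma J_fun_has_derivative:
  "(J_fun has_real_derivative (sin x - x * cos x) * sin x) (at x)"
proof -
  have "(J_fun has_real_derivative
      (1 / 4 + ((cos x)\<^sup>2 / 2 - x * cos x * sin x) - 3 / 4 * ((cos x)\<^sup>2 - (sin x)\<^sup>2))) (at x)"
    unfolding J_fun_def
    by (rule derivative_eq_intros refl | simp)+ (simp add: field_simps power2_eq_square)
  moreover have "1 / 4 + ((cos x)\<^sup>2 / 2 - x * cos x * sin x) - 3 / 4 * ((cos x)\<^sup>2 - (sin x)\<^sup>2)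
     = (sin x - x * cos x) * sin x"
    unfolding cos_squared_eq by (simp add: field_simps power2_eq_square)
  ultimately show ?thesis by metis
qed

text \<open>The constant 3/5 is the limit of the ratio as x tends to 0, where sin x - x cos x
  behaves like x^3 / 3 and \<open>J_fun x\<close> like x^5 / 15. Two differentiations of the
  difference reduce the claim to the preceding bounds.\<close>

lemma J_fun_lower:
  assumes "0 \<le> x" "x \<le> pi / 2"
  shows "3 / 5 * (sin x - x * cos x)\<^sup>2 \<le> x * J_fun x"
proof -
  define K where "K = (\<lambda>x::real. sin x - x * cos x)"
  have K': "(K has_real_derivative x * sin x) (at x)" for x
    unfolding K_def by (auto intro!: derivative_eq_intros simp: field_simps)
  have c: "continuous_on A J_fun" for A
    by (intro continuous_at_imp_continuous_on ballI DERIV_isCont[OF J_fun_has_derivative])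
  have cK: "continuous_on A K" for A
    unfolding K_def by (intro continuous_intros)
  define B where "B = (\<lambda>x. x * J_fun x - 3 / 5 * (K x * K x))"
  define B1 where "B1 = (\<lambda>x. J_fun x - 1 / 5 * (K x * x * sin x))"
  have dB: "(B has_real_derivative B1 x) (at x)" for x
  proof -
    have "(J_fun has_real_derivative K x * sin x) (at x)"
      using J_fun_has_derivative by (simp add: K_def)
    then have "(B has_real_derivative (1 * J_fun x + K x * sin x * x - 3 / 5 * (x * sin x * K x + x * sin x * K x))) (at x)"
      unfolding B_def by (intro DERIV_diff DERIV_cmult DERIV_mult K' DERIV_ident)
    then show ?thesis by (simp add: B1_def algebra_simps)
  qed
  have dB1: "(B1 has_real_derivative 1 / 5 * (K x * (4 * sin x - x * cos x) - (x * sin x)\<^sup>2)) (at x)" for x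
  proof -
    have "(J_fun has_real_derivative K x * sin x) (at x)"
      using J_fun_has_derivative by (simp add: K_def)
    then have "(B1 has_real_derivative (K x * sin x - 1 / 5 * (((x * sin x) * x + 1 * K x) * sin x + cos x * (K x * x)))) (at x)"
      unfolding B1_def by (intro DERIV_diff DERIV_cmult DERIV_mult K' DERIV_ident DERIV_sin)
    then show ?thesis by (rule DERIV_cong) (simp add: algebra_simps power2_eq_square)
  qed
  have B1: "0 \<le> B1 x" if "0 \<le> x" "x \<le> pi / 2" for x
  proof -
    have "B1 0 \<le> B1 x"
    proof (rule mono_by_deriv[OF that(1) _ dB1])
      show "continuous_on {0..x} B1" unfolding B1_def by (intro continuous_intros c cK)
      fix y assume y: "0 < y" "y < x"
      then have s: "0 \<le> sin y" "y\<^sup>2 * sin y / 3 \<le> K y" "0 \<le> K y"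
        using that sin_minus_cos_bounds[of y] by (auto simp: K_def sin_ge_zero)
      \<comment> \<open>Both factors are dominated: the first by \<open>K y\<close>, the second
        because 4 sin y - y cos y = 3 sin y + \<open>K y\<close>.\<close>
      have "(y * sin y)\<^sup>2 = (y\<^sup>2 * sin y / 3) * (3 * sin y)" by (simp add: power2_eq_square)
      also have "\<dots> \<le> K y * (4 * sin y - y * cos y)"
        using s by (intro mult_mono) (auto simp: K_def)
      finally show "0 \<le> 1 / 5 * (K y * (4 * sin y - y * cos y) - (y * sin y)\<^sup>2)" by simp
    qed
    then show ?thesis by (simp add: B1_def J_fun_def)
  qed
  have "B 0 \<le> B x"
  proof (rule mono_by_deriv[OF assms(1) _ dB])
    show "continuous_on {0..x} B" unfolding B_def by (intro continuous_intros c cK)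
  qed (use B1 assms in auto)
  then show ?thesis by (simp add: B_def K_def J_fun_def power2_eq_square)
qed

lemma G_fun_has_integral:
  assumes "0 < l" "0 \<le> M" "M \<le> l"
  shows "(G_fun l has_integral l\<^sup>2 / pi * J_fun (arccos (M / l))) {M..l}"
proof -
  define K where "K = (\<lambda>z. 1 / pi * (3 / 4 * (z * sqrt (l\<^sup>2 - z\<^sup>2)) + l\<^sup>2 / 4 * arcsin (z / l) - z\<^sup>2 / 2 * arccos (z / l)))"
  have "(G_fun l has_integral (K l - K M)) {M..l}"
  proof (rule fundamental_theorem_of_calculus_interior[OF assms(3)])
    show "continuous_on {M..l} K"
      unfolding K_def using assms
      by (intro continuous_intros) (auto simp: divide_simps)
    fix z assume "z \<in> {M<..<l}"
    then have z: "0 < z" "z < l" "\<bar>z / l\<bar> < 1" "- 1 < z / l"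
      using assms by (auto simp: order_less_le_trans[of "-1" 0])
    define R where "R = sqrt (l\<^sup>2 - z\<^sup>2)"
    have pos: "0 < l\<^sup>2 - z\<^sup>2" using z by (simp add: power_strict_mono)
    have R: "0 < R" "R\<^sup>2 = l\<^sup>2 - z\<^sup>2" using pos by (auto simp: R_def)
    have sq: "sqrt (1 - (z / l)\<^sup>2) = R / l"
    proof -
      have "1 - (z / l)\<^sup>2 = (l\<^sup>2 - z\<^sup>2) / l\<^sup>2" using assms by (simp add: field_simps)
      then show ?thesis using assms by (simp add: real_sqrt_divide R_def)
    qed
    have da: "((\<lambda>z. arcsin (z / l)) has_real_derivative 1 / R) (at z)"
    proof -
      have "((\<lambda>z. arcsin (z / l)) has_real_derivative inverse (sqrt (1 - (z / l)\<^sup>2)) * (1 / l)) (at z)"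
        using z assms by (auto intro!: derivative_eq_intros)
      then show ?thesis unfolding sq using assms by (simp add: field_simps)
    qed
    have dc: "((\<lambda>z. arccos (z / l)) has_real_derivative - (1 / R)) (at z)"
      using arccos_scale_has_derivative[of z l] z by (simp add: R_def)
    have dr: "((\<lambda>z. sqrt (l\<^sup>2 - z\<^sup>2)) has_real_derivative - z / R) (at z)"
      using pos by (auto intro!: derivative_eq_intros simp: R_def field_simps)
    have dz: "((\<lambda>z. z\<^sup>2 / 2) has_real_derivative z) (at z)"
      by (auto intro!: derivative_eq_intros)
    have "(K has_real_derivative 1 / pi * (3 / 4 * (1 * sqrt (l\<^sup>2 - z\<^sup>2) + (- z / R) * z) + l\<^sup>2 / 4 * (1 / R)
        - (z * arccos (z / l) + (- (1 / R)) * (z\<^sup>2 / 2)))) (at z)"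
      unfolding K_def by (intro DERIV_cmult DERIV_diff DERIV_add DERIV_mult da dc dr dz DERIV_ident)
    moreover have "1 / pi * (3 / 4 * (1 * sqrt (l\<^sup>2 - z\<^sup>2) + (- z / R) * z) + l\<^sup>2 / 4 * (1 / R)
        - (z * arccos (z / l) + (- (1 / R)) * (z\<^sup>2 / 2))) = G_fun l z"
    proof -
      have "l\<^sup>2 = R\<^sup>2 + z\<^sup>2" using R by simp
      then have "3 / 4 * (1 * R + z * (- z / R)) + l\<^sup>2 / 4 * (1 / R) + z\<^sup>2 / 2 * (1 / R) = R"
        using R(1) by (simp add: field_simps power2_eq_square)
      moreover have "G_fun l z = 1 / pi * (R - z * arccos (z / l))" using z by (simp add: G_fun_def R_def)
      ultimately show ?thesis by (simp add: R_def[symmetric] algebra_simps)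
    qed
    ultimately show "(K has_vector_derivative G_fun l z) (at z)"
      by (simp add: has_real_derivative_iff_has_vector_derivative)
  qed
  moreover have "K l - K M = l\<^sup>2 / pi * J_fun (arccos (M / l))"
  proof -
    define x where "x = arccos (M / l)"
    have u: "0 \<le> M / l" "M / l \<le> 1" using assms by auto
    have c: "cos x = M / l" "arcsin (M / l) = pi / 2 - x"
      using arccos_unit[OF u] by (auto simp: x_def)
    have M: "M = l * cos x" using c assms by simp
    have sx: "0 \<le> sin x" using arccos_unit[OF u] by (simp add: x_def sin_ge_zero)
    have "l\<^sup>2 - M\<^sup>2 = (l * sin x)\<^sup>2" unfolding M by (simp add: power_mult_distrib cos_squared_eq algebra_simps)
    then have s: "sqrt (l\<^sup>2 - M\<^sup>2) = l * sin x" using sx assms by simp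
    show ?thesis
      unfolding K_def s c(2) x_def[symmetric] J_fun_def
      using assms by (simp add: M power2_eq_square field_simps)
  qed
  ultimately show ?thesis by simp
qed

lemma G_fun_integral:
  assumes "0 < l"
  shows "(G_fun l has_integral l\<^sup>2 / 8) {0..l}"
  using G_fun_has_integral[of l 0] assms by (simp add: J_fun_def)

text \<open>The triangle under the tangent at \<open>M\<close> would give the factor 1/2; the gain
  from 1/2 to 3/5 is what rescues a critical first level.\<close>

lemma G_fun_tail_integral:
  assumes "0 < l" "0 \<le> M" "M < l"
  shows "3 / 5 * (G_fun l M)\<^sup>2 / (arccos (M / l) / pi) \<le> integral {M..l} (G_fun l)"
proof -
  define x where "x = arccos (M / l)"
  have u: "0 \<le> M / l" "M / l \<le> 1" "M / l < 1" using assms by auto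
  have x: "0 \<le> x" "x \<le> pi / 2" "cos x = M / l" using arccos_unit[OF u(1,2)] by (auto simp: x_def)
  have x0: "0 < x" using x u by (metis cos_zero less_irrefl order_le_less)
  have M: "M = l * cos x" using x assms by simp
  have sx: "0 \<le> sin x" using x by (simp add: sin_ge_zero)
  have "l\<^sup>2 - M\<^sup>2 = (l * sin x)\<^sup>2" unfolding M by (simp add: power_mult_distrib cos_squared_eq algebra_simps)
  then have s: "sqrt (l\<^sup>2 - M\<^sup>2) = l * sin x" using sx assms by simp
  have G: "G_fun l M = l / pi * (sin x - x * cos x)"
    using assms by (simp add: G_fun_def s x_def[symmetric]) (simp add: M algebra_simps)
  have "integral {M..l} (G_fun l) = l\<^sup>2 / pi * J_fun x"
    using G_fun_has_integral[of l M] assms by (simp add: x_def integral_unique)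
  moreover have "3 / 5 * (l / p * K)\<^sup>2 / (x / p) = l\<^sup>2 / p * (3 / 5 * K\<^sup>2 / x)" if "p \<noteq> 0" for p K
    using that x0 by (simp add: field_simps power2_eq_square)
  then have "3 / 5 * (G_fun l M)\<^sup>2 / (x / pi) = l\<^sup>2 / pi * (3 / 5 * (sin x - x * cos x)\<^sup>2 / x)"
    unfolding G by simp
  moreover have "l\<^sup>2 / pi * (3 / 5 * (sin x - x * cos x)\<^sup>2 / x) \<le> l\<^sup>2 / pi * J_fun x"
    using J_fun_lower[OF x(1,2)] x0 by (intro mult_left_mono) (auto simp: divide_le_eq mult_ac)
  ultimately show ?thesis by (simp add: x_def)
qed

section \<open>Layers\<close>

lemma integral_ge_has_integral:
  fixes f h :: "real \<Rightarrow> real"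
  assumes "(h has_integral I) {a..b}" "continuous_on {a..b} f"
    and "\<And>z. a \<le> z \<Longrightarrow> z \<le> b \<Longrightarrow> h z \<le> f z"
  shows "I \<le> integral {a..b} f"
  using has_integral_le[OF assms(1) integrable_integral[OF integrable_continuous_real[OF assms(2)]]] assms(3)
  by auto

lemma integral_split:
  fixes f :: "real \<Rightarrow> real"
  assumes "a \<le> c" "c \<le> b" "continuous_on {a..b} f"
  shows "integral {a..b} f = integral {a..c} f + integral {c..b} f"
  using Henstock_Kurzweil_Integration.integral_combine[OF assms(1,2) integrable_continuous_real[OF assms(3)]]
  by simp

lemma has_integral_FTC:
  fixes f F :: "real \<Rightarrow> real"
  assumes "a \<le> b" "\<And>x. (F has_real_derivative f x) (at x)"
  shows "(f has_integral (F b - F a)) {a..b}"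
  using assms
  by (intro fundamental_theorem_of_calculus)
     (auto simp: has_real_derivative_iff_has_vector_derivative[symmetric] intro: has_field_derivative_at_within)

lemma integral_ge_triangle_right:
  fixes f :: "real \<Rightarrow> real"
  assumes "continuous_on {a..b} f" "\<And>z. a \<le> z \<Longrightarrow> z \<le> b \<Longrightarrow> 0 \<le> f z"
    and "0 < c" "0 \<le> p" "a + p / c \<le> b"
    and "\<And>z. a \<le> z \<Longrightarrow> z \<le> b \<Longrightarrow> p - c * (z - a) \<le> f z"
  shows "p\<^sup>2 / (2 * c) \<le> integral {a..b} f"
proof -
  define e where "e = a + p / c"
  have e: "a \<le> e" "e \<le> b" using assms by (auto simp: e_def)
  have c1: "continuous_on {a..e} f" and c2: "continuous_on {e..b} f"
    using assms(1) e by (auto elim!: continuous_on_subset)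
  have "((\<lambda>z. p - c * (z - a)) has_integral ((p * e - c * (e - a)\<^sup>2 / 2) - (p * a - c * (a - a)\<^sup>2 / 2))) {a..e}"
    by (rule has_integral_FTC[OF e(1)]) (auto intro!: derivative_eq_intros)
  then have "(p * e - c * (e - a)\<^sup>2 / 2) - (p * a - c * (a - a)\<^sup>2 / 2) \<le> integral {a..e} f"
    by (rule integral_ge_has_integral[OF _ c1]) (use assms e in auto)
  moreover have "0 \<le> integral {e..b} f"
    by (rule integral_nonneg[OF integrable_continuous_real[OF c2]]) (use assms e in auto)
  moreover have "(p * e - c * (e - a)\<^sup>2 / 2) - (p * a - c * (a - a)\<^sup>2 / 2) = p\<^sup>2 / (2 * c)"
    using assms(3) by (simp add: e_def field_simps power2_eq_square)
  ultimately show ?thesis using integral_split[OF e assms(1)] by simp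
qed

text \<open>The missing part below height 1 lies in a right triangle with height \<open>s\<close>
  and slope \<open>c\<close>. If that triangle is cut off at 0, the loss is smaller still, which is
  the nonnegative square in the last computation.\<close>

lemma integral_ge_triangle_left:
  fixes f :: "real \<Rightarrow> real"
  assumes "continuous_on {0..M} f" "0 \<le> M" "0 < c" "0 \<le> s"
    and "\<And>z. 0 \<le> z \<Longrightarrow> z \<le> M \<Longrightarrow> min 1 (1 - s + c * (M - z)) \<le> f z"
  shows "M - s\<^sup>2 / (2 * c) \<le> integral {0..M} f"
proof -
  define e where "e = max 0 (M - s / c)"
  have e: "0 \<le> e" "e \<le> M" using assms by (auto simp: e_def)
  have c1: "continuous_on {0..e} f" and c2: "continuous_on {e..M} f"
    using assms(1) e by (auto elim!: continuous_on_subset)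
  have slope: "c * (M - z) \<le> s \<longleftrightarrow> M - s / c \<le> z" for z
    using assms(3) by (simp add: field_simps)
  have one: "((\<lambda>z. 1 :: real) has_integral (e - 0)) {0..e}"
    using e has_integral_const_real[of "1 :: real" 0 e] by simp
  have 1: "e \<le> integral {0..e} f"
  proof (cases "e = 0")
    case False
    then have "M - s / c = e" by (simp add: e_def max_def split: if_splits)
    then have Me: "c * (M - e) = s" using assms(3) by (simp add: field_simps)
    have "1 \<le> f z" if "0 \<le> z" "z \<le> e" for z
    proof -
      have "c * (M - e) \<le> c * (M - z)" using that assms(3) by (intro mult_left_mono) auto
      then show ?thesis using assms(5)[of z] that e Me by simp
    qed
    then show ?thesis using integral_ge_has_integral[OF one c1] by simp
  qed simp
  have "((\<lambda>z. 1 - s + c * (M - z)) has_integral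
      (((1 - s) * M - c * (M - M)\<^sup>2 / 2) - ((1 - s) * e - c * (M - e)\<^sup>2 / 2))) {e..M}"
    by (rule has_integral_FTC[OF e(2)]) (auto intro!: derivative_eq_intros simp: field_simps)
  then have 2: "((1 - s) * M - c * (M - M)\<^sup>2 / 2) - ((1 - s) * e - c * (M - e)\<^sup>2 / 2) \<le> integral {e..M} f"
  proof (rule integral_ge_has_integral[OF _ c2])
    fix z assume z: "e \<le> z" "z \<le> M"
    then have "c * (M - z) \<le> s" unfolding slope by (simp add: e_def)
    then show "1 - s + c * (M - z) \<le> f z" using assms(5)[of z] z e by simp
  qed
  have "M - s\<^sup>2 / (2 * c) \<le> e + (1 - s) * (M - e) + c * (M - e)\<^sup>2 / 2"
  proof -
    have "0 \<le> (s - c * (M - e))\<^sup>2 / (2 * c)" using assms(3) by simp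
    also have "\<dots> = s\<^sup>2 / (2 * c) - s * (M - e) + c * (M - e)\<^sup>2 / 2"
      using assms(3) by (simp add: field_simps power2_eq_square)
    finally show ?thesis by (simp add: algebra_simps)
  qed
  then show ?thesis using 1 2 integral_split[OF e assms(1)] by (simp add: algebra_simps)
qed

text \<open>The factor \<open>3/8\<close> is the maximum of the loss, in units of \<open>s\<^sup>2 M / D\<close>,
  over all ratios \<open>s / D\<close>; it is attained at \<open>s = 4 D / 3\<close>.\<close>

lemma integral_ge_parabola_left:
  fixes f :: "real \<Rightarrow> real"
  assumes "continuous_on {0..M} f" "0 < M" "0 < D" "0 \<le> s"
    and "\<And>z. 0 \<le> z \<Longrightarrow> z \<le> M \<Longrightarrow> min 1 (1 - s + D * (1 - (z / M)\<^sup>2)) \<le> f z"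
  shows "M - 3 / 8 * s\<^sup>2 * M / D \<le> integral {0..M} f"
proof -
  define F where "F = (\<lambda>z. (1 - s + D) * z - D * z ^ 3 / (3 * M\<^sup>2))"
  have F: "((\<lambda>z. 1 - s + D * (1 - (z / M)\<^sup>2)) has_integral (F M - F e)) {e..M}" if "e \<le> M" for e
    by (rule has_integral_FTC[OF that])
       (use assms(2) in \<open>auto simp: F_def field_simps power2_eq_square intro!: derivative_eq_intros\<close>)
  show ?thesis
  proof (cases "D \<le> s")
    \<comment> \<open>The parabola stays below 1 on the whole interval, and the difference to the
      claim is a perfect square that vanishes at s = 4 D / 3.\<close>
    case True
    have "F M - F 0 \<le> integral {0..M} f"
    proof (rule integral_ge_has_integral[OF F assms(1)])
      fix z assume z: "0 \<le> z" "z \<le> M"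
      have "D * (1 - (z / M)\<^sup>2) \<le> D * 1" using assms by (intro mult_left_mono) auto
      then show "1 - s + D * (1 - (z / M)\<^sup>2) \<le> f z" using assms(5)[OF z] True by simp
    qed (use assms in auto)
    moreover have "F M - F 0 - (M - 3 / 8 * s\<^sup>2 * M / D) = 3 / 8 * (s - 4 / 3 * D)\<^sup>2 * M / D"
      using assms by (simp add: F_def field_simps power2_eq_square power3_eq_cube)
    moreover have "0 \<le> 3 / 8 * (s - 4 / 3 * D)\<^sup>2 * M / D" using assms by simp
    ultimately show ?thesis by linarith
  next
    case False
    \<comment> \<open>The parabola passes height 1 at z = M r; to the left of that point the layer
      is full.\<close>
    define r where "r = sqrt (1 - s / D)"
    have r: "0 \<le> r" "r \<le> 1" "r\<^sup>2 = 1 - s / D" using False assms by (auto simp: r_def)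
    have s: "s = D * (1 - r\<^sup>2)" using assms r by simp
    define e where "e = M * r"
    have e: "0 \<le> e" "e \<le> M" using r assms by (auto simp: e_def mult_left_le)
    have c1: "continuous_on {0..e} f" and c2: "continuous_on {e..M} f"
      using assms(1) e by (auto elim!: continuous_on_subset)
    have q: "D * (1 - (z / M)\<^sup>2) - s = D * (r\<^sup>2 - (z / M)\<^sup>2)" for z by (simp add: s algebra_simps)
    have "((\<lambda>z. 1 :: real) has_integral (e - 0)) {0..e}"
    using e has_integral_const_real[of "1 :: real" 0 e] by simp
    then have "e - 0 \<le> integral {0..e} f"
    proof (rule integral_ge_has_integral[OF _ c1])
      fix z assume z: "0 \<le> z" "z \<le> e"
      then have "z / M \<le> r" using assms by (simp add: e_def divide_le_eq mult.commute)
      then have "(z / M)\<^sup>2 \<le> r\<^sup>2" using z assms by (intro power_mono) auto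
      then have "0 \<le> D * (1 - (z / M)\<^sup>2) - s" unfolding q using assms by simp
      then show "1 \<le> f z" using assms(5)[of z] z e by simp
    qed
    moreover have "F M - F e \<le> integral {e..M} f"
    proof (rule integral_ge_has_integral[OF F[OF e(2)] c2])
      fix z assume z: "e \<le> z" "z \<le> M"
      then have "r \<le> z / M" using assms by (simp add: e_def le_divide_eq mult.commute)
      then have "r\<^sup>2 \<le> (z / M)\<^sup>2" using r by (intro power_mono) auto
      then have "D * (1 - (z / M)\<^sup>2) - s \<le> 0" unfolding q using assms by (simp add: mult_nonneg_nonpos)
      then show "1 - s + D * (1 - (z / M)\<^sup>2) \<le> f z" using assms(5)[of z] z e by simp
    qed
    moreover have "e + (F M - F e) - (M - 3 / 8 * s\<^sup>2 * M / D) = D * M * (1 - r)\<^sup>2 * (1 + 2 * r + 9 * r\<^sup>2) / 24"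
    proof -
      have "M - 3 / 8 * s\<^sup>2 * M / D = M - 3 / 8 * D * (1 - r\<^sup>2)\<^sup>2 * M"
        unfolding s using assms by (simp add: power_mult_distrib power2_eq_square)
      moreover have "F M - F e = (1 - s + D) * (M - M * r) - D * M * (1 - r ^ 3) / 3"
        using assms by (simp add: F_def e_def power_mult_distrib field_simps power2_eq_square power3_eq_cube)
      ultimately have "e + (F M - F e) - (M - 3 / 8 * s\<^sup>2 * M / D)
          = M * r + ((1 - s + D) * (M - M * r) - D * M * (1 - r ^ 3) / 3) - (M - 3 / 8 * D * (1 - r\<^sup>2)\<^sup>2 * M)"
        by (simp add: e_def)
      also have "\<dots> = D * M * (1 - r)\<^sup>2 * (1 + 2 * r + 9 * r\<^sup>2) / 24"
        unfolding s by (simp add: field_simps power2_eq_square power3_eq_cube)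
      finally show ?thesis .
    qed
    moreover have "0 \<le> D * M * (1 - r)\<^sup>2 * (1 + 2 * r + 9 * r\<^sup>2) / 24" using assms r(1) by simp
    ultimately show ?thesis using integral_split[OF e assms(1)] by linarith
  qed
qed

text \<open>\<open>clip (x - (k - 1))\<close> is the length of the part of the segment from 0 to x
  between heights k - 1 and k, so layers become integrals of continuous functions.\<close>

definition clip :: "real \<Rightarrow> real" where "clip x = min 1 (max 0 x)"

lemma clip_bounds: "0 \<le> clip x" "clip x \<le> 1" "x \<le> 1 \<Longrightarrow> x \<le> clip x" "min 1 x \<le> clip x"
  "x \<le> y \<Longrightarrow> clip x \<le> clip y"
  by (auto simp: clip_def)

definition layer :: "real \<Rightarrow> real \<Rightarrow> real \<Rightarrow> real" where
  "layer l m k = integral {0..l} (\<lambda>z. clip (G_fun l z - G_fun m z - (k - 1)))"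

lemma clip_continuous:
  assumes "0 \<le> m" "0 \<le> l" "0 \<le> a"
  shows "continuous_on {a..b} (\<lambda>z. clip (G_fun l z - G_fun m z - (k - 1)))"
  unfolding clip_def using assms by (intro continuous_intros) auto

lemma layer_split:
  assumes "0 \<le> m" "0 \<le> M" "M \<le> l"
  shows "layer l m k = integral {0..M} (\<lambda>z. clip (G_fun l z - G_fun m z - (k - 1)))
     + integral {M..l} (\<lambda>z. clip (G_fun l z - G_fun m z - (k - 1)))"
  unfolding layer_def using assms by (intro integral_split clip_continuous) auto

lemma layer_nonneg:
  assumes "0 \<le> m" "0 \<le> l"
  shows "0 \<le> layer l m k"
  unfolding layer_def using assms
  by (intro integral_nonneg integrable_continuous_real clip_continuous clip_bounds) auto

lemma layer_antimono:
  assumes "0 \<le> m" "m \<le> m'" "0 < l"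
  shows "layer l m' k \<le> layer l m k"
  unfolding layer_def using assms
  by (intro integral_le integrable_continuous_real clip_continuous clip_bounds)
     (auto simp: G_fun_mono_radius)

lemma sum_clip: "0 \<le> x \<Longrightarrow> (\<Sum>k=1..N. clip (x - (real k - 1))) = min x (real N)"
  by (induction N) (auto simp: clip_def)

text \<open>Finitely many clipped heights add up to \<open>min x N\<close>, hence an inequality. The
  case m = 0 is separate because the integral formula is stated for positive radius.\<close>

lemma sum_layer_le:
  assumes "0 \<le> m" "m \<le> l" "0 < l"
  shows "(\<Sum>k=1..N. layer l m (real k)) \<le> (l\<^sup>2 - m\<^sup>2) / 8"
proof -
  have Gm: "(G_fun m has_integral m\<^sup>2 / 8) {0..l}"
  proof (cases "m = 0")
    case True
    then show ?thesis
      using has_integral_is_0[of "{0..l}" "G_fun m"] by (simp add: G_fun_eq_0)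
  next
    case False
    have "(G_fun m has_integral 0) {m..l}"
      by (rule has_integral_is_0) (use assms in \<open>auto simp: G_fun_eq_0\<close>)
    then have "(G_fun m has_integral m\<^sup>2 / 8 + 0) {0..l}"
      using False assms by (intro has_integral_combine[OF assms(1,2) G_fun_integral[of m]]) auto
    then show ?thesis by simp
  qed
  have "(\<Sum>k=1..N. layer l m (real k)) = integral {0..l} (\<lambda>z. \<Sum>k=1..N. clip (G_fun l z - G_fun m z - (real k - 1)))"
    unfolding layer_def using assms
    by (intro integral_sum[symmetric] integrable_continuous_real clip_continuous) auto
  also have "\<dots> \<le> integral {0..l} (\<lambda>z. G_fun l z - G_fun m z)"
  proof (rule integral_le)
    show "(\<lambda>z. \<Sum>k=1..N. clip (G_fun l z - G_fun m z - (real k - 1))) integrable_on {0..l}"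
      using assms by (intro integrable_sum integrable_continuous_real clip_continuous) auto
    show "(\<lambda>z. G_fun l z - G_fun m z) integrable_on {0..l}"
      using assms by (intro integrable_continuous_real continuous_intros) auto
    fix z assume "z \<in> {0..l}"
    then show "(\<Sum>k=1..N. clip (G_fun l z - G_fun m z - (real k - 1))) \<le> G_fun l z - G_fun m z"
      using assms G_fun_mono_radius[of m l z] by (subst sum_clip) auto
  qed
  also have "\<dots> = l\<^sup>2 / 8 - m\<^sup>2 / 8"
    using has_integral_diff[OF G_fun_integral[OF assms(3)] Gm] by (simp add: integral_unique)
  finally show ?thesis by simp
qed

section \<open>The decrease of G between 0 and M\<close>

lemma G_fun_drop:
  assumes "0 < M" "M \<le> L"
  obtains t where "0 < t" "t \<le> 1" "M / L = 2 * t / (1 + t\<^sup>2)" "arccos (M / L) = pi / 2 - 2 * arctan t"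
    "sqrt (1 - (M / L)\<^sup>2) = (1 - t\<^sup>2) / (1 + t\<^sup>2)"
    "G_fun L M = M / pi * ((1 - t\<^sup>2) / (2 * t) - pi / 2 + 2 * arctan t)"
    "G_fun L 0 - G_fun L M = M / pi * (pi / 2 - (2 * arctan t - t))"
proof -
  obtain t where "0 < t" "t \<le> 1" "M / L = 2 * t / (1 + t\<^sup>2)"
    "sqrt (1 - (M / L)\<^sup>2) = (1 - t\<^sup>2) / (1 + t\<^sup>2)" "arccos (M / L) = pi / 2 - 2 * arctan t"
    using half_angle_param[of "M / L"] assms by auto
  then show ?thesis using G_fun_half_angle[of t M L] assms that[of t] by simp
qed

text \<open>The variable part of the drop \<open>G_fun L 0 - G_fun L M\<close>, which is M / pi
  times pi / 2 - \<open>Psi t\<close>. The drop of G_l - G_m is then proportional to a difference of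
  two values of \<open>Psi\<close>.\<close>

definition Psi :: "real \<Rightarrow> real" where "Psi t = 2 * arctan t - t"

text \<open>The subtracted term t / (1 + t^2) is half of M / L, which converts the second bound into
  one in terms of radii. The derivative of the difference is x^2 (1 - x^2) / (1 + x^2)^2.\<close>

lemma Psi_mono:
  assumes "0 \<le> t" "t \<le> u" "u \<le> 1"
  shows "Psi t \<le> Psi u" "u / (1 + u\<^sup>2) - t / (1 + t\<^sup>2) \<le> Psi u - Psi t"
proof -
  have nz: "1 + x\<^sup>2 \<noteq> 0" for x :: real by (simp add: add_nonneg_eq_0_iff)
  have d: "(Psi has_real_derivative (2 / (1 + x\<^sup>2) - 1)) (at x)" for x
    unfolding Psi_def by (auto intro!: derivative_eq_intros simp: field_simps nz)
  have c: "continuous_on A Psi" for A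
    by (intro continuous_at_imp_continuous_on ballI DERIV_isCont[OF d])
  show "Psi t \<le> Psi u"
  proof (rule mono_by_deriv[OF assms(2) c d])
    fix x assume "t < x" "x < u"
    then have "x\<^sup>2 \<le> 1" using assms by (simp add: power_le_one)
    then show "0 \<le> 2 / (1 + x\<^sup>2) - 1" using nz by (simp add: field_simps add_nonneg_pos)
  qed
  have "Psi t - t / (1 + t\<^sup>2) \<le> Psi u - u / (1 + u\<^sup>2)"
  proof (rule mono_by_deriv[OF assms(2), where f' = "\<lambda>x. 2 / (1 + x\<^sup>2) - 1 - (1 - x\<^sup>2) / (1 + x\<^sup>2)\<^sup>2"])
    show "continuous_on {t..u} (\<lambda>x. Psi x - x / (1 + x\<^sup>2))"
      using nz by (intro continuous_intros c) auto
    fix x assume x: "t < x" "x < u"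
    show "((\<lambda>x. Psi x - x / (1 + x\<^sup>2)) has_real_derivative 2 / (1 + x\<^sup>2) - 1 - (1 - x\<^sup>2) / (1 + x\<^sup>2)\<^sup>2) (at x)"
    proof (rule DERIV_diff[OF d])
      have "((\<lambda>x. x / (1 + x\<^sup>2)) has_real_derivative (1 * (1 + x\<^sup>2) - x * (2 * x)) / ((1 + x\<^sup>2) * (1 + x\<^sup>2))) (at x)"
        using nz by (auto intro!: derivative_eq_intros)
      then show "((\<lambda>x. x / (1 + x\<^sup>2)) has_real_derivative (1 - x\<^sup>2) / (1 + x\<^sup>2)\<^sup>2) (at x)"
        by (simp add: power2_eq_square)
    qed
    have "2 / (1 + x\<^sup>2) - 1 - (1 - x\<^sup>2) / (1 + x\<^sup>2)\<^sup>2 = x\<^sup>2 * (1 - x\<^sup>2) / (1 + x\<^sup>2)\<^sup>2"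
      using nz[of x] by (simp add: divide_simps) (simp add: power2_eq_square algebra_simps)
    moreover have "x\<^sup>2 \<le> 1" using assms x by (simp add: power_le_one)
    ultimately show "0 \<le> 2 / (1 + x\<^sup>2) - 1 - (1 - x\<^sup>2) / (1 + x\<^sup>2)\<^sup>2" by simp
  qed
  then show "u / (1 + u\<^sup>2) - t / (1 + t\<^sup>2) \<le> Psi u - Psi t" by simp
qed

lemma G_diff_drop:
  assumes "0 < M" "M \<le> m" "m \<le> l"
  shows "M / pi * ((M / m - M / l) / 2) \<le> (G_fun l 0 - G_fun m 0) - (G_fun l M - G_fun m M)"
proof -
  obtain t where t: "0 < t" "t \<le> 1" "M / l = 2 * t / (1 + t\<^sup>2)" "arccos (M / l) = pi / 2 - 2 * arctan t"
    "G_fun l 0 - G_fun l M = M / pi * (pi / 2 - (2 * arctan t - t))"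
    using G_fun_drop[OF assms(1) order_trans[OF assms(2,3)]] by blast
  obtain u where u: "0 < u" "u \<le> 1" "M / m = 2 * u / (1 + u\<^sup>2)" "arccos (M / m) = pi / 2 - 2 * arctan u"
    "G_fun m 0 - G_fun m M = M / pi * (pi / 2 - (2 * arctan u - u))"
    using G_fun_drop[OF assms(1,2)] by blast
  have "arctan t \<le> arctan u" using arccos_mono_scale[of m l M] assms t(4) u(4) by simp
  then have "t \<le> u" by (simp add: arctan_le_iff)
  then have "(M / m - M / l) / 2 \<le> Psi u - Psi t"
    using Psi_mono(2)[of t u] t u by simp
  then have "M / pi * ((M / m - M / l) / 2) \<le> M / pi * (Psi u - Psi t)"
    using assms by (intro mult_left_mono) auto
  also have "\<dots> = (G_fun l 0 - G_fun l M) - (G_fun m 0 - G_fun m M)"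
    unfolding t(5) u(5) Psi_def by (simp add: right_diff_distrib)
  finally show ?thesis by simp
qed

lemma G_diff_nonneg:
  assumes "0 \<le> m" "m \<le> l" "0 \<le> z"
  shows "0 \<le> G_fun l z - G_fun m z"
  using G_fun_mono_radius[OF assms] by simp

section \<open>Area of a single layer\<close>

lemma layer_right_ge:
  assumes "0 \<le> m" "0 < l" "0 \<le> M" "0 < c" "0 \<le> p" "p \<le> 1" "M + p / c \<le> l"
    and "\<And>z. M \<le> z \<Longrightarrow> z \<le> l \<Longrightarrow> p - c * (z - M) \<le> G_fun l z - G_fun m z - (k - 1)"
  shows "p\<^sup>2 / (2 * c) \<le> integral {M..l} (\<lambda>z. clip (G_fun l z - G_fun m z - (k - 1)))"
proof (rule integral_ge_triangle_right[OF _ _ assms(4,5,7)])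
  show "continuous_on {M..l} (\<lambda>z. clip (G_fun l z - G_fun m z - (k - 1)))"
    using assms by (intro clip_continuous) auto
  fix z assume z: "M \<le> z" "z \<le> l"
  have "0 \<le> c * (z - M)" using assms z by simp
  then have "p - c * (z - M) \<le> 1" using assms(6) by linarith
  then show "p - c * (z - M) \<le> clip (G_fun l z - G_fun m z - (k - 1))"
    using clip_bounds(3)[of "p - c * (z - M)"] clip_bounds(5)[OF assms(8)[OF z]] by linarith
qed (simp add: clip_bounds)

lemma level_below_outer_radius:
  assumes "0 \<le> m" "m \<le> l" "0 < l" "0 < G_fun l M - G_fun m M"
  shows "M < l"
  using assms by (cases "M < l") (auto simp: G_fun_eq_0)

text \<open>Without a shift nothing is lost on the left, and slope at most 1/2 yields a triangle of
  height 1 and width 2 on the right.\<close>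

lemma layer_above:
  assumes "0 \<le> m" "m \<le> l" "0 < l" "0 \<le> M" "1 \<le> k" "k \<le> G_fun l M - G_fun m M"
  shows "M + 1 \<le> layer l m k"
proof -
  have Ml: "M < l" using level_below_outer_radius[of m l M] assms by simp
  have lip: "G_fun l M - G_fun m M - 1 / 2 * (z - M) \<le> G_fun l z - G_fun m z" if "M \<le> z" "z \<le> l" for z
  proof -
    have "0 \<le> m / (l * pi) * (z - M)" using assms that by simp
    moreover have "G_fun l M - G_fun m M - (1 / 2 * (z - M) - m / (l * pi) * (z - M)) \<le> G_fun l z - G_fun m z"
      using G_diff_lipschitz[of m l M z] assms that unfolding left_diff_distrib by simp
    ultimately show ?thesis by linarith
  qed
  have "(1::real)\<^sup>2 / (2 * (1 / 2)) \<le> integral {M..l} (\<lambda>z. clip (G_fun l z - G_fun m z - (k - 1)))"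
  proof (rule layer_right_ge)
    show "M + 1 / (1 / 2) \<le> l"
      using lip[of l] Ml assms by (simp add: G_fun_eq_0)
    fix z assume "M \<le> z" "z \<le> l"
    then show "1 - 1 / 2 * (z - M) \<le> G_fun l z - G_fun m z - (k - 1)" using lip[of z] assms by simp
  qed (use assms in auto)
  moreover have "1 * M \<le> integral {0..M} (\<lambda>z. clip (G_fun l z - G_fun m z - (k - 1)))"
  proof (rule integral_ge_has_integral)
    show "((\<lambda>z. 1) has_integral (1 * M)) {0..M}" using has_integral_const_real[of "1::real" 0 M] assms by simp
    fix z assume "0 \<le> z" "z \<le> M"
    then show "1 \<le> clip (G_fun l z - G_fun m z - (k - 1))"
      using G_diff_antimono[of m l z M] assms by (simp add: clip_def)
  qed (use assms clip_continuous in auto)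
  ultimately show ?thesis using layer_split[of m M l k] assms Ml by simp
qed

text \<open>The last assumption fills the layer up to \<open>m\<close>, so the whole loss occurs
  where the tangent of \<open>G_fun l\<close> applies. Gain minus loss is (1 - 2 s) / (2 c).\<close>

lemma layer_convex:
  assumes "0 \<le> m" "m \<le> M" "0 < M" "M < l" "1 \<le> k" "k - 1 / 4 \<le> G_fun l M" "G_fun l M \<le> k"
    "k \<le> G_fun l m - G_fun m m"
  shows "M + 1 / 2 < layer l m k"
proof -
  define s where "s = k - G_fun l M"
  define c where "c = arccos (M / l) / pi"
  have s: "0 \<le> s" "s \<le> 1 / 4" using assms by (auto simp: s_def)
  have u: "M / l < 1" "0 < M / l" using assms by auto
  have c2: "c < 1 / 2"
  proof -
    have "c \<le> 1 / 2 - M / (l * pi)"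
      unfolding c_def using assms by (intro arccos_div_bounds) auto
    moreover have "0 < M / (l * pi)" using assms by simp
    ultimately show ?thesis by linarith
  qed
  have tan: "G_fun l M - c * (z - M) \<le> G_fun l z" if "0 \<le> z" for z
    using G_fun_tangent[of l M z] assms that by (simp add: c_def)
  have c0: "0 < c"
  proof -
    have "0 < c * (l - M)" using tan[of l] assms by (simp add: G_fun_eq_0)
    then show ?thesis using assms by (simp add: zero_less_mult_iff)
  qed
  have Gm: "G_fun m z = 0" if "m \<le> z" for z using that assms by (simp add: G_fun_eq_0)
  have R: "(1 - s)\<^sup>2 / (2 * c) \<le> integral {M..l} (\<lambda>z. clip (G_fun l z - G_fun m z - (k - 1)))"
  proof (rule layer_right_ge)
    have "1 - s \<le> c * (l - M)" using tan[of l] assms by (simp add: s_def G_fun_eq_0)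
    then show "M + (1 - s) / c \<le> l" using c0 by (simp add: field_simps)
    fix z assume "M \<le> z" "z \<le> l"
    then show "1 - s - c * (z - M) \<le> G_fun l z - G_fun m z - (k - 1)"
      using tan[of z] Gm[of z] assms by (simp add: s_def)
  qed (use assms s c0 in auto)
  have L: "M - s\<^sup>2 / (2 * c) \<le> integral {0..M} (\<lambda>z. clip (G_fun l z - G_fun m z - (k - 1)))"
  proof (rule integral_ge_triangle_left[OF clip_continuous])
    fix z assume z: "0 \<le> z" "z \<le> M"
    show "min 1 (1 - s + c * (M - z)) \<le> clip (G_fun l z - G_fun m z - (k - 1))"
    proof (cases "m \<le> z")
      case True
      then have "1 - s + c * (M - z) \<le> G_fun l z - G_fun m z - (k - 1)"
        using tan[of z] Gm[of z] z by (simp add: s_def algebra_simps)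
      then show ?thesis by (auto simp: clip_def)
    next
      case False
      then have "1 \<le> G_fun l z - G_fun m z - (k - 1)"
        using G_diff_antimono[of m l z m] assms z by simp
      then show ?thesis by (auto simp: clip_def)
    qed
  qed (use assms s c0 in auto)
  have "1 / 2 < (1 - 2 * s) / (2 * c)" using s c0 c2 by (simp add: field_simps)
  also have "\<dots> = (1 - s)\<^sup>2 / (2 * c) - s\<^sup>2 / (2 * c)"
    using c0 by (simp add: field_simps power2_eq_square)
  finally show ?thesis using R L layer_split[of m M l k] assms by simp
qed

text \<open>\<open>49/160 = 27/80 - 1/32\<close>: gain \<open>3/5 (3/4)\<^sup>2\<close> to the right of \<open>z\<close>, loss \<open>(1/4)\<^sup>2 / 2\<close> to the left.\<close>

lemma layer_first:
  assumes "0 \<le> m" "m \<le> z" "z < l" "0 \<le> z" "G_fun l z = 3 / 4" "1 \<le> G_fun l m - G_fun m m"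
  shows "z + 49 / 160 / (arccos (z / l) / pi) \<le> layer l m 1"
proof -
  define c where "c = arccos (z / l) / pi"
  have tan: "G_fun l z - c * (y - z) \<le> G_fun l y" if "0 \<le> y" for y
    using G_fun_tangent[of l z y] assms that by (simp add: c_def)
  have c0: "0 < c"
  proof -
    have "0 < c * (l - z)" using tan[of l] assms by (simp add: G_fun_eq_0)
    then show ?thesis using assms by (simp add: zero_less_mult_iff)
  qed
  have Gm: "G_fun m y = 0" if "m \<le> y" for y using that assms by (simp add: G_fun_eq_0)
  have L: "z - (1 / 4)\<^sup>2 / (2 * c) \<le> integral {0..z} (\<lambda>y. clip (G_fun l y - G_fun m y - (1 - 1)))"
  proof (rule integral_ge_triangle_left[OF clip_continuous])
    fix y assume y: "0 \<le> y" "y \<le> z"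
    show "min 1 (1 - 1 / 4 + c * (z - y)) \<le> clip (G_fun l y - G_fun m y - (1 - 1))"
    proof (cases "m \<le> y")
      case True
      then have "1 - 1 / 4 + c * (z - y) \<le> G_fun l y - G_fun m y - (1 - 1)"
        using tan[of y] Gm[of y] y assms by (simp add: algebra_simps)
      then show ?thesis by (auto simp: clip_def)
    next
      case False
      then have "1 \<le> G_fun l y - G_fun m y - (1 - 1)"
        using G_diff_antimono[of m l y m] assms y by simp
      then show ?thesis by (auto simp: clip_def)
    qed
  qed (use assms c0 in auto)
  have "integral {z..l} (\<lambda>y. clip (G_fun l y - G_fun m y - (1 - 1))) = integral {z..l} (G_fun l)"
  proof (rule integral_cong)
    fix y assume "y \<in> {z..l}"
    then show "clip (G_fun l y - G_fun m y - (1 - 1)) = G_fun l y"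
      using G_fun_antimono[of l z y] Gm[of y] G_fun_nonneg[of l y] assms by (simp add: clip_def)
  qed
  then have R: "3 / 5 * (3 / 4)\<^sup>2 / c \<le> integral {z..l} (\<lambda>y. clip (G_fun l y - G_fun m y - (1 - 1)))"
    using G_fun_tail_integral[of l z] assms by (simp add: c_def)
  have "49 / 160 / c = 3 / 5 * (3 / 4)\<^sup>2 / c - (1 / 4)\<^sup>2 / (2 * c)"
    using c0 by (simp add: field_simps power2_eq_square)
  then show ?thesis using L R layer_split[of m z l 1] assms by (simp add: c_def)
qed

lemma H_fun_alt:
  assumes "0 \<le> z" "z < m"
  shows "H_fun m z = (3 * m\<^sup>2 + 2 * z\<^sup>2) / (24 * pi * ((m\<^sup>2 - z\<^sup>2) * sqrt (m\<^sup>2 - z\<^sup>2)))"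
proof -
  have "0 < m\<^sup>2 - z\<^sup>2" using assms by (simp add: power_strict_mono)
  then have "(m\<^sup>2 - z\<^sup>2) powr (3 / 2) = (m\<^sup>2 - z\<^sup>2) * sqrt (m\<^sup>2 - z\<^sup>2)"
    using powr_add[of "m\<^sup>2 - z\<^sup>2" 1 "1/2"] by (simp add: powr_half_sqrt)
  then show ?thesis by (simp add: H_fun_def)
qed

text \<open>The product depends only on z / m and increases with it; at 3/4 its value is just below
  0.142. The constant 0.6614 approximates sqrt 7 / 4 from below.\<close>

lemma mult_H_fun_le:
  assumes "0 \<le> z" "z \<le> 3 / 4 * m" "0 < m"
  shows "z * H_fun m z \<le> 71 / 500"
proof -
  define w where "w = m\<^sup>2 - z\<^sup>2"
  have "z\<^sup>2 \<le> (3 / 4 * m)\<^sup>2" using assms by (intro power_mono) auto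
  then have z2: "z\<^sup>2 \<le> 9 / 16 * m\<^sup>2" by (simp add: power2_eq_square)
  then have w: "7 / 16 * m\<^sup>2 \<le> w" by (simp add: w_def)
  have "((6614 / 10000) * m)\<^sup>2 \<le> 7 / 16 * m\<^sup>2" by (simp add: power2_eq_square)
  then have "(6614 / 10000) * m \<le> sqrt w" using w by (intro real_le_rsqrt) linarith
  moreover have "0 \<le> 7 / 16 * m\<^sup>2" by simp
  then have "0 \<le> w" using w by linarith
  ultimately have ww: "7 / 16 * m\<^sup>2 * ((6614 / 10000) * m) \<le> w * sqrt w" using w assms by (intro mult_mono) auto
  have m3: "0 < m ^ 3" using assms by simp
  have "24 * (31415 / 10000) * (7 / 16 * m\<^sup>2 * ((6614 / 10000) * m)) \<le> 24 * pi * (w * sqrt w)"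
    using pi_approx assms by (intro mult_mono ww) auto
  then have den: "(218 / 10) * m ^ 3 \<le> 24 * pi * (w * sqrt w)"
    using m3 by (simp add: power2_eq_square power3_eq_cube algebra_simps)
  have "z * (3 * m\<^sup>2 + 2 * z\<^sup>2) \<le> 3 / 4 * m * (3 * m\<^sup>2 + 2 * (9 / 16 * m\<^sup>2))"
    using assms z2 by (intro mult_mono) auto
  then have num: "z * (3 * m\<^sup>2 + 2 * z\<^sup>2) \<le> (3094 / 1000) * m ^ 3"
    using m3 by (simp add: power2_eq_square power3_eq_cube algebra_simps)
  have "z * H_fun m z = z * (3 * m\<^sup>2 + 2 * z\<^sup>2) / (24 * pi * (w * sqrt w))"
    using H_fun_alt[of z m] assms by (simp add: w_def)
  also have "\<dots> \<le> (3094 / 1000) * m ^ 3 / ((218 / 10) * m ^ 3)"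
    using num den m3 assms by (intro frac_le) auto
  also have "\<dots> \<le> 71 / 500" using m3 by simp
  finally show ?thesis .
qed

text \<open>Here r stands for m / l and p for pi: a gain with height 0.81 and slope 1/2 - r / p
  against the parabola loss 0.19^2 p / (1 - r). The inequality fails soon after r = 22/25, already
  at 0.89.\<close>

lemma slope_loss_poly:
  fixes r :: real
  assumes "0 \<le> r" "r \<le> 22 / 25" "(31415 / 10000) \<le> p" "p \<le> (31416 / 10000)"
  shows "1 / 2 < (6561 / 10000) / (2 * (1 / 2 - r / p)) - (361 / 10000) * p / (1 - r)"
proof -
  have "r / p \<le> (22 / 25) / (31415 / 10000)" using assms by (intro frac_le) auto
  then have rp: "r / p \<le> 2802 / 10000" by simp
  have "r / (31416 / 10000) \<le> r / p" using assms by (intro divide_left_mono) auto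
  then have rp2: "1250 / 3927 * r \<le> r / p" by simp
  define c where "c = 1 - 2500 / 3927 * r"
  have c: "0 < 1 - 2 * (r / p)" "1 - 2 * (r / p) \<le> c"
    unfolding c_def using rp rp2 by linarith+
  have r1: "0 < 1 - r" using assms by simp
  have "(361 / 10000) * p / (1 - r) \<le> (361 / 10000) * (31416 / 10000) / (1 - r)" using assms by (intro divide_right_mono) auto
  moreover have "(6561 / 10000) / c \<le> (6561 / 10000) / (1 - 2 * (r / p))" using c by (intro divide_left_mono) auto
  moreover have "1 / 2 + (361 / 10000) * (31416 / 10000) / (1 - r) < (6561 / 10000) / c"
  proof -
    have "r * r \<le> 22 / 25 * r" using assms by (intro mult_right_mono) auto
    then have "613411760 / 1000000000 - (1 / 2 + 2500 / 3927 * (613411760 / 1000000000)) * r + 1250 / 3927 * (r * r)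
        < (6561 / 10000) * (1 - r)"
      using assms(1,2) by (simp add: algebra_simps)
    moreover have "(1 / 2 * (1 - r) + (361 / 10000) * (31416 / 10000)) * c
        = 613411760 / 1000000000 - (1 / 2 + 2500 / 3927 * (613411760 / 1000000000)) * r + 1250 / 3927 * (r * r)"
      by (simp add: c_def field_simps)
    ultimately have "(1 / 2 * (1 - r) + (361 / 10000) * (31416 / 10000)) * c < (6561 / 10000) * (1 - r)"
      by simp
    then show ?thesis using r1 c by (simp add: field_simps)
  qed
  ultimately show ?thesis by simp
qed

text \<open>For \<open>M \<le> 3 / 4 * m\<close> a rectangle of height 1 - s loses only M s, at most
  0.142 by the bound on M H, while the right gains at least 0.6561. Closer to \<open>m\<close> the
  parabola is used; M / m > 3/4 then keeps its height \<open>D\<close> large. The gain uses the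
  slope reduced by m / (l pi).\<close>

lemma layer_concave:
  assumes "0 \<le> M" "M < m" "m \<le> 22 / 25 * l" "1 \<le> k"
    "G_fun l M - G_fun m M \<le> k" "k - (G_fun l M - G_fun m M) \<le> 19 / 100"
    "k - (G_fun l M - G_fun m M) \<le> H_fun m M"
  shows "M + 1 / 2 < layer l m k"
proof -
  define p where "p = (\<lambda>z. G_fun l z - G_fun m z)"
  define s where "s = k - p M"
  define c where "c = 1 / 2 - m / (l * pi)"
  have s: "0 \<le> s" "s \<le> 19 / 100" using assms by (auto simp: s_def p_def)
  have l0: "0 < l" "m < l" "M < l" using assms by auto
  define r where "r = m / l"
  have r: "0 \<le> r" "r \<le> 22 / 25" using assms l0 by (auto simp: r_def divide_le_eq)
  have cr: "c = 1 / 2 - r / pi" using l0 by (simp add: c_def r_def)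
  have "r / pi \<le> (22 / 25) / 3" using r pi_gt3 by (intro frac_le) auto
  then have c0: "0 < c" unfolding cr by linarith
  have "0 \<le> r / pi" using r by simp
  then have c2: "c \<le> 1 / 2" unfolding cr by linarith
  have lip: "p M - c * (z - M) \<le> p z" if "M \<le> z" "z \<le> l" for z
    using G_diff_lipschitz[of m l M z] assms that l0 by (simp add: c_def p_def)
  have "(1 - s)\<^sup>2 / (2 * c) \<le> integral {M..l} (\<lambda>z. clip (G_fun l z - G_fun m z - (k - 1)))"
  proof (rule layer_right_ge)
    have "1 - s \<le> c * (l - M)" using lip[of l] assms l0 by (simp add: s_def p_def G_fun_eq_0)
    then show "M + (1 - s) / c \<le> l" using c0 by (simp add: field_simps)
    fix z assume "M \<le> z" "z \<le> l"
    then show "1 - s - c * (z - M) \<le> G_fun l z - G_fun m z - (k - 1)"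
      using lip[of z] by (simp add: s_def p_def)
  qed (use assms s c0 l0 in auto)
  moreover have "(81 / 100)\<^sup>2 / (2 * c) \<le> (1 - s)\<^sup>2 / (2 * c)"
    using s c0 by (intro divide_right_mono power_mono) auto
  ultimately have R: "(6561 / 10000) / (2 * c) \<le> integral {M..l} (\<lambda>z. clip (G_fun l z - G_fun m z - (k - 1)))"
    by (simp add: power2_eq_square)
  have cont: "continuous_on {0..M} (\<lambda>z. clip (G_fun l z - G_fun m z - (k - 1)))"
    using assms l0 by (intro clip_continuous) auto
  note split = layer_split[of m M l k]
  show ?thesis
  proof (cases "M \<le> 3 / 4 * m")
    case True
    have "((\<lambda>z. 1 - s) has_integral ((1 - s) * M)) {0..M}"
      using has_integral_const_real[of "1 - s" 0 M] assms by (simp add: mult.commute)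
    then have "(1 - s) * M \<le> integral {0..M} (\<lambda>z. clip (G_fun l z - G_fun m z - (k - 1)))"
    proof (rule integral_ge_has_integral[OF _ cont])
      fix z assume "0 \<le> z" "z \<le> M"
      then show "1 - s \<le> clip (G_fun l z - G_fun m z - (k - 1))"
        using G_diff_antimono[of m l z M] assms s l0 by (auto simp: clip_def s_def p_def)
    qed
    moreover have "M * s \<le> M * H_fun m M" using assms by (intro mult_left_mono) (auto simp: s_def p_def)
    then have "M * s \<le> 71 / 500" using mult_H_fun_le[of M m] True assms by simp
    moreover have "(6561 / 10000) / 1 \<le> (6561 / 10000) / (2 * c)" using c0 c2 by (intro divide_left_mono) auto
    ultimately show ?thesis using R split assms l0 by (simp add: algebra_simps)
  next
    case False
    define D where "D = p 0 - p M"
    have M0: "0 < M" using False assms by simp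
    have "3 / 4 * (1 - r) \<le> M / m - M / l"
    proof -
      have "M / m - M / l = M / m * (1 - r)" using assms l0 by (simp add: r_def field_simps)
      moreover have "3 / 4 * (1 - r) \<le> M / m * (1 - r)"
        using False assms r by (intro mult_right_mono) (auto simp: le_divide_eq)
      ultimately show ?thesis by simp
    qed
    moreover have "3 / 4 * (1 - r) \<le> y \<Longrightarrow> 3 / 8 * (1 - r) \<le> y / 2" for y by linarith
    ultimately have h: "3 / 8 * (1 - r) \<le> (M / m - M / l) / 2" by blast
    have "M / pi * (3 / 8 * (1 - r)) \<le> M / pi * ((M / m - M / l) / 2)"
      using M0 by (intro mult_left_mono h) simp
    then have D: "M / pi * (3 / 8 * (1 - r)) \<le> D"
      using G_diff_drop[of M m l] assms M0 l0 by (simp add: D_def p_def)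
    have D1: "0 < M / pi * (3 / 8 * (1 - r))" using M0 r by simp
    have L: "M - 3 / 8 * s\<^sup>2 * M / D \<le> integral {0..M} (\<lambda>z. clip (G_fun l z - G_fun m z - (k - 1)))"
    proof (rule integral_ge_parabola_left[OF cont M0])
      show "0 < D" using D D1 by simp
      fix z assume z: "0 \<le> z" "z \<le> M"
      have "1 - s + D * (1 - (z / M)\<^sup>2) \<le> p z - (k - 1)"
        using G_diff_quadratic_chord[of M m l z] z assms l0 M0 by (simp add: D_def p_def s_def)
      then show "min 1 (1 - s + D * (1 - (z / M)\<^sup>2)) \<le> clip (G_fun l z - G_fun m z - (k - 1))"
        by (auto simp: clip_def p_def)
    qed (use s in auto)
    have "3 / 8 * s\<^sup>2 * M / D \<le> 3 / 8 * (361 / 10000) * M / (M / pi * (3 / 8 * (1 - r)))"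
    proof (rule frac_le)
      have "s\<^sup>2 \<le> (19 / 100)\<^sup>2" using s by (intro power_mono) auto
      then show "3 / 8 * s\<^sup>2 * M \<le> 3 / 8 * (361 / 10000) * M"
        using M0 by (intro mult_right_mono) (auto simp: power2_eq_square)
    qed (use D D1 M0 in auto)
    also have "\<dots> = (361 / 10000) * pi / (1 - r)" using M0 r by (simp add: field_simps)
    finally have "3 / 8 * s\<^sup>2 * M / D \<le> (361 / 10000) * pi / (1 - r)" .
    moreover have "1 / 2 < (6561 / 10000) / (2 * c) - (361 / 10000) * pi / (1 - r)"
      unfolding cr using slope_loss_poly[OF r, of pi] pi_approx by simp
    ultimately show ?thesis using L R split assms l0 by simp
  qed
qed

text \<open>\<open>clip\<close> is nondecreasing and 1-Lipschitz, so subtracting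
  \<open>G_fun m\<close> costs at most its own integral.\<close>

lemma integral_clip_diff:
  assumes "0 \<le> m" "0 < l" "0 \<le> a"
  shows "integral {a..b} (\<lambda>z. clip (G_fun l z - (k - 1))) - integral {a..b} (G_fun m)
    \<le> integral {a..b} (\<lambda>z. clip (G_fun l z - G_fun m z - (k - 1)))"
proof -
  have i: "(\<lambda>z. clip (G_fun l z - (k - 1))) integrable_on {a..b}" "G_fun m integrable_on {a..b}"
    using assms clip_continuous[of 0 l a b k]
    by (auto intro!: integrable_continuous_real continuous_intros simp: clip_def)
  have "integral {a..b} (\<lambda>z. clip (G_fun l z - (k - 1)) - G_fun m z)
    \<le> integral {a..b} (\<lambda>z. clip (G_fun l z - G_fun m z - (k - 1)))"
  proof (rule integral_le)
    show "(\<lambda>z. clip (G_fun l z - (k - 1)) - G_fun m z) integrable_on {a..b}"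
      using i by (rule integrable_diff)
    show "(\<lambda>z. clip (G_fun l z - G_fun m z - (k - 1))) integrable_on {a..b}"
      using assms by (intro integrable_continuous_real clip_continuous) auto
    fix z assume "z \<in> {a..b}"
    then show "clip (G_fun l z - (k - 1)) - G_fun m z \<le> clip (G_fun l z - G_fun m z - (k - 1))"
      using G_fun_nonneg[of m z] assms by (auto simp: clip_def)
  qed
  then show ?thesis using i by (simp add: integral_diff)
qed

lemma layer_tangent_right:
  assumes "0 < l" "0 \<le> M" "M < l" "1 \<le> k" "k - 1 / 4 \<le> G_fun l M"
  shows "9 / 32 / (arccos (M / l) / pi) \<le> integral {M..l} (\<lambda>z. clip (G_fun l z - (k - 1)))"
proof -
  define c where "c = arccos (M / l) / pi"
  have tan: "G_fun l M - c * (z - M) \<le> G_fun l z" if "0 \<le> z" for z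
    using G_fun_tangent[of l M z] assms that by (simp add: c_def)
  have c0: "0 < c"
  proof -
    have "0 < c * (l - M)" using tan[of l] assms by (simp add: G_fun_eq_0)
    then show ?thesis using assms by (simp add: zero_less_mult_iff)
  qed
  have "(3 / 4)\<^sup>2 / (2 * c) \<le> integral {M..l} (\<lambda>z. clip (G_fun l z - G_fun 0 z - (k - 1)))"
  proof (rule layer_right_ge)
    have "3 / 4 \<le> c * (l - M)" using tan[of l] assms by (simp add: G_fun_eq_0)
    then show "M + 3 / 4 / c \<le> l" using c0 by (simp add: field_simps)
    fix z assume "M \<le> z" "z \<le> l"
    then show "3 / 4 - c * (z - M) \<le> G_fun l z - G_fun 0 z - (k - 1)"
      using tan[of z] assms by (simp add: G_fun_eq_0)
  qed (use assms c0 in auto)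
  also have "\<dots> = integral {M..l} (\<lambda>z. clip (G_fun l z - (k - 1)))"
    by (rule integral_cong) (use assms in \<open>simp add: G_fun_eq_0\<close>)
  finally show ?thesis by (simp add: c_def power2_eq_square)
qed

text \<open>At 0 the value of H is 1 / (8 pi m), useless for small \<open>m\<close>. Instead the
  whole area m^2 / 8 under \<open>G_fun m\<close> is given up: 9/16 - 0.49/8 = 0.50125.\<close>

lemma layer_zero:
  assumes "0 \<le> m" "m \<le> 7 / 10" "m \<le> l" "0 < l" "1 \<le> k" "k - 1 / 4 \<le> G_fun l 0"
  shows "1 / 2 < layer l m k"
proof -
  have "9 / 32 / (arccos (0 / l) / pi) \<le> integral {0..l} (\<lambda>z. clip (G_fun l z - (k - 1)))"
    using layer_tangent_right[of l 0 k] assms by simp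
  moreover have "integral {0..l} (G_fun m) = m\<^sup>2 / 8"
  proof (cases "m = 0")
    case True
    have "integral {0..l} (G_fun m) = integral {0..l} (\<lambda>z. 0)"
      by (rule integral_cong) (use True in \<open>simp add: G_fun_eq_0\<close>)
    then show ?thesis using True by simp
  next
    case False
    have "integral {m..l} (G_fun m) = integral {m..l} (\<lambda>z. 0)"
      by (rule integral_cong) (use assms in \<open>simp add: G_fun_eq_0\<close>)
    then show ?thesis
      using integral_split[of 0 m l "G_fun m"] G_fun_integral[of m] False assms
      by (simp add: integral_unique G_fun_continuous_on)
  qed
  moreover have "m\<^sup>2 \<le> (7 / 10)\<^sup>2" using assms by (intro power_mono) auto
  ultimately show ?thesis
    using integral_clip_diff[of m l 0 l k] assms by (simp add: layer_def power2_eq_square)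
qed

section \<open>Numerical bounds\<close>

lemma pi_bounds:
  "31415 / 10000 \<le> pi" "pi \<le> 31416 / 10000" "7853981 / 10000000 \<le> pi / 4" "pi / 4 \<le> 7853982 / 10000000"
  using pi_approx by simp_all

text \<open>Truncated geometric series: the two differences have the derivatives x^8 / (1 + x^2) and
  x^10 / (1 + x^2).\<close>

lemma arctan_series_bounds:
  assumes "0 \<le> (x::real)"
  shows "x - x ^ 3 / 3 + x ^ 5 / 5 - x ^ 7 / 7 \<le> arctan x"
    "arctan x \<le> x - x ^ 3 / 3 + x ^ 5 / 5 - x ^ 7 / 7 + x ^ 9 / 9"
proof -
  have nz: "1 + y\<^sup>2 \<noteq> 0" for y :: real by (simp add: add_nonneg_eq_0_iff)
  have "(\<lambda>x. arctan x - (x - x ^ 3 / 3 + x ^ 5 / 5 - x ^ 7 / 7)) 0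
     \<le> (\<lambda>x. arctan x - (x - x ^ 3 / 3 + x ^ 5 / 5 - x ^ 7 / 7)) x"
  proof (rule mono_by_deriv[OF assms, where f' = "\<lambda>x. x ^ 8 / (1 + x\<^sup>2)"])
    fix y :: real
    show "((\<lambda>x. arctan x - (x - x ^ 3 / 3 + x ^ 5 / 5 - x ^ 7 / 7)) has_real_derivative y ^ 8 / (1 + y\<^sup>2)) (at y)"
      using nz[of y] by (auto intro!: derivative_eq_intros simp: divide_simps) (simp add: algebra_simps eval_nat_numeral)
  qed (auto intro!: continuous_intros)
  then show "x - x ^ 3 / 3 + x ^ 5 / 5 - x ^ 7 / 7 \<le> arctan x" by simp
  have "(\<lambda>x. x - x ^ 3 / 3 + x ^ 5 / 5 - x ^ 7 / 7 + x ^ 9 / 9 - arctan x) 0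
     \<le> (\<lambda>x. x - x ^ 3 / 3 + x ^ 5 / 5 - x ^ 7 / 7 + x ^ 9 / 9 - arctan x) x"
  proof (rule mono_by_deriv[OF assms, where f' = "\<lambda>x. x ^ 10 / (1 + x\<^sup>2)"])
    fix y :: real
    show "((\<lambda>x. x - x ^ 3 / 3 + x ^ 5 / 5 - x ^ 7 / 7 + x ^ 9 / 9 - arctan x) has_real_derivative y ^ 10 / (1 + y\<^sup>2)) (at y)"
      using nz[of y] by (auto intro!: derivative_eq_intros simp: divide_simps) (simp add: algebra_simps eval_nat_numeral)
  qed (auto intro!: continuous_intros)
  then show "arctan x \<le> x - x ^ 3 / 3 + x ^ 5 / 5 - x ^ 7 / 7 + x ^ 9 / 9" by simp
qed

text \<open>For x near 1 the new argument is small, so the truncated series becomes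
  accurate.\<close>

lemma arctan_complement:
  assumes "0 < x" "x \<le> (1::real)"
  shows "arctan x = pi / 4 - arctan ((1 - x) / (1 + x))"
proof -
  define y where "y = (1 - x) / (1 + x)"
  have y: "\<bar>y\<bar> < 1" using assms by (simp add: y_def)
  have p: "1 + x * x \<noteq> 0" by (simp add: add_nonneg_eq_0_iff)
  have "x + y = (1 + x * x) / (1 + x)" "1 - x * y = (1 + x * x) / (1 + x)"
    using assms by (simp_all add: y_def field_simps)
  then have "(x + y) / (1 - x * y) = 1" using p assms by simp
  moreover have "arctan x + arctan y = arctan ((x + y) / (1 - x * y))"
    using assms y by (intro arctan_add) auto
  ultimately have "arctan x + arctan y = pi / 4" by (simp only: arctan_one)
  then show ?thesis by (simp add: y_def)
qed

lemma arctan_ge_series: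
  "0 \<le> (x::real) \<Longrightarrow> a \<le> x - x ^ 3 / 3 + x ^ 5 / 5 - x ^ 7 / 7 \<Longrightarrow> a \<le> arctan x"
  using arctan_series_bounds(1)[of x] by simp

lemma arctan_le_series:
  "0 \<le> (x::real) \<Longrightarrow> x - x ^ 3 / 3 + x ^ 5 / 5 - x ^ 7 / 7 + x ^ 9 / 9 \<le> a \<Longrightarrow> arctan x \<le> a"
  using arctan_series_bounds(2)[of x] by simp

lemma arctan_ge_complement:
  assumes "0 < (x::real)" "x \<le> 1"
    "a \<le> 7853981 / 10000000 - ((1 - x) / (1 + x) - ((1 - x) / (1 + x)) ^ 3 / 3 + ((1 - x) / (1 + x)) ^ 5 / 5
      - ((1 - x) / (1 + x)) ^ 7 / 7 + ((1 - x) / (1 + x)) ^ 9 / 9)"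
  shows "a \<le> arctan x"
  using arctan_series_bounds(2)[of "(1 - x) / (1 + x)"] arctan_complement[of x] assms pi_bounds by simp

lemma arctan_le_complement:
  assumes "0 < (x::real)" "x \<le> 1"
    "7853982 / 10000000 - ((1 - x) / (1 + x) - ((1 - x) / (1 + x)) ^ 3 / 3 + ((1 - x) / (1 + x)) ^ 5 / 5
      - ((1 - x) / (1 + x)) ^ 7 / 7) \<le> a"
  shows "arctan x \<le> a"
  using arctan_series_bounds(1)[of "(1 - x) / (1 + x)"] arctan_complement[of x] assms pi_bounds by simp

text \<open>The arguments are the breakpoints of the later case distinctions, and the entries are
  cited by position. Up to 0.354 the series is used directly, from 0.42 on through the
  complement.\<close>

lemma arctan_lower_values:
  shows "10560 / 100000 \<le> arctan (106 / 1000)"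
    "12533 / 100000 \<le> arctan (126 / 1000)"
    "13025 / 100000 \<le> arctan (131 / 1000)"
    "16352 / 100000 \<le> arctan (165 / 1000)"
    "18776 / 100000 \<le> arctan (190 / 1000)"
    "20794 / 100000 \<le> arctan (211 / 1000)"
    "24497 / 100000 \<le> arctan (250 / 1000)"
    "24873 / 100000 \<le> arctan (254 / 1000)"
    "28870 / 100000 \<le> arctan (297 / 1000)"
    "34022 / 100000 \<le> arctan (354 / 1000)"
    "39762 / 100000 \<le> arctan (420 / 1000)"
    "45319 / 100000 \<le> arctan (487 / 1000)"
    "50130 / 100000 \<le> arctan (548 / 1000)"
    "51655 / 100000 \<le> arctan (568 / 1000)"
    "53894 / 100000 \<le> arctan (598 / 1000)"
    "54846 / 100000 \<le> arctan (611 / 1000)"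
    "56718 / 100000 \<le> arctan (637 / 1000)"
    "57355 / 100000 \<le> arctan (646 / 1000)"
    "58823 / 100000 \<le> arctan (667 / 1000)"
    "60262 / 100000 \<le> arctan (688 / 1000)"
    "63057 / 100000 \<le> arctan (730 / 1000)"
    "65617 / 100000 \<le> arctan (770 / 1000)"
    "67656 / 100000 \<le> arctan (803 / 1000)"
    "69217 / 100000 \<le> arctan (829 / 1000)"
    "70333 / 100000 \<le> arctan (848 / 1000)"
    "71141 / 100000 \<le> arctan (862 / 1000)"
    "71712 / 100000 \<le> arctan (872 / 1000)"
  subgoal by (rule arctan_ge_series, simp, simp add: power_divide)
  subgoal by (rule arctan_ge_series, simp, simp add: power_divide)
  subgoal by (rule arctan_ge_series, simp, simp add: power_divide)
  subgoal by (rule arctan_ge_series, simp, simp add: power_divide)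
  subgoal by (rule arctan_ge_series, simp, simp add: power_divide)
  subgoal by (rule arctan_ge_series, simp, simp add: power_divide)
  subgoal by (rule arctan_ge_series, simp, simp add: power_divide)
  subgoal by (rule arctan_ge_series, simp, simp add: power_divide)
  subgoal by (rule arctan_ge_series, simp, simp add: power_divide)
  subgoal by (rule arctan_ge_series, simp, simp add: power_divide)
  subgoal by (rule arctan_ge_complement, simp, simp, simp add: power_divide)
  subgoal by (rule arctan_ge_complement, simp, simp, simp add: power_divide)
  subgoal by (rule arctan_ge_complement, simp, simp, simp add: power_divide)
  subgoal by (rule arctan_ge_complement, simp, simp, simp add: power_divide)
  subgoal by (rule arctan_ge_complement, simp, simp, simp add: power_divide)
  subgoal by (rule arctan_ge_complement, simp, simp, simp add: power_divide)
  subgoal by (rule arctan_ge_complement, simp, simp, simp add: power_divide)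
  subgoal by (rule arctan_ge_complement, simp, simp, simp add: power_divide)
  subgoal by (rule arctan_ge_complement, simp, simp, simp add: power_divide)
  subgoal by (rule arctan_ge_complement, simp, simp, simp add: power_divide)
  subgoal by (rule arctan_ge_complement, simp, simp, simp add: power_divide)
  subgoal by (rule arctan_ge_complement, simp, simp, simp add: power_divide)
  subgoal by (rule arctan_ge_complement, simp, simp, simp add: power_divide)
  subgoal by (rule arctan_ge_complement, simp, simp, simp add: power_divide)
  subgoal by (rule arctan_ge_complement, simp, simp, simp add: power_divide)
  subgoal by (rule arctan_ge_complement, simp, simp, simp add: power_divide)
  subgoal by (rule arctan_ge_complement, simp, simp, simp add: power_divide)
  done

lemma arctan_upper_values:
  shows "arctan (126 / 1000) \<le> 12534 / 100000"
    "arctan (206 / 1000) \<le> 20316 / 100000"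
    "arctan (211 / 1000) \<le> 20795 / 100000"
    "arctan (213 / 1000) \<le> 20987 / 100000"
    "arctan (254 / 1000) \<le> 24874 / 100000"
    "arctan (297 / 1000) \<le> 28871 / 100000"
    "arctan (354 / 1000) \<le> 34024 / 100000"
    "arctan (420 / 1000) \<le> 39766 / 100000"
    "arctan (487 / 1000) \<le> 45321 / 100000"
    "arctan (548 / 1000) \<le> 50131 / 100000"
    "arctan (598 / 1000) \<le> 53895 / 100000"
    "arctan (637 / 1000) \<le> 56719 / 100000"
    "arctan (667 / 1000) \<le> 58824 / 100000"
    "arctan (688 / 1000) \<le> 60263 / 100000"
    "arctan (700 / 1000) \<le> 61073 / 100000"
  subgoal by (rule arctan_le_series, simp, simp add: power_divide)
  subgoal by (rule arctan_le_series, simp, simp add: power_divide)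
  subgoal by (rule arctan_le_series, simp, simp add: power_divide)
  subgoal by (rule arctan_le_series, simp, simp add: power_divide)
  subgoal by (rule arctan_le_series, simp, simp add: power_divide)
  subgoal by (rule arctan_le_series, simp, simp add: power_divide)
  subgoal by (rule arctan_le_series, simp, simp add: power_divide)
  subgoal by (rule arctan_le_complement, simp, simp, simp add: power_divide)
  subgoal by (rule arctan_le_complement, simp, simp, simp add: power_divide)
  subgoal by (rule arctan_le_complement, simp, simp, simp add: power_divide)
  subgoal by (rule arctan_le_complement, simp, simp, simp add: power_divide)
  subgoal by (rule arctan_le_complement, simp, simp, simp add: power_divide)
  subgoal by (rule arctan_le_complement, simp, simp, simp add: power_divide)
  subgoal by (rule arctan_le_complement, simp, simp, simp add: power_divide)
  subgoal by (rule arctan_le_complement, simp, simp, simp add: power_divide)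
  done

text \<open>\<open>G_l M = M gam t / pi\<close> when \<open>M / l = 2 t / (1 + t\<^sup>2)\<close>.\<close>

definition gam :: "real \<Rightarrow> real" where
  "gam t = (1 - t\<^sup>2) / (2 * t) - pi / 2 + 2 * arctan t"

text \<open>The sign of the derivative reduces to (1 + x^2)^2 \<ge> 4 x^2.\<close>

lemma gam_antimono:
  assumes "0 < a" "a \<le> t"
  shows "gam t \<le> gam a"
proof (rule antimono_by_deriv[OF assms(2), where f' = "\<lambda>x. - (1 + x\<^sup>2) / (2 * x\<^sup>2) + 2 / (1 + x\<^sup>2)"])
  have nz: "1 + y\<^sup>2 \<noteq> 0" for y :: real by (simp add: add_nonneg_eq_0_iff)
  show "continuous_on {a..t} gam" unfolding gam_def using assms by (intro continuous_intros) auto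
  fix x assume x: "a < x" "x < t"
  then have x0: "x \<noteq> 0" using assms by simp
  have "((\<lambda>x. (1 - x\<^sup>2) / (2 * x)) has_real_derivative ((- (2 * x)) * (2 * x) - (1 - x\<^sup>2) * 2) / ((2 * x) * (2 * x))) (at x)"
    using x0 by (auto intro!: derivative_eq_intros)
  moreover have "((- (2 * x)) * (2 * x) - (1 - x\<^sup>2) * 2) / ((2 * x) * (2 * x)) = - (1 + x\<^sup>2) / (2 * x\<^sup>2)"
    using x0 by (simp add: field_simps power2_eq_square)
  ultimately have "((\<lambda>x. (1 - x\<^sup>2) / (2 * x)) has_real_derivative - (1 + x\<^sup>2) / (2 * x\<^sup>2)) (at x)" by metis
  moreover have "((\<lambda>x. 2 * arctan x) has_real_derivative 2 / (1 + x\<^sup>2)) (at x)"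
    using nz[of x] by (auto intro!: derivative_eq_intros simp: divide_simps)
  ultimately have "((\<lambda>x. (1 - x\<^sup>2) / (2 * x) - pi / 2 + 2 * arctan x) has_real_derivative
      - (1 + x\<^sup>2) / (2 * x\<^sup>2) - 0 + 2 / (1 + x\<^sup>2)) (at x)"
    by (rule DERIV_add[OF DERIV_diff[OF _ DERIV_const[of "pi / 2"]]])
  then show "(gam has_real_derivative - (1 + x\<^sup>2) / (2 * x\<^sup>2) + 2 / (1 + x\<^sup>2)) (at x)"
    unfolding gam_def by simp
  have "2 * (2 * x\<^sup>2) \<le> (1 + x\<^sup>2) * (1 + x\<^sup>2)"
    using zero_le_power2[of "1 - x\<^sup>2"] by (simp add: power2_eq_square algebra_simps)
  then have "2 / (1 + x\<^sup>2) \<le> (1 + x\<^sup>2) / (2 * x\<^sup>2)"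
    using x0 by (simp add: divide_simps nz add_pos_nonneg)
  then show "- (1 + x\<^sup>2) / (2 * x\<^sup>2) + 2 / (1 + x\<^sup>2) \<le> 0"
    unfolding minus_divide_left[symmetric] by linarith
qed

lemma gam_le:
  assumes "0 < a" "a \<le> t" "arctan a \<le> A"
  shows "gam t \<le> (1 - a\<^sup>2) / (2 * a) - 31415 / 20000 + 2 * A"
  using gam_antimono[OF assms(1,2)] assms(3) pi_approx by (simp add: gam_def)

lemma half_tangent_ge:
  assumes "0 < t" "B \<le> arctan b" "gam t < (1 - b\<^sup>2) / (2 * b) - 31416 / 20000 + 2 * B"
  shows "b \<le> t"
proof (rule ccontr)
  assume "\<not> b \<le> t"
  then have "gam b \<le> gam t" using gam_antimono[of t b] assms by simp
  then show False using assms pi_approx by (simp add: gam_def)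
qed

text \<open>A large \<open>t\<close> means that M / l is close to 1, where G_l is small relative to
  M; keeping it at least 3/4 forces M to be large.\<close>

lemma radius_lower:
  assumes "3 / 4 \<le> M / pi * gam t" "0 \<le> M" "0 < a" "a \<le> t" "arctan a \<le> A" "0 \<le> R"
    "R * ((1 - a\<^sup>2) / (2 * a) - 31415 / 20000 + 2 * A) < 3 / 4 * (31415 / 10000)"
  shows "R \<le> M"
proof (rule ccontr)
  assume "\<not> R \<le> M"
  have g: "3 / 4 * pi \<le> M * gam t" using assms(1) by (simp add: field_simps)
  have "0 < 3 / 4 * pi" by simp
  then have "0 < M * gam t" using g by linarith
  then have "0 < gam t" using assms(2) by (simp add: zero_less_mult_iff)
  then have "M * gam t \<le> R * gam t" using \<open>\<not> R \<le> M\<close> by (intro mult_right_mono) auto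
  also have "\<dots> \<le> R * ((1 - a\<^sup>2) / (2 * a) - 31415 / 20000 + 2 * A)"
    using assms(6) by (intro mult_left_mono gam_le assms)
  finally show False using g assms(7) pi_bounds by linarith
qed

text \<open>With \<open>M / m = 2 u / (1 + u\<^sup>2)\<close> this says \<open>h M \<le> M H_m(M)\<close>, in a form that also covers \<open>m = M\<close>.\<close>

definition near_edge :: "real \<Rightarrow> real \<Rightarrow> real \<Rightarrow> bool" where
  "near_edge h M u \<longleftrightarrow> 24 * pi * h * (M * ((1 - u\<^sup>2) / (1 + u\<^sup>2)) ^ 3)
     \<le> 2 * u / (1 + u\<^sup>2) * (3 + 2 * (2 * u / (1 + u\<^sup>2))\<^sup>2)"

text \<open>In the edge condition the left side decreases and the right side increases with the
  half-angle parameter, so a violation at \<open>v\<close> with M replaced by a smaller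
  \<open>R\<close> excludes every parameter below \<open>v\<close>.\<close>

lemma near_edge_lower:
  assumes "near_edge h M u" "0 < u" "0 \<le> h" "0 \<le> R" "R \<le> M" "v \<le> 1"
    "2 * v / (1 + v\<^sup>2) * (3 + 2 * (2 * v / (1 + v\<^sup>2))\<^sup>2)
      < 24 * (31415 / 10000) * h * (R * ((1 - v\<^sup>2) / (1 + v\<^sup>2)) ^ 3)"
  shows "v \<le> u"
proof (rule ccontr)
  assume "\<not> v \<le> u"
  then have uv: "u \<le> v" "0 < v" using assms by auto
  have p: "0 < 1 + u\<^sup>2" "0 < 1 + v\<^sup>2" by (auto simp: add_pos_nonneg)
  have v2: "v\<^sup>2 \<le> 1" using assms uv by (simp add: power_le_one)
  have u2: "u\<^sup>2 \<le> v\<^sup>2" using assms uv by (intro power_mono) auto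
  have y: "(1 - v\<^sup>2) / (1 + v\<^sup>2) \<le> (1 - u\<^sup>2) / (1 + u\<^sup>2)" using u2 v2 by (intro frac_le) (auto simp: add_pos_nonneg)
  have "u * v \<le> 1" using assms uv by (simp add: mult_le_one)
  then have "0 \<le> (v - u) * (1 - u * v)" using uv by simp
  then have "u * (1 + v\<^sup>2) \<le> v * (1 + u\<^sup>2)" by (simp add: algebra_simps power2_eq_square)
  then have x: "2 * u / (1 + u\<^sup>2) \<le> 2 * v / (1 + v\<^sup>2)" using p by (simp add: divide_simps)
  have "24 * (31415 / 10000) * h * (R * ((1 - v\<^sup>2) / (1 + v\<^sup>2)) ^ 3)
      \<le> 24 * pi * h * (M * ((1 - u\<^sup>2) / (1 + u\<^sup>2)) ^ 3)"
    using assms v2 pi_approx by (intro mult_mono power_mono y) auto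
  also have "\<dots> \<le> 2 * u / (1 + u\<^sup>2) * (3 + 2 * (2 * u / (1 + u\<^sup>2))\<^sup>2)"
    using assms(1) by (simp add: near_edge_def)
  also have "\<dots> \<le> 2 * v / (1 + v\<^sup>2) * (3 + 2 * (2 * v / (1 + v\<^sup>2))\<^sup>2)"
    using x assms uv by (intro mult_mono add_mono power_mono) auto
  finally show False using assms(7) by simp
qed

lemma Psi_diff_lower:
  assumes "0 \<le> t" "t \<le> b" "b \<le> 1" "0 \<le> v" "v \<le> u" "u \<le> 1" "arctan b \<le> B" "C \<le> arctan v"
  shows "(2 * C - v) - (2 * B - b) \<le> Psi u - Psi t"
  using Psi_mono(1)[of t b] Psi_mono(1)[of v u] assms by (simp add: Psi_def)

lemma parabola_loss_le:
  assumes "0 < d" "d \<le> D" "0 \<le> s" "s \<le> s0"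
  shows "3 / 8 * s\<^sup>2 * pi / D \<le> 3 / 8 * s0\<^sup>2 * (31416 / 10000) / d"
  using assms pi_approx by (intro frac_le mult_mono power_mono) auto

text \<open>The bounded expression is the tangent slope arccos (M / l) / pi in terms of
  \<open>t\<close>.\<close>

lemma tau_upper:
  assumes "0 \<le> A" "A \<le> arctan a" "a \<le> t"
  shows "1 / 2 - 2 * arctan t / pi \<le> 1 / 2 - 2 * A / (31416 / 10000)"
proof -
  have "arctan a \<le> arctan t" using assms by (simp add: arctan_le_iff)
  moreover have "0 \<le> arctan t" using calculation assms by linarith
  ultimately have "2 * A / (31416 / 10000) \<le> 2 * arctan t / pi"
    using assms pi_approx by (intro frac_le) auto
  then show ?thesis by simp
qed

lemma tau_pos:
  assumes "t < 1"
  shows "0 < 1 / 2 - 2 * arctan t / pi"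
proof -
  have "arctan t < arctan 1" using assms by (simp only: arctan_less_iff)
  then have "2 * arctan t < pi / 2" by (simp add: arctan_one)
  then have "2 * arctan t / pi < (pi / 2) / pi" by (rule divide_strict_right_mono) simp
  then show ?thesis by simp
qed

text \<open>The constants: \<open>27/80 = 3/5 (3/4)\<^sup>2\<close> is the gain at \<open>G_l M = 3/4\<close>; \<open>s \<le> 0.2812\<close> bounds the
  shift \<open>k - (G_l M - G_m M)\<close>; \<open>0.5315\<close> is the required \<open>1/2\<close> plus the area under \<open>G_m\<close> beyond \<open>M\<close>.\<close>

lemma gain_loss_piece:
  assumes t: "a \<le> t" "t \<le> b" "0 < a" "b < 1"
    and u: "0 < u" "u \<le> 1" and near: "near_edge (19 / 100) M u" and R: "R \<le> M" "0 \<le> R" "v \<le> 1"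
    and s: "0 \<le> s" "s \<le> 2812 / 10000"
    and vals: "A \<le> arctan a" "arctan b \<le> B" "C \<le> arctan v"
    and num: "0 \<le> A" "0 \<le> v" "2 * v / (1 + v\<^sup>2) * (3 + 2 * (2 * v / (1 + v\<^sup>2))\<^sup>2)
      < 24 * (31415 / 10000) * (19 / 100) * (R * ((1 - v\<^sup>2) / (1 + v\<^sup>2)) ^ 3)"
    "0 < (2 * C - v) - (2 * B - b)" "0 < 1 / 2 - 2 * A / (31416 / 10000)"
    "5315 / 10000 + 3 / 8 * (2812 / 10000)\<^sup>2 * (31416 / 10000) / ((2 * C - v) - (2 * B - b))
      < 27 / 80 / (1 / 2 - 2 * A / (31416 / 10000))"
  shows "5315 / 10000 + 3 / 8 * s\<^sup>2 * pi / (Psi u - Psi t) < 27 / 80 / (1 / 2 - 2 * arctan t / pi)"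
proof -
  have "v \<le> u" using near_edge_lower[OF near u(1) _ R(2,1,3) num(3)] by simp
  then have "(2 * C - v) - (2 * B - b) \<le> Psi u - Psi t"
    using Psi_diff_lower[of t b v u B C] t u vals num by simp
  then have "3 / 8 * s\<^sup>2 * pi / (Psi u - Psi t) \<le> 3 / 8 * (2812 / 10000)\<^sup>2 * (31416 / 10000) / ((2 * C - v) - (2 * B - b))"
    by (rule parabola_loss_le[OF num(4) _ s])
  moreover have "27 / 80 / (1 / 2 - 2 * A / (31416 / 10000)) \<le> 27 / 80 / (1 / 2 - 2 * arctan t / pi)"
    using tau_upper[OF num(1) vals(1) t(1)] tau_pos[of t] t num by (intro divide_left_mono) auto
  ultimately show ?thesis using num(6) by linarith
qed

text \<open>A bootstrap by contradiction: on each interval for \<open>t\<close>, the lower end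
  forces M \<ge> R, the edge condition then forces u \<ge> v, and this keeps
  \<open>Psi u - Psi t\<close> away from 0. If the claim fails, \<open>t\<close> lies beyond the
  interval. Past 0.7 the radius would have to be at least 150.5.\<close>

lemma gain_exceeds_loss:
  assumes G: "3 / 4 \<le> M / pi * gam t" and M: "3 \<le> M" "M \<le> 150" and t: "211 / 1000 \<le> t" "t < 1"
    and u: "0 < u" "u \<le> 1" and near: "near_edge (19 / 100) M u" and s: "0 \<le> s" "s \<le> 2812 / 10000"
  shows "5315 / 10000 + 3 / 8 * s\<^sup>2 * pi / (Psi u - Psi t) < 27 / 80 / (1 / 2 - 2 * arctan t / pi)"
proof (rule ccontr)
  assume neg: "\<not> ?thesis"
  have M0: "0 \<le> M" using M by simp
  have t1: "254 / 1000 \<le> t"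
  proof (rule ccontr)
    assume "\<not> ?thesis"
    then have tb: "t \<le> 254 / 1000" by simp
    have R: "3 \<le> M"
      by (rule M(1))
    show False
      \<comment> \<open>The table entries belong, in this order, to the two ends of the interval for
        \<open>t\<close> and to the threshold \<open>v\<close> for \<open>u\<close>; likewise in all
        steps below.\<close>
      by (rule notE[OF neg gain_loss_piece[OF t(1) tb _ _ u near R _ _ s arctan_lower_values(6) arctan_upper_values(5) arctan_lower_values(16)]])
        (simp_all add: power2_eq_square power3_eq_cube)
  qed
  have t2: "297 / 1000 \<le> t"
  proof (rule ccontr)
    assume "\<not> ?thesis"
    then have tb: "t \<le> 297 / 1000" by simp
    have R: "3 \<le> M"
      by (rule M(1))
    show False
      by (rule notE[OF neg gain_loss_piece[OF t1 tb _ _ u near R _ _ s arctan_lower_values(8) arctan_upper_values(6) arctan_lower_values(16)]])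
        (simp_all add: power2_eq_square power3_eq_cube)
  qed
  have t3: "354 / 1000 \<le> t"
  proof (rule ccontr)
    assume "\<not> ?thesis"
    then have tb: "t \<le> 354 / 1000" by simp
    have R: "43 / 10 \<le> M"
      by (rule radius_lower[OF G M0 _ t2 arctan_upper_values(6)]) (use M in \<open>simp_all add: power2_eq_square\<close>)
    show False
      by (rule notE[OF neg gain_loss_piece[OF t2 tb _ _ u near R _ _ s arctan_lower_values(9) arctan_upper_values(7) arctan_lower_values(18)]])
        (simp_all add: power2_eq_square power3_eq_cube)
  qed
  have t4: "420 / 1000 \<le> t"
  proof (rule ccontr)
    assume "\<not> ?thesis"
    then have tb: "t \<le> 420 / 1000" by simp
    have R: "68 / 10 \<le> M"
      by (rule radius_lower[OF G M0 _ t3 arctan_upper_values(7)]) (use M in \<open>simp_all add: power2_eq_square\<close>)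
    show False
      by (rule notE[OF neg gain_loss_piece[OF t3 tb _ _ u near R _ _ s arctan_lower_values(10) arctan_upper_values(8) arctan_lower_values(20)]])
        (simp_all add: power2_eq_square power3_eq_cube)
  qed
  have t5: "487 / 1000 \<le> t"
  proof (rule ccontr)
    assume "\<not> ?thesis"
    then have tb: "t \<le> 487 / 1000" by simp
    have R: "114 / 10 \<le> M"
      by (rule radius_lower[OF G M0 _ t4 arctan_upper_values(8)]) (use M in \<open>simp_all add: power2_eq_square\<close>)
    show False
      by (rule notE[OF neg gain_loss_piece[OF t4 tb _ _ u near R _ _ s arctan_lower_values(11) arctan_upper_values(9) arctan_lower_values(21)]])
        (simp_all add: power2_eq_square power3_eq_cube)
  qed
  have t6: "548 / 1000 \<le> t"
  proof (rule ccontr)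
    assume "\<not> ?thesis"
    then have tb: "t \<le> 548 / 1000" by simp
    have R: "198 / 10 \<le> M"
      by (rule radius_lower[OF G M0 _ t5 arctan_upper_values(9)]) (use M in \<open>simp_all add: power2_eq_square\<close>)
    show False
      by (rule notE[OF neg gain_loss_piece[OF t5 tb _ _ u near R _ _ s arctan_lower_values(12) arctan_upper_values(10) arctan_lower_values(22)]])
        (simp_all add: power2_eq_square power3_eq_cube)
  qed
  have t7: "598 / 1000 \<le> t"
  proof (rule ccontr)
    assume "\<not> ?thesis"
    then have tb: "t \<le> 598 / 1000" by simp
    have R: "335 / 10 \<le> M"
      by (rule radius_lower[OF G M0 _ t6 arctan_upper_values(10)]) (use M in \<open>simp_all add: power2_eq_square\<close>)
    show False
      by (rule notE[OF neg gain_loss_piece[OF t6 tb _ _ u near R _ _ s arctan_lower_values(13) arctan_upper_values(11) arctan_lower_values(23)]])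
        (simp_all add: power2_eq_square power3_eq_cube)
  qed
  have t8: "637 / 1000 \<le> t"
  proof (rule ccontr)
    assume "\<not> ?thesis"
    then have tb: "t \<le> 637 / 1000" by simp
    have R: "532 / 10 \<le> M"
      by (rule radius_lower[OF G M0 _ t7 arctan_upper_values(11)]) (use M in \<open>simp_all add: power2_eq_square\<close>)
    show False
      by (rule notE[OF neg gain_loss_piece[OF t7 tb _ _ u near R _ _ s arctan_lower_values(15) arctan_upper_values(12) arctan_lower_values(24)]])
        (simp_all add: power2_eq_square power3_eq_cube)
  qed
  have t9: "667 / 1000 \<le> t"
  proof (rule ccontr)
    assume "\<not> ?thesis"
    then have tb: "t \<le> 667 / 1000" by simp
    have R: "783 / 10 \<le> M"
      by (rule radius_lower[OF G M0 _ t8 arctan_upper_values(12)]) (use M in \<open>simp_all add: power2_eq_square\<close>)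
    show False
      by (rule notE[OF neg gain_loss_piece[OF t8 tb _ _ u near R _ _ s arctan_lower_values(17) arctan_upper_values(13) arctan_lower_values(25)]])
        (simp_all add: power2_eq_square power3_eq_cube)
  qed
  have t10: "688 / 1000 \<le> t"
  proof (rule ccontr)
    assume "\<not> ?thesis"
    then have tb: "t \<le> 688 / 1000" by simp
    have R: "1078 / 10 \<le> M"
      by (rule radius_lower[OF G M0 _ t9 arctan_upper_values(13)]) (use M in \<open>simp_all add: power2_eq_square\<close>)
    show False
      by (rule notE[OF neg gain_loss_piece[OF t9 tb _ _ u near R _ _ s arctan_lower_values(19) arctan_upper_values(14) arctan_lower_values(26)]])
        (simp_all add: power2_eq_square power3_eq_cube)
  qed
  have t11: "700 / 1000 \<le> t"
  proof (rule ccontr)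
    assume "\<not> ?thesis"
    then have tb: "t \<le> 700 / 1000" by simp
    have R: "1365 / 10 \<le> M"
      by (rule radius_lower[OF G M0 _ t10 arctan_upper_values(14)]) (use M in \<open>simp_all add: power2_eq_square\<close>)
    show False
      by (rule notE[OF neg gain_loss_piece[OF t10 tb _ _ u near R _ _ s arctan_lower_values(20) arctan_upper_values(15) arctan_lower_values(27)]])
        (simp_all add: power2_eq_square power3_eq_cube)
  qed
  have "1505 / 10 \<le> M"
    by (rule radius_lower[OF G M0 _ t11 arctan_upper_values(15)]) (simp_all add: power2_eq_square)
  then show False using M by simp
qed

section \<open>Consequences of the edge condition\<close>

lemma half_tangent_mono:
  fixes u v :: real
  assumes "0 \<le> v" "v \<le> u" "u \<le> 1"
  shows "2 * v / (1 + v\<^sup>2) \<le> 2 * u / (1 + u\<^sup>2)"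
proof -
  have p: "0 < 1 + u\<^sup>2" "0 < 1 + v\<^sup>2" by (auto simp: add_pos_nonneg)
  have "v * u \<le> 1" using assms by (intro mult_le_one) auto
  then have "0 \<le> (u - v) * (1 - v * u)" using assms by simp
  then have "v * (1 + u\<^sup>2) \<le> u * (1 + v\<^sup>2)" by (simp add: algebra_simps power2_eq_square)
  then show ?thesis using p by (simp add: divide_simps)
qed

lemma sin_cube_le:
  fixes x :: real
  assumes "0 \<le> x" "x \<le> pi / 2"
  shows "sin x + (sin x) ^ 3 / 6 \<le> x"
proof -
  have "(\<lambda>x. x - (sin x + (sin x) ^ 3 / 6)) 0 \<le> (\<lambda>x. x - (sin x + (sin x) ^ 3 / 6)) x"
  proof (rule mono_by_deriv[OF assms(1), where f' = "\<lambda>x. 1 - (cos x + (sin x)\<^sup>2 * cos x / 2)"])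
    fix y assume y: "0 < y" "y < x"
    show "((\<lambda>x. x - (sin x + (sin x) ^ 3 / 6)) has_real_derivative 1 - (cos y + (sin y)\<^sup>2 * cos y / 2)) (at y)"
      by (auto intro!: derivative_eq_intros simp: field_simps power2_eq_square)
    have c: "0 \<le> cos y" using y assms by (intro cos_ge_zero) auto
    have "1 - (cos y + (sin y)\<^sup>2 * cos y / 2) = (1 - cos y)\<^sup>2 * (2 + cos y) / 2"
      unfolding sin_squared_eq by (simp add: field_simps power2_eq_square)
    moreover have "0 \<le> (1 - cos y)\<^sup>2 * (2 + cos y) / 2" using c by simp
    ultimately show "0 \<le> 1 - (cos y + (sin y)\<^sup>2 * cos y / 2)" by linarith
  qed (auto intro!: continuous_intros)
  then show ?thesis by simp
qed

text \<open>With a = arccos x one has G_m = m / pi times (y - x a), and a \<ge> y + y^3 / 6. Since y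
  (1 - x) = y^3 / (1 + x), everything is of order m y^3.\<close>

lemma G_fun_edge_le:
  fixes m M :: real
  defines "x \<equiv> M / m"
  defines "y \<equiv> sqrt (1 - x\<^sup>2)"
  assumes "0 < M" "M \<le> m"
  shows "G_fun m M \<le> m * y ^ 3 / pi * (1 / (1 + x) - x / 6)"
proof -
  define a where "a = arccos x"
  have x: "0 < x" "x \<le> 1" "M = m * x" using assms by (auto simp: x_def)
  have a: "0 \<le> a" "a \<le> pi / 2" "cos a = x" using arccos_unit[of x] x by (auto simp: a_def)
  have s: "sin a = y" using x by (simp add: a_def y_def sin_arccos)
  have x2: "x\<^sup>2 \<le> 1" using x by (simp add: power_le_one)
  have y: "0 \<le> y" "y\<^sup>2 = 1 - x\<^sup>2" using x2 by (auto simp: y_def)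
  have "m\<^sup>2 - M\<^sup>2 = m\<^sup>2 * (1 - x\<^sup>2)" using x by (simp add: algebra_simps power_mult_distrib)
  then have "sqrt (m\<^sup>2 - M\<^sup>2) = m * y" using assms(3,4) by (simp add: y_def real_sqrt_mult)
  then have "G_fun m M = m / pi * (y - x * a)"
    using assms(3,4) x by (simp add: G_fun_def a_def x_def[symmetric] right_diff_distrib)
  also have "\<dots> \<le> m / pi * (y - x * (y + y ^ 3 / 6))"
    using sin_cube_le[OF a(1,2)] x assms(3,4)
    by (intro mult_left_mono diff_left_mono) (auto simp: s)
  also have "y - x * (y + y ^ 3 / 6) = y ^ 3 * (1 / (1 + x) - x / 6)"
  proof -
    have "1 - x = y\<^sup>2 / (1 + x)" using y x by (simp add: field_simps power2_eq_square)
    then have "y * (1 - x) = y ^ 3 / (1 + x)" by (simp add: power3_eq_cube power2_eq_square)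
    then show ?thesis by (simp add: algebra_simps)
  qed
  finally show ?thesis by simp
qed

lemma near_edge_of_H:
  fixes M m u :: real
  assumes "0 < M" "M < m" "0 < u" "u \<le> 1" "M / m = 2 * u / (1 + u\<^sup>2)"
    "sqrt (1 - (M / m)\<^sup>2) = (1 - u\<^sup>2) / (1 + u\<^sup>2)" "h \<le> H_fun m M"
  shows "near_edge h M u"
proof -
  define x y where "x = M / m" and "y = sqrt (1 - x\<^sup>2)"
  have x: "0 < x" "x < 1" "M = m * x" using assms(1,2) by (auto simp: x_def)
  have m: "0 < m" using assms by simp
  have x2: "x\<^sup>2 < 1" using x by (simp add: power_less_one_iff)
  have y: "0 < y" "y\<^sup>2 = 1 - x\<^sup>2" using x2 by (auto simp: y_def)
  have w0: "m\<^sup>2 - M\<^sup>2 = m\<^sup>2 * (1 - x\<^sup>2)" using x by (simp add: algebra_simps power_mult_distrib)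
  then have w: "m\<^sup>2 - M\<^sup>2 = m\<^sup>2 * y\<^sup>2" by (simp add: y)
  have sq: "sqrt (m\<^sup>2 - M\<^sup>2) = m * y" using m w0 by (simp add: y_def real_sqrt_mult)
  have num: "3 * m\<^sup>2 + 2 * M\<^sup>2 = m\<^sup>2 * (3 + 2 * x\<^sup>2)" using x(3) by (simp add: algebra_simps power_mult_distrib)
  have den: "24 * pi * ((m\<^sup>2 - M\<^sup>2) * sqrt (m\<^sup>2 - M\<^sup>2)) = m\<^sup>2 * (24 * pi * (m * y ^ 3))"
    unfolding sq unfolding w by (simp add: power3_eq_cube power2_eq_square)
  have "H_fun m M = (m\<^sup>2 * (3 + 2 * x\<^sup>2)) / (m\<^sup>2 * (24 * pi * (m * y ^ 3)))"
    unfolding H_fun_alt[OF less_imp_le[OF assms(1)] assms(2)] num den ..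
  also have "\<dots> = (3 + 2 * x\<^sup>2) / (24 * pi * (m * y ^ 3))" using m by simp
  finally have "h \<le> (3 + 2 * x\<^sup>2) / (24 * pi * (m * y ^ 3))" using assms by simp
  then have "h * (24 * pi * (m * y ^ 3)) \<le> 3 + 2 * x\<^sup>2" using m y by (simp add: pos_le_divide_eq)
  then have "x * (h * (24 * pi * (m * y ^ 3))) \<le> x * (3 + 2 * x\<^sup>2)" using x by (intro mult_left_mono) auto
  moreover have "x * (h * (24 * pi * (m * y ^ 3))) = 24 * pi * h * (M * y ^ 3)" using x by simp
  ultimately show ?thesis
    unfolding near_edge_def assms(5)[symmetric] assms(6)[symmetric] by (simp add: x_def y_def)
qed

text \<open>The condition amounts to 24 pi h m y^3 \<le> 3 + 2 x^2, and the right side is at most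
  5.\<close>

lemma near_edge_cube:
  fixes M m u h :: real
  assumes "0 < M" "M \<le> m" "0 < u" "M / m = 2 * u / (1 + u\<^sup>2)"
    "sqrt (1 - (M / m)\<^sup>2) = (1 - u\<^sup>2) / (1 + u\<^sup>2)" "near_edge h M u" "0 < h"
  shows "m * sqrt (1 - (M / m)\<^sup>2) ^ 3 \<le> 5 / (24 * (31415 / 10000) * h)"
proof -
  define x y where "x = M / m" and "y = sqrt (1 - x\<^sup>2)"
  have x: "0 < x" "x \<le> 1" "M = m * x" using assms(1,2) by (auto simp: x_def)
  have x2: "x\<^sup>2 \<le> 1" using x by (simp add: power_le_one)
  then have y: "0 \<le> y" by (simp add: y_def)
  have "24 * pi * h * (M * y ^ 3) \<le> x * (3 + 2 * x\<^sup>2)"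
    using assms(6) unfolding near_edge_def assms(4)[symmetric] assms(5)[symmetric]
    by (simp add: x_def y_def)
  then have "x * (24 * pi * h * (m * y ^ 3)) \<le> x * (3 + 2 * x\<^sup>2)" using x by (simp add: algebra_simps)
  then have "24 * pi * h * (m * y ^ 3) \<le> 3 + 2 * x\<^sup>2" using x by simp
  moreover have "24 * (31415 / 10000) * h * (m * y ^ 3) \<le> 24 * pi * h * (m * y ^ 3)"
    using pi_bounds assms y by (intro mult_right_mono mult_left_mono) auto
  ultimately have "24 * (31415 / 10000) * h * (m * y ^ 3) \<le> 5" using x2 by linarith
  then have "m * y ^ 3 \<le> 5 / (24 * (31415 / 10000) * h)"
    using assms(7) by (simp add: pos_le_divide_eq mult.commute)
  then show ?thesis by (simp add: x_def y_def)
qed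

text \<open>The threshold \<open>v\<close> is computed for M = 1, the least positive integer, which
  is the weakest case; the bound on x that it gives sharpens the decreasing factor 1 / (1 + x) - x /
  6.\<close>

lemma G_fun_near_edge:
  fixes M m u h :: real
  assumes "1 \<le> M" "M \<le> m" "0 < u" "u \<le> 1" "M / m = 2 * u / (1 + u\<^sup>2)"
    "sqrt (1 - (M / m)\<^sup>2) = (1 - u\<^sup>2) / (1 + u\<^sup>2)" "near_edge h M u" "0 < h"
    and v: "0 \<le> v" "v \<le> 1" "2 * v / (1 + v\<^sup>2) * (3 + 2 * (2 * v / (1 + v\<^sup>2))\<^sup>2)
      < 24 * (31415 / 10000) * h * (1 * ((1 - v\<^sup>2) / (1 + v\<^sup>2)) ^ 3)"
  shows "v \<le> u" "2 * v / (1 + v\<^sup>2) \<le> M / m"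
    "G_fun m M \<le> 5 / (24 * (31415 / 10000) * h) / (31415 / 10000) *
      (1 / (1 + 2 * v / (1 + v\<^sup>2)) - 2 * v / (1 + v\<^sup>2) / 6)"
proof -
  define x y where "x = M / m" and "y = sqrt (1 - x\<^sup>2)"
  define X where "X = 2 * v / (1 + v\<^sup>2)"
  have x: "0 < x" "x \<le> 1" using assms(1,2) by (auto simp: x_def)
  have x2: "x\<^sup>2 \<le> 1" using x by (simp add: power_le_one)
  then have y: "0 \<le> y" by (simp add: y_def)
  have X0: "0 \<le> X" using v by (simp add: X_def)
  show "v \<le> u" using near_edge_lower[OF assms(7,3) _ _ assms(1) v(2,3)] assms by simp
  then show *: "2 * v / (1 + v\<^sup>2) \<le> M / m" using half_tangent_mono[of v u] assms by simp
  then have Xx: "X \<le> x" by (simp add: X_def x_def)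
  have c: "m * y ^ 3 \<le> 5 / (24 * (31415 / 10000) * h)"
    using near_edge_cube[OF _ assms(2,3,5,6,7,8)] assms(1) by (simp add: x_def y_def)
  have "1 / (1 + x) \<ge> 1 / 2" using x by (simp add: field_simps)
  then have pos: "0 \<le> 1 / (1 + x) - x / 6" using x by linarith
  have "G_fun m M \<le> m * y ^ 3 / pi * (1 / (1 + x) - x / 6)"
    using G_fun_edge_le[of M m] assms by (simp add: x_def y_def)
  also have "\<dots> \<le> 5 / (24 * (31415 / 10000) * h) / (31415 / 10000) * (1 / (1 + X) - X / 6)"
  proof (rule mult_mono)
    show "m * y ^ 3 / pi \<le> 5 / (24 * (31415 / 10000) * h) / (31415 / 10000)"
      using c pi_bounds assms y by (intro frac_le) auto
    have "1 / (1 + x) \<le> 1 / (1 + X)" using Xx X0 by (intro divide_left_mono) auto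
    then show "1 / (1 + x) - x / 6 \<le> 1 / (1 + X) - X / 6" using Xx by simp
  qed (use assms pos in auto)
  finally show "G_fun m M \<le> 5 / (24 * (31415 / 10000) * h) / (31415 / 10000) *
      (1 / (1 + 2 * v / (1 + v\<^sup>2)) - 2 * v / (1 + v\<^sup>2) / 6)"
    by (simp add: X_def)
qed

text \<open>Writing \<open>d = m - M\<close> and \<open>x = M/m\<close>, the edge condition bounds \<open>d\<^sup>3 (1 + x)\<^sup>3 = m (m y\<^sup>3)\<^sup>2\<close>;
  a first crude bound on \<open>d\<close> forces \<open>x\<close> close to \<open>1\<close> when \<open>m\<close> is large, which gives the final bound.\<close>

lemma edge_distance:
  fixes m d x c :: real
  assumes "0 \<le> d" "d = m * (1 - x)" "78 / 100 \<le> x" "x \<le> 1" "0 < m" "m \<le> 132"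
    "(d * (1 + x)) ^ 3 \<le> m * c\<^sup>2" "0 \<le> c" "c \<le> 35 / 100"
  shows "d \<le> 13 / 10"
proof (rule ccontr)
  assume "\<not> ?thesis"
  then have d: "13 / 10 < d" by simp
  have c2: "c\<^sup>2 \<le> (35 / 100)\<^sup>2" using assms by (intro power_mono) auto
  have mc: "(d * (1 + x)) ^ 3 \<le> m * (49 / 400)"
  proof -
    have "m * c\<^sup>2 \<le> m * (35 / 100)\<^sup>2" using assms(5) by (intro mult_left_mono c2) simp
    then show ?thesis using assms(7) by (simp add: power2_eq_square)
  qed
  have "(13 / 10 * (178 / 100)) ^ 3 \<le> (d * (1 + x)) ^ 3"
    using d assms by (intro power_mono mult_mono) auto
  then have m1: "100 \<le> m" using mc by (simp add: power3_eq_cube)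
  have "(d * (178 / 100)) ^ 3 \<le> (d * (1 + x)) ^ 3"
    using d assms by (intro power_mono mult_mono) auto
  then have "(d * (178 / 100)) ^ 3 \<le> m * (49 / 400)" using mc by linarith
  also have "\<dots> \<le> (3 :: real) ^ 3" using assms(6) by simp
  finally have "(d * (178 / 100)) ^ 3 \<le> (3 :: real) ^ 3" .
  then have "\<not> 3 < d * (178 / 100)" using power_strict_mono[of 3 "d * (178 / 100)" 3] by linarith
  then have "m * (1 - x) \<le> 2" unfolding assms(2) by linarith
  moreover have "100 * (1 - x) \<le> m * (1 - x)" using m1 assms by (intro mult_right_mono) auto
  ultimately have "98 / 100 \<le> x" by simp
  then have "(13 / 10 * (198 / 100)) ^ 3 \<le> (d * (1 + x)) ^ 3"
    using d by (intro power_mono mult_mono) auto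
  then have "m * (49 / 400) \<ge> 17" using mc by (simp add: power3_eq_cube)
  then show False using assms by simp
qed

section \<open>Bad levels\<close>

text \<open>Convexity again: the tangent at \<open>z\<close>, evaluated at both ends and weighted by
  the distances.\<close>

lemma G_fun_chord:
  assumes "0 < v" "0 \<le> M" "M < v" "M \<le> z" "z \<le> v"
  shows "G_fun v z \<le> G_fun v M * (v - z) / (v - M)"
proof -
  define c where "c = arccos (z / v) / pi"
  have "G_fun v z - c * (M - z) \<le> G_fun v M" "G_fun v z - c * (v - z) \<le> 0"
    using G_fun_tangent[of v z M] G_fun_tangent[of v z v] assms by (auto simp: c_def G_fun_eq_0)
  then have "(v - z) * (G_fun v z - c * (M - z)) \<le> (v - z) * G_fun v M"
    "(z - M) * (G_fun v z - c * (v - z)) \<le> 0"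
    using assms by (auto intro!: mult_left_mono mult_nonneg_nonpos simp del: diff_le_0_iff_le)
  moreover have "(v - z) * (G_fun v z - c * (M - z)) + (z - M) * (G_fun v z - c * (v - z)) = G_fun v z * (v - M)"
    by (simp add: algebra_simps)
  ultimately have "G_fun v z * (v - M) \<le> G_fun v M * (v - z)" by (simp add: mult.commute)
  then show ?thesis using assms by (simp add: pos_le_divide_eq)
qed

lemma integral_G_fun_le:
  assumes "0 < v" "0 \<le> M" "M \<le> v" "v \<le> l"
  shows "integral {M..l} (G_fun v) \<le> G_fun v M * (v - M) / 2"
proof -
  have cont: "continuous_on {M..l} (G_fun v)" using assms by (intro continuous_intros) auto
  have "integral {v..l} (G_fun v) = integral {v..l} (\<lambda>z. 0)"
    by (rule integral_cong) (use assms in \<open>simp add: G_fun_eq_0\<close>)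
  then have split: "integral {M..l} (G_fun v) = integral {M..v} (G_fun v)"
    using integral_split[OF assms(3,4) cont] by simp
  show ?thesis
  proof (cases "M = v")
    case True
    then show ?thesis using split by simp
  next
    case False
    define c where "c = G_fun v M / (v - M)"
    define F where "F = (\<lambda>z. - c * (v - z)\<^sup>2 / 2)"
    have F: "((\<lambda>z. c * (v - z)) has_integral F v - F M) {M..v}"
      by (rule has_integral_FTC[OF assms(3)])
         (auto simp: F_def field_simps intro!: derivative_eq_intros)
    have "F v - F M = c * (v - M) * (v - M) / 2" by (simp add: F_def power2_eq_square)
    then have "F v - F M = G_fun v M * (v - M) / 2" using False by (simp add: c_def)
    moreover have "integral {M..v} (G_fun v) \<le> F v - F M"
    proof (rule has_integral_le[OF integrable_integral F])
      show "G_fun v integrable_on {M..v}"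
        using assms by (intro integrable_continuous_real continuous_intros) auto
      show "G_fun v z \<le> c * (v - z)" if "z \<in> {M..v}" for z
        using G_fun_chord[of v M z] that False assms by (simp add: c_def)
    qed
    ultimately show ?thesis using split by simp
  qed
qed

text \<open>Common data of a critical level: \<open>v\<close> is the inner radius, enlarged if
  necessary so that M \<le> v; \<open>t\<close> and \<open>u\<close> are the half-angle parameters
  of M / l and M / v; the shift \<open>s\<close> is measured with \<open>v\<close>.\<close>

context
  fixes l m v M k t u s :: real
  assumes m: "0 \<le> m" "m \<le> v" and M: "1 \<le> M" "M \<le> v" "v < l" and k: "1 \<le> k"
    and t: "0 < t" "t < 1" "M / l = 2 * t / (1 + t\<^sup>2)"
      "arccos (M / l) = pi / 2 - 2 * arctan t"
      "G_fun l 0 - G_fun l M = M / pi * (pi / 2 - (2 * arctan t - t))"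
    and u: "0 < u" "u \<le> 1" "arccos (M / v) = pi / 2 - 2 * arctan u"
      "G_fun v 0 - G_fun v M = M / pi * (pi / 2 - (2 * arctan u - u))"
    and s: "s = k - (G_fun l M - G_fun v M)" "0 \<le> s"
    and G: "k - 1 / 4 \<le> G_fun l M"
begin

lemma tau_eq: "arccos (M / l) / pi = 1 / 2 - 2 * arctan t / pi"
  unfolding t(4) by (simp add: diff_divide_distrib)

lemma layer_parts:
  assumes "a \<le> integral {0..M} (\<lambda>z. clip (G_fun l z - G_fun v z - (k - 1)))"
    and "b \<le> integral {M..l} (\<lambda>z. clip (G_fun l z - G_fun v z - (k - 1)))"
  shows "a + b \<le> layer l m k"
  using layer_split[of v M l k] layer_antimono[of m v l k] m M assms by simp

text \<open>A rectangle loses s M, good enough when M = 1.\<close>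

lemma left_crude: "(1 - s) * M \<le> integral {0..M} (\<lambda>z. clip (G_fun l z - G_fun v z - (k - 1)))"
proof (rule integral_ge_has_integral)
  show "((\<lambda>z. 1 - s) has_integral ((1 - s) * M)) {0..M}"
    using has_integral_const_real[of "1 - s" 0 M] M by (simp add: mult.commute)
  show "continuous_on {0..M} (\<lambda>z. clip (G_fun l z - G_fun v z - (k - 1)))"
    using M by (intro clip_continuous) auto
  fix z assume "0 \<le> z" "z \<le> M"
  then show "1 - s \<le> clip (G_fun l z - G_fun v z - (k - 1))"
    using G_diff_antimono[of v l z M] M s by (auto simp: clip_def)
qed

lemma Psi_less: "Psi t < Psi u"
proof -
  have "M / l < M / v" using M by (intro divide_strict_left_mono) auto
  moreover have "0 < M / l" "M / v \<le> 1" using M by auto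
  ultimately have "arccos (M / v) < arccos (M / l)" by (intro arccos_less_arccos) linarith+
  then have "arctan t < arctan u" using t(4) u(3) by simp
  then have tu: "t < u" by (simp add: arctan_less_iff)
  have "t * u < 1" using tu u t by (meson less_le_trans mult_less_cancel_right2 mult_left_le_one_le less_imp_le le_less_trans mult_left_le)
  then have "0 < (u - t) * (1 - t * u)" using tu by simp
  then have "t * (1 + u\<^sup>2) < u * (1 + t\<^sup>2)" by (simp add: algebra_simps power2_eq_square)
  then have "t / (1 + t\<^sup>2) < u / (1 + u\<^sup>2)" by (simp add: divide_simps add_pos_nonneg)
  then show ?thesis using Psi_mono(2)[of t u] tu t u by simp
qed

lemma left_parabola:
  "M - 3 / 8 * s\<^sup>2 * pi / (Psi u - Psi t) \<le> integral {0..M} (\<lambda>z. clip (G_fun l z - G_fun v z - (k - 1)))"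
proof -
  define D where "D = M / pi * (Psi u - Psi t)"
  have D: "D = (G_fun l 0 - G_fun v 0) - (G_fun l M - G_fun v M)"
  proof -
    have "D = M / pi * (pi / 2 - (2 * arctan t - t)) - M / pi * (pi / 2 - (2 * arctan u - u))"
      by (simp add: D_def Psi_def right_diff_distrib)
    then show ?thesis using t(5) u(4) by simp
  qed
  have D0: "0 < D" using Psi_less M by (simp add: D_def)
  have "M - 3 / 8 * s\<^sup>2 * M / D \<le> integral {0..M} (\<lambda>z. clip (G_fun l z - G_fun v z - (k - 1)))"
  proof (rule integral_ge_parabola_left)
    show "continuous_on {0..M} (\<lambda>z. clip (G_fun l z - G_fun v z - (k - 1)))"
      using M by (intro clip_continuous) auto
    fix z assume z: "0 \<le> z" "z \<le> M"
    have "1 - s + D * (1 - (z / M)\<^sup>2) \<le> G_fun l z - G_fun v z - (k - 1)"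
      using G_diff_quadratic_chord[of M v l z] z M by (simp add: D s)
    then show "min 1 (1 - s + D * (1 - (z / M)\<^sup>2)) \<le> clip (G_fun l z - G_fun v z - (k - 1))"
      by (auto simp: clip_def)
  qed (use M D0 s in auto)
  moreover have "3 / 8 * s\<^sup>2 * M / D = 3 / 8 * s\<^sup>2 * pi / (Psi u - Psi t)"
    using M by (simp add: D_def)
  ultimately show ?thesis by simp
qed

lemma right_tangent:
  "9 / 32 / (1 / 2 - 2 * arctan t / pi) - G_fun v M * (v - M) / 2
    \<le> integral {M..l} (\<lambda>z. clip (G_fun l z - G_fun v z - (k - 1)))"
  using layer_tangent_right[of l M k] integral_clip_diff[of v l M l k] integral_G_fun_le[of v M l] M k G
  unfolding tau_eq by simp

text \<open>For the lowest layer clipping has no effect to the right of \<open>M\<close>, so the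
  full tail integral with its factor 3/5 is available.\<close>

lemma right_first:
  assumes "k = 1"
  shows "3 / 5 * (G_fun l M)\<^sup>2 / (1 / 2 - 2 * arctan t / pi) - G_fun v M * (v - M) / 2
    \<le> integral {M..l} (\<lambda>z. clip (G_fun l z - G_fun v z - (k - 1)))"
proof -
  have "integral {M..l} (\<lambda>z. clip (G_fun l z - G_fun v z - (k - 1))) = integral {M..l} (\<lambda>z. G_fun l z - G_fun v z)"
  proof (rule integral_cong)
    fix z assume z: "z \<in> {M..l}"
    then have "G_fun l z - G_fun v z \<le> G_fun l M - G_fun v M"
      using M by (intro G_diff_antimono) auto
    also have "\<dots> \<le> 1" using s assms by simp
    finally show "clip (G_fun l z - G_fun v z - (k - 1)) = G_fun l z - G_fun v z"
      using G_diff_nonneg[of v l z] z M assms by (simp add: clip_def)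
  qed
  also have "\<dots> = integral {M..l} (G_fun l) - integral {M..l} (G_fun v)"
    using M by (intro integral_diff integrable_continuous_real continuous_intros) auto
  finally show ?thesis
    using G_fun_tail_integral[of l M] integral_G_fun_le[of v M l] M unfolding tau_eq by simp
qed

lemma gam_eq: "G_fun l M = M / pi * gam t"
proof -
  have "G_fun l 0 = M / pi * ((1 + t\<^sup>2) / (2 * t))"
  proof -
    have "l = M * ((1 + t\<^sup>2) / (2 * t))"
      using t(1,3) M add_pos_nonneg[of 1 "t\<^sup>2"] by (simp add: field_simps)
    moreover have "G_fun l 0 = l / pi" using M by (simp add: G_fun_def)
    ultimately show ?thesis by simp
  qed
  then have "G_fun l M = M / pi * ((1 + t\<^sup>2) / (2 * t)) - M / pi * (pi / 2 - (2 * arctan t - t))"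
    using t(5) by simp
  also have "\<dots> = M / pi * ((1 + t\<^sup>2) / (2 * t) - (pi / 2 - (2 * arctan t - t)))"
    by (simp add: right_diff_distrib)
  also have "(1 + t\<^sup>2) / (2 * t) - (pi / 2 - (2 * arctan t - t)) = gam t"
    unfolding gam_def using t(1) by (simp add: field_simps power2_eq_square)
  finally show ?thesis .
qed

end

text \<open>Since \<open>F_fun\<close> is a maximum, reaching height \<open>k\<close> yields both
  inequalities at once, one from the cut-off -1/4 and one from G_m - H_m.\<close>

definition level :: "real \<Rightarrow> real \<Rightarrow> real \<Rightarrow> real \<Rightarrow> bool" where
  "level l m k M \<longleftrightarrow> k - 1 / 4 \<le> G_fun l M \<and> (M < m \<longrightarrow> k - (G_fun l M - G_fun m M) \<le> H_fun m M)"

lemma level_of_F: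
  assumes "k \<le> G_fun l M - F_fun m M"
  shows "level l m k M"
  using assms by (auto simp: level_def F_fun_def max_def split: if_splits)

text \<open>Exactly in these cases the area of layer \<open>k\<close> may fall short of \<open>M + 1/2\<close>: the part of the layer
  missing to the left of \<open>M\<close> reaches into, or starts in, the range where \<open>G_l - G_m\<close> is concave,
  with a shift that is not small.\<close>

definition bad :: "real \<Rightarrow> real \<Rightarrow> real \<Rightarrow> real \<Rightarrow> bool" where
  "bad l m k M \<longleftrightarrow> 1 \<le> M \<and> G_fun l M - G_fun m M < k \<and>
     (if m \<le> M then G_fun l m - G_fun m m < k else 19 / 100 < k - (G_fun l M - G_fun m M))"

lemma layer_not_bad:
  assumes "0 \<le> m" "m \<le> 22 / 25 * l" "0 < l" "M = 0 \<or> 1 \<le> M" "1 \<le> k" "level l m k M" "\<not> bad l m k M"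
  shows "M + 1 / 2 < layer l m k"
proof -
  have ml: "m < l" using assms by simp
  have G: "k - 1 / 4 \<le> G_fun l M" using assms(6) by (simp add: level_def)
  have M0: "0 \<le> M" using assms by auto
  have Ml: "M < l"
    using G assms(3,5) G_fun_eq_0[of l M] by (cases "M < l") auto
  show ?thesis
  proof (cases "k \<le> G_fun l M - G_fun m M")
    case True
    then show ?thesis using layer_above[of m l M k] ml assms M0 by simp
  next
    case False
    show ?thesis
    proof (cases "M = 0")
      case True
      show ?thesis
      proof (cases "m \<le> 7 / 10")
        case True
        then show ?thesis using layer_zero[of m l k] G ml assms \<open>M = 0\<close> by simp
      next
        case m: False
        have H: "k - (G_fun l 0 - G_fun m 0) \<le> H_fun m 0"
          using assms(6) m True by (simp add: level_def)
        \<comment> \<open>For m above 0.7 the shift at 0 is below 1 / 16.8, well under the threshold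
          0.19 of the concave estimate.\<close>
        have "H_fun m 0 = 3 * m\<^sup>2 / (24 * pi * (m\<^sup>2 * m))" using H_fun_alt[of 0 m] m by simp
        also have "\<dots> = 1 / (8 * (pi * m))" using m by (simp add: power2_eq_square)
        also have "\<dots> \<le> 1 / (8 * (3 * (7 / 10)))"
          using m pi_gt3 by (intro divide_left_mono mult_left_mono mult_mono mult_pos_pos) auto
        finally have "k - (G_fun l 0 - G_fun m 0) \<le> 19 / 100" using H by simp
        then show ?thesis
          using layer_concave[of M m l k] True m H False assms by simp
      qed
    next
      case M: False
      show ?thesis
      proof (cases "m \<le> M")
        case True
        have "k \<le> G_fun l m - G_fun m m" using assms(4,7) False M True by (auto simp: bad_def)
        moreover have "G_fun l M \<le> k" using False True assms(1) by (simp add: G_fun_eq_0)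
        ultimately show ?thesis using layer_convex[of m M l k] True M M0 Ml G assms by simp
      next
        case mM: False
        have "k - (G_fun l M - G_fun m M) \<le> 19 / 100" using assms(4,7) False M mM by (auto simp: bad_def)
        then show ?thesis
          using layer_concave[of M m l k] M0 mM False assms by (simp add: level_def)
      qed
    qed
  qed
qed

text \<open>The outer point \<open>v = max M m\<close> replaces \<open>m\<close>: enlarging \<open>m\<close> to \<open>M\<close> only decreases the layer
  area, and leaves \<open>G_l - G_m\<close> unchanged at \<open>M\<close>.\<close>

lemma bad_cases:
  assumes "0 \<le> m" "m \<le> 132" "m < l" "1 \<le> k" "level l m k M" "bad l m k M"
  obtains v t u s where "m \<le> v" "1 \<le> M" "M \<le> v" "v < l"
    "0 < t" "t < 1" "M / l = 2 * t / (1 + t\<^sup>2)" "arccos (M / l) = pi / 2 - 2 * arctan t"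
    "G_fun l 0 - G_fun l M = M / pi * (pi / 2 - (2 * arctan t - t))"
    "0 < u" "u \<le> 1" "arccos (M / v) = pi / 2 - 2 * arctan u"
    "G_fun v 0 - G_fun v M = M / pi * (pi / 2 - (2 * arctan u - u))"
    "s = k - (G_fun l M - G_fun v M)" "0 \<le> s" "s \<le> 2812 / 10000" "k - 1 / 4 \<le> G_fun l M"
    "near_edge (19 / 100) M u" "487 / 1000 \<le> u" "v * (786 / 1000) \<le> M" "0 \<le> G_fun v M" "G_fun v M \<le> 48 / 1000" "v - M \<le> 13 / 10"
proof -
  define v where "v = max M m"
  define s where "s = k - (G_fun l M - G_fun v M)"
  have M1: "1 \<le> M" and lt: "G_fun l M - G_fun m M < k" using assms(6) by (auto simp: bad_def)
  have M0: "0 < M" using M1 by simp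
  have G: "k - 1 / 4 \<le> G_fun l M" using assms(5) by (simp add: level_def)
  have "M < l" using G assms(1,3,4) G_fun_eq_0[of l M] by (cases "M < l") auto
  then have v: "m \<le> v" "M \<le> v" "v < l" using assms by (auto simp: v_def)
  have vM: "v = M \<and> m \<le> M \<or> v = m \<and> M < m" by (auto simp: v_def)
  have Gv: "G_fun v M = G_fun m M" using vM assms(1) M1 by (auto simp: G_fun_eq_0)
  have s0: "0 \<le> s" using lt Gv by (simp add: s_def)
  obtain t where t: "0 < t" "t \<le> 1" "M / l = 2 * t / (1 + t\<^sup>2)" "arccos (M / l) = pi / 2 - 2 * arctan t"
    "G_fun l 0 - G_fun l M = M / pi * (pi / 2 - (2 * arctan t - t))"
    using G_fun_drop[OF M0 less_imp_le[OF \<open>M < l\<close>]] by blast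
  have "M / l < 1" using \<open>M < l\<close> M1 by simp
  then have t1: "t < 1" using t(2,3) by (cases "t = 1") auto
  obtain u where u: "0 < u" "u \<le> 1" "M / v = 2 * u / (1 + u\<^sup>2)" "arccos (M / v) = pi / 2 - 2 * arctan u"
    "sqrt (1 - (M / v)\<^sup>2) = (1 - u\<^sup>2) / (1 + u\<^sup>2)"
    "G_fun v 0 - G_fun v M = M / pi * (pi / 2 - (2 * arctan u - u))"
    using G_fun_drop[OF M0 v(2)] by blast
  \<comment> \<open>If the point lies outside the inner radius, then u = 1 and the edge condition is
    trivial; this unifies both kinds of bad levels.\<close>
  have u_one: "u = 1" if "v = M"
  proof -
    have "(1 - u)\<^sup>2 = 0" using u(1,3) that M1 by (simp add: power2_eq_square field_simps add_nonneg_eq_0_iff)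
    then show ?thesis by simp
  qed
  have near: "near_edge h M u" if "v = M \<or> h \<le> H_fun m M" for h
  proof (cases "v = M")
    case True
    then show ?thesis using u_one by (simp add: near_edge_def)
  next
    case False
    then have "v = m" "M < m" "h \<le> H_fun m M" using vM that by auto
    then show ?thesis using near_edge_of_H[of M m u h] u M1 by simp
  qed
  have sH: "s \<le> H_fun m M" if "v \<noteq> M"
    using assms(5) vM that Gv by (auto simp: level_def s_def)
  have n19: "near_edge (19 / 100) M u"
  proof (rule near)
    show "v = M \<or> 19 / 100 \<le> H_fun m M"
      using sH assms(6) vM Gv by (auto simp: bad_def s_def split: if_splits)
  qed
  have "2 * (487 / 1000) / (1 + (487 / 1000)\<^sup>2) * (3 + 2 * (2 * (487 / 1000) / (1 + (487 / 1000)\<^sup>2))\<^sup>2)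
      < 24 * (31415 / 10000) * (19 / 100) * (1 * ((1 - (487 / 1000)\<^sup>2) / (1 + (487 / 1000 :: real)\<^sup>2)) ^ 3)"
    by (simp add: power2_eq_square power3_eq_cube)
  note e19 = G_fun_near_edge[OF M1 v(2) u(1,2,3,5) n19 _ _ _ this, simplified]
  have u487: "487 / 1000 \<le> u" using e19(1) by simp
  have x: "786 / 1000 \<le> M / v" using e19(2) by (simp add: power2_eq_square)
  have g48: "G_fun v M \<le> 48 / 1000"
    using e19(3) by (simp add: power2_eq_square)
  have vpos: "0 < v" using M1 v by simp
  \<comment> \<open>Either H is at most 0.2812 and bounds the shift, or the edge condition with h =
    0.2812 gives \<open>G_fun v M\<close> \<le> 0.0312, and then s \<le> 1/4 + 0.0312.\<close>
  have s28: "s \<le> 2812 / 10000"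
  proof (cases "v \<noteq> M \<and> H_fun m M \<le> 2812 / 10000")
    case True
    then show ?thesis using sH by simp
  next
    case False
    then have n28: "near_edge (2812 / 10000) M u" by (intro near) auto
    have "2 * (533 / 1000) / (1 + (533 / 1000)\<^sup>2) * (3 + 2 * (2 * (533 / 1000) / (1 + (533 / 1000)\<^sup>2))\<^sup>2)
      < 24 * (31415 / 10000) * (2812 / 10000) * (1 * ((1 - (533 / 1000)\<^sup>2) / (1 + (533 / 1000 :: real)\<^sup>2)) ^ 3)"
      by (simp add: power2_eq_square power3_eq_cube)
    note e28 = G_fun_near_edge[OF M1 v(2) u(1,2,3,5) n28 _ _ _ this, simplified]
    have "G_fun v M \<le> 312 / 10000" using e28(3) by (simp add: power2_eq_square)
    then show ?thesis using G by (simp add: s_def)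
  qed
  have d: "v - M \<le> 13 / 10"
  proof (cases "v = M")
    case False
    define y where "y = sqrt (1 - (M / v)\<^sup>2)"
    have xv: "M / v \<le> 1" "0 \<le> M / v" using v M1 vpos by auto
    have "(M / v)\<^sup>2 \<le> 1" using xv by (simp add: power_le_one)
    then have y: "0 \<le> y" "y\<^sup>2 = 1 - (M / v)\<^sup>2" by (auto simp: y_def)
    have c: "v * y ^ 3 \<le> 35 / 100"
      using near_edge_cube[OF _ v(2) u(1,3,5) n19] M1 by (simp add: y_def)
    have vy: "(v - M) * (1 + M / v) = v * y\<^sup>2"
      unfolding y(2) using vpos by (simp add: field_simps power2_eq_square)
    show ?thesis
    proof (rule edge_distance[where x = "M / v" and m = v and c = "v * y ^ 3"])
      show "v - M = v * (1 - M / v)" using vpos by (simp add: right_diff_distrib)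
      show "((v - M) * (1 + M / v)) ^ 3 \<le> v * (v * y ^ 3)\<^sup>2"
        unfolding vy by (simp add: power2_eq_square power3_eq_cube)
      show "v \<le> 132" using False vM assms by auto
      show "78 / 100 \<le> M / v" using x by linarith
    qed (use x xv v vpos y c in auto)
  qed simp
  have vx: "v * (786 / 1000) \<le> M" using x vpos by (simp only: pos_le_divide_eq mult.commute)
  have g0: "0 \<le> G_fun v M" using vpos M0 by (intro G_fun_nonneg) auto
  show ?thesis
    by (rule that[of v t u s]) (fact | fact s_def)+
qed

lemma edge_loss_le:
  assumes "0 \<le> g" "g \<le> 48 / 1000" "0 \<le> d" "d \<le> c"
  shows "g * d / 2 \<le> 24 / 1000 * (c::real)"
proof -
  have "g * d \<le> 48 / 1000 * c" using assms by (intro mult_mono) auto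
  then show ?thesis by simp
qed

text \<open>For k = 1 there is a trade-off in GM = G_l M: since s \<le> 1.048 - GM, a large value
  means a small shift, while a small value forces a larger \<open>t\<close>, hence a flatter tangent
  and more gain. M = 1 and M = 2 are split by GM; from 3 on the numerical chain applies.\<close>

lemma layer_bad_first:
  assumes "0 \<le> m" "m \<le> 132" "m < l" "l \<le> 150" "level l m 1 M" "bad l m 1 M" "M = 1 \<or> M = 2 \<or> 3 \<le> M"
  shows "M + 1 / 2 < layer l m 1"
proof -
  obtain v t u s where v: "m \<le> v" "1 \<le> M" "M \<le> v" "v < l"
    and t: "0 < t" "t < 1" "M / l = 2 * t / (1 + t\<^sup>2)" "arccos (M / l) = pi / 2 - 2 * arctan t"
    "G_fun l 0 - G_fun l M = M / pi * (pi / 2 - (2 * arctan t - t))"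
    and u: "0 < u" "u \<le> 1" "arccos (M / v) = pi / 2 - 2 * arctan u"
    "G_fun v 0 - G_fun v M = M / pi * (pi / 2 - (2 * arctan u - u))"
    and s: "s = 1 - (G_fun l M - G_fun v M)" "0 \<le> s" "s \<le> 2812 / 10000" and G: "1 - 1 / 4 \<le> G_fun l M"
    and near: "near_edge (19 / 100) M u" and x: "v * (786 / 1000) \<le> M"
    and g: "0 \<le> G_fun v M" "G_fun v M \<le> 48 / 1000" and d: "v - M \<le> 13 / 10"
    by (rule bad_cases[OF assms(1,2,3) order_refl assms(5,6)]) (rule that, assumption+)
  note ctx = assms(1) v(1,2,3,4) order_refl t u s(1,2) G
  define GM where "GM = G_fun l M"
  define T where "T = 1 / 2 - 2 * arctan t / pi"
  define W where "W = 3 / 8 * s\<^sup>2 * pi / (Psi u - Psi t)"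
  have T0: "0 < T" using tau_pos[of t] t by (simp add: T_def)
  have GM: "3 / 4 \<le> GM" "GM \<le> 1048 / 1000" "s \<le> 1048 / 1000 - GM" using G s g by (auto simp: GM_def)
  have GMgam: "GM = M / pi * gam t" using gam_eq[OF ctx] by (simp add: GM_def)
  have right: "3 / 5 * GM\<^sup>2 / T - G_fun v M * (v - M) / 2
    \<le> integral {M..l} (\<lambda>z. clip (G_fun l z - G_fun v z - (1 - 1)))"
    using right_first[OF ctx refl] by (simp add: GM_def T_def)
  have parab: "M - W + (3 / 5 * GM\<^sup>2 / T - G_fun v M * (v - M) / 2) \<le> layer l m 1"
    unfolding W_def by (rule layer_parts[OF ctx left_parabola[OF ctx] right])
  have crude: "(1 - s) * M + (3 / 5 * GM\<^sup>2 / T - G_fun v M * (v - M) / 2) \<le> layer l m 1"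
    by (rule layer_parts[OF ctx left_crude[OF ctx] right])
  have gd: "G_fun v M * (v - M) / 2 \<le> 24 / 1000 * (13 / 10)"
    using edge_loss_le[of "G_fun v M" "v - M" "13 / 10"] g d v by simp
  have gain: "3 / 5 * a\<^sup>2 / T \<le> 3 / 5 * GM\<^sup>2 / T" if "0 \<le> a" "a \<le> GM" for a
    using that T0 by (intro divide_right_mono mult_left_mono power_mono) auto
  have gam_lt: "gam t < c" if "GM \<le> a" "31416 / 10000 * a < M * c" for a c
  proof -
    have "M * gam t = pi * GM" using GMgam by simp
    also have "\<dots> \<le> 31416 / 10000 * GM" using GM pi_bounds by (intro mult_right_mono) auto
    also have "\<dots> < M * c" using that by simp
    finally show ?thesis using v by simp
  qed
  have gamma_ge: "b \<le> t"
    if "B \<le> arctan b" "GM \<le> a" "31416 / 10000 * a < M * ((1 - b\<^sup>2) / (2 * b) - 31416 / 20000 + 2 * B)" for a b B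
    using half_tangent_ge[OF t(1) that(1) gam_lt[OF that(2,3)]] .
  have T_le: "T \<le> 1 / 2 - 2 * A / (31416 / 10000)" if "0 \<le> A" "A \<le> arctan a" "a \<le> t" for a A
    unfolding T_def using that by (rule tau_upper)
  consider "M = 1" | "M = 2" | "3 \<le> M" using assms(7) by auto
  then show ?thesis
  proof cases
    case 1
    \<comment> \<open>At M = 1 the edge condition gives v \<le> 1 / 0.786 < 1.3, much better than
      the general distance bound.\<close>
    have gd1: "G_fun v M * (v - M) / 2 \<le> 24 / 1000 * (3 / 10)"
      using edge_loss_le[of "G_fun v M" "v - M" "3 / 10"] g x v 1 by simp
    show ?thesis
    proof (cases "GM \<le> 77 / 100")
      case True
      have t131: "131 / 1000 \<le> t"
        by (rule gamma_ge[OF arctan_lower_values(3) True]) (simp add: 1 power2_eq_square)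
      have "T \<le> 1 / 2 - 2 * (13025 / 100000) / (31416 / 10000)"
        by (rule T_le[OF _ arctan_lower_values(3) t131]) simp
      then have "3 / 5 * (3 / 4)\<^sup>2 / (1 / 2 - 2 * (13025 / 100000) / (31416 / 10000)) \<le> 3 / 5 * (3 / 4)\<^sup>2 / T"
        using T0 by (intro divide_left_mono) auto
      then have "8 / 10 \<le> 3 / 5 * (3 / 4)\<^sup>2 / T" by (simp add: power2_eq_square)
      then show ?thesis using crude gain[of "3 / 4"] GM gd1 s 1 by simp
    next
      case False
      have t106: "106 / 1000 \<le> t"
        by (rule gamma_ge[OF arctan_lower_values(1) GM(2)]) (simp add: 1 power2_eq_square)
      have "T \<le> 1 / 2 - 2 * (10560 / 100000) / (31416 / 10000)"
        by (rule T_le[OF _ arctan_lower_values(1) t106]) simp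
      then have "3 / 5 * (77 / 100)\<^sup>2 / (1 / 2 - 2 * (10560 / 100000) / (31416 / 10000)) \<le> 3 / 5 * (77 / 100)\<^sup>2 / T"
        using T0 by (intro divide_left_mono) auto
      then have "8 / 10 \<le> 3 / 5 * (77 / 100)\<^sup>2 / T" by (simp add: power2_eq_square)
      then show ?thesis using crude gain[of "77 / 100"] GM gd1 False 1 by simp
    qed
  next
    case 2
    \<comment> \<open>A larger \<open>t\<close> would need M \<ge> 2.02 to keep G_l M at
      3/4.\<close>
    have t206: "t \<le> 206 / 1000"
    proof (rule ccontr)
      assume "\<not> ?thesis"
      then have "206 / 1000 \<le> t" by simp
      then have "202 / 100 \<le> M"
        using radius_lower[OF _ _ _ \<open>206 / 1000 \<le> t\<close> arctan_upper_values(2), of M "202 / 100"] GM(1) GMgam 2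
        by (simp add: power2_eq_square)
      then show False using 2 by simp
    qed
    have near2: "2 * (568 / 1000) / (1 + (568 / 1000)\<^sup>2) * (3 + 2 * (2 * (568 / 1000) / (1 + (568 / 1000)\<^sup>2))\<^sup>2)
      < 24 * (31415 / 10000) * (19 / 100) * (2 * ((1 - (568 / 1000)\<^sup>2) / (1 + (568 / 1000 :: real)\<^sup>2)) ^ 3)"
      by (simp add: power2_eq_square power3_eq_cube)
    show ?thesis
    proof (cases "GM \<le> 85 / 100")
      case True
      have t19: "190 / 1000 \<le> t"
        by (rule gamma_ge[OF arctan_lower_values(5) True]) (simp add: 2 power2_eq_square)
      have "5315 / 10000 + W < 27 / 80 / T"
        unfolding W_def T_def
        by (rule gain_loss_piece[where R = 2, OF t19 t206 _ _ u(1,2) near _ _ _ s(2,3)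
              arctan_lower_values(5) arctan_upper_values(2) arctan_lower_values(14) _ _ near2])
           (simp_all add: 2 power2_eq_square)
      then show ?thesis using parab gain[of "3 / 4"] GM gd by (simp add: power2_eq_square)
    next
      case False
      have t165: "165 / 1000 \<le> t"
        by (rule gamma_ge[OF arctan_lower_values(4) GM(2)]) (simp add: 2 power2_eq_square)
      have "T \<le> 1 / 2 - 2 * (16352 / 100000) / (31416 / 10000)"
        by (rule T_le[OF _ arctan_lower_values(4) t165]) simp
      then have "3 / 5 * (85 / 100)\<^sup>2 / (1 / 2 - 2 * (16352 / 100000) / (31416 / 10000)) \<le> 3 / 5 * (85 / 100)\<^sup>2 / T"
        using T0 by (intro divide_left_mono) auto
      then have A: "1 \<le> 3 / 5 * (85 / 100)\<^sup>2 / T" by (simp add: power2_eq_square)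
      have "568 / 1000 \<le> u" using near_edge_lower[OF near u(1) _ _ _ _ near2] 2 by simp
      then have PD: "2 * (51655 / 100000) - 568 / 1000 - (2 * (20317 / 100000) - 206 / 1000) \<le> Psi u - Psi t"
        using Psi_diff_lower[OF _ t206 _ _ _ u(2) arctan_upper_values(2) arctan_lower_values(14)] t by simp
      have s2: "s \<le> 2 / 10" using GM False by simp
      have "W \<le> 3 / 8 * (2 / 10)\<^sup>2 * (31416 / 10000) / (2 * (51655 / 100000) - 568 / 1000 - (2 * (20317 / 100000) - 206 / 1000))"
        unfolding W_def by (rule parabola_loss_le[OF _ PD s(2) s2]) simp
      then have "W \<le> 3 / 10" by (simp add: power2_eq_square)
      then show ?thesis using parab gain[of "85 / 100"] GM gd A False by simp
    qed
  next
    case 3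
    have t211: "211 / 1000 \<le> t"
    proof (rule gamma_ge[OF arctan_lower_values(6) GM(2)])
      have "31416 / 10000 * (1048 / 1000)
        < 3 * ((1 - (211 / 1000)\<^sup>2) / (2 * (211 / 1000)) - 31416 / 20000 + 2 * (20794 / 100000 :: real))"
        by (simp add: power2_eq_square)
      also have "\<dots> \<le> M * ((1 - (211 / 1000)\<^sup>2) / (2 * (211 / 1000)) - 31416 / 20000 + 2 * (20794 / 100000))"
        using 3 by (intro mult_right_mono) (simp_all add: power2_eq_square)
      finally show "31416 / 10000 * (1048 / 1000)
        < M * ((1 - (211 / 1000)\<^sup>2) / (2 * (211 / 1000)) - 31416 / 20000 + 2 * (20794 / 100000))" .
    qed
    have "5315 / 10000 + W < 27 / 80 / T"
      unfolding W_def T_def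
      by (rule gain_exceeds_loss[OF _ 3 _ t211 t(2) u(1,2) near s(2,3)])
         (use GM GMgam v assms in auto)
    then show ?thesis using parab gain[of "3 / 4"] GM gd by (simp add: power2_eq_square)
  qed
qed

text \<open>The deficit of a bad layer \<open>k \<ge> 2\<close> is paid for by the surplus of the first layer, where
  \<open>G_l - G_m\<close> is flat. Here \<open>z \<ge> M1\<close> with \<open>G_l z = 3/4\<close> also satisfies \<open>z \<ge> M + 2\<close>, because
  \<open>G_l\<close> has slope at most \<open>1/2\<close>.\<close>

lemma layer_bad_later:
  assumes "0 \<le> m" "m \<le> 132" "m < l" "l \<le> 150" "2 \<le> k" "level l m k M" "bad l m k M"
    and "0 \<le> M1" "3 / 4 \<le> G_fun l M1"
  shows "M1 + M + 1 < layer l m 1 + layer l m k"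
proof -
  have k1: "1 \<le> k" using assms by simp
  obtain v t u s where v: "m \<le> v" "1 \<le> M" "M \<le> v" "v < l"
    and t: "0 < t" "t < 1" "M / l = 2 * t / (1 + t\<^sup>2)" "arccos (M / l) = pi / 2 - 2 * arctan t"
    "G_fun l 0 - G_fun l M = M / pi * (pi / 2 - (2 * arctan t - t))"
    and u: "0 < u" "u \<le> 1" "arccos (M / v) = pi / 2 - 2 * arctan u"
    "G_fun v 0 - G_fun v M = M / pi * (pi / 2 - (2 * arctan u - u))"
    and s: "s = k - (G_fun l M - G_fun v M)" "0 \<le> s" "s \<le> 2812 / 10000" and G: "k - 1 / 4 \<le> G_fun l M"
    and near: "near_edge (19 / 100) M u" and u487: "487 / 1000 \<le> u"
    and g: "0 \<le> G_fun v M" "G_fun v M \<le> 48 / 1000" and d: "v - M \<le> 13 / 10"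
    by (rule bad_cases[OF assms(1,2,3) k1 assms(6,7)]) (rule that, assumption+)
  note ctx = assms(1) v(1,2,3,4) k1 t u s(1,2) G
  define T where "T = 1 / 2 - 2 * arctan t / pi"
  define W where "W = 3 / 8 * s\<^sup>2 * pi / (Psi u - Psi t)"
  have l0: "0 < l" using assms by simp
  have T0: "0 < T" using tau_pos[of t] t by (simp add: T_def)
  have T2: "T \<le> 1 / 2" using t by (simp add: T_def)
  have GMgam: "G_fun l M = M / pi * gam t" by (rule gam_eq[OF ctx])
  have gd: "G_fun v M * (v - M) / 2 \<le> 24 / 1000 * (13 / 10)"
    using edge_loss_le[of "G_fun v M" "v - M" "13 / 10"] g d v by simp
  have "M - W + (9 / 32 / T - G_fun v M * (v - M) / 2) \<le> layer l m k"
    unfolding W_def T_def by (rule layer_parts[OF ctx left_parabola[OF ctx] right_tangent[OF ctx]])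
  then have layer_k: "M - W + 9 / 32 / T - 312 / 10000 \<le> layer l m k" using gd by simp
  define a where "a = max M1 (M + 2)"
  have half: "G_fun l M - (z / 2 - M / 2) \<le> G_fun l z" if "M \<le> z" for z
  proof -
    have "arccos (M / l) / pi * (z - M) \<le> 1 / 2 * (z - M)"
      using arccos_div_bounds(3)[of l M] v that by (intro mult_right_mono) auto
    moreover have "G_fun l M - arccos (M / l) / pi * (z - M) \<le> G_fun l z"
      using v that by (intro G_fun_tangent) auto
    moreover have "1 / 2 * (z - M) = z / 2 - M / 2" by (simp add: diff_divide_distrib)
    ultimately show ?thesis by linarith
  qed
  have Ga: "3 / 4 \<le> G_fun l a" "0 \<le> a"
  proof -
    have "(M + 2) / 2 - M / 2 = 1" by (simp add: field_simps)
    then have "3 / 4 \<le> G_fun l (M + 2)" using half[of "M + 2"] G assms(5) by simp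
    then show "3 / 4 \<le> G_fun l a" "0 \<le> a" using assms(8,9) v by (auto simp: a_def max_def)
  qed
  have al: "a < l" using Ga G_fun_eq_0[of l a] l0 by (cases "a < l") auto
  obtain z where z: "a \<le> z" "z \<le> l" "G_fun l z = 3 / 4"
    using IVT2'[of "G_fun l" l "3 / 4" a] Ga al l0 G_fun_eq_0[of l l] G_fun_continuous_on[of l "{a..l}"]
    by auto
  have zM: "M1 \<le> z" "M + 2 \<le> z" using z by (auto simp: a_def)
  have zl: "z < l" using z G_fun_eq_0[of l l] l0 by (cases "z = l") auto
  have Gm: "1 \<le> G_fun l m"
  proof (cases "m \<le> M")
    case True
    then show ?thesis using G_fun_antimono[of l m M] G assms by simp
  next
    \<comment> \<open>Here m - M \<le> 1.3, so slope at most 1/2 leaves at least 7/4 - 0.65 >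
      1.\<close>
    case False
    then have "G_fun l M - (m / 2 - M / 2) \<le> G_fun l m" by (intro half) simp
    then show ?thesis using v(1) d G assms(5) by linarith
  qed
  have mz: "m \<le> z"
    using G_fun_antimono[of l z m] Gm z assms zM v by (cases "m \<le> z") auto
  have z0: "0 < z" using zM v by simp
  obtain t1 where t1: "0 < t1" "t1 \<le> 1" "arccos (z / l) = pi / 2 - 2 * arctan t1"
    "G_fun l z = z / pi * ((1 - t1\<^sup>2) / (2 * t1) - pi / 2 + 2 * arctan t1)"
    using G_fun_drop[OF z0 less_imp_le[OF zl]] by blast
  define T1 where "T1 = 1 / 2 - 2 * arctan t1 / pi"
  have T1: "arccos (z / l) / pi = T1" unfolding t1(3) T1_def by (simp add: diff_divide_distrib)
  have "z + 49 / 160 / T1 \<le> layer l m 1"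
    using layer_first[of m z l] mz zl z Gm assms zM v by (simp add: G_fun_eq_0 T1)
  then have layer_1: "M1 + 49 / 160 / T1 \<le> layer l m 1" using zM by simp
  have T1pos: "0 < T1"
  proof -
    have "0 < z / l" "z / l < 1" using z0 zl l0 by auto
    then have "0 < arccos (z / l)" using arccos_less_arccos[of "z / l" 1] by simp
    then show ?thesis unfolding T1[symmetric] by simp
  qed
  \<comment> \<open>Since z \<ge> M + 2 \<ge> 3 while G_l z is only 3/4, the tangent at z is already
    flat.\<close>
  have t125: "250 / 1000 \<le> t1"
  proof (rule half_tangent_ge[OF t1(1) arctan_lower_values(7)])
    have "z * gam t1 = 3 / 4 * pi" using t1(4) z(3) zM v by (simp add: gam_def field_simps)
    also have "\<dots> \<le> 3 * (31416 / 40000)" using pi_bounds by simp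
    also have "\<dots> \<le> z * (31416 / 40000)" using zM v by (intro mult_right_mono) auto
    finally have "gam t1 \<le> 31416 / 40000" using zM v by simp
    then show "gam t1 < (1 - (250 / 1000)\<^sup>2) / (2 * (250 / 1000)) - 31416 / 20000 + 2 * (24497 / 100000)"
      by (simp add: power2_eq_square)
  qed
  have "T1 \<le> 1 / 2 - 2 * (24497 / 100000) / (31416 / 10000)"
    unfolding T1_def by (rule tau_upper[OF _ arctan_lower_values(7) t125]) simp
  then have "49 / 160 / (1 / 2 - 2 * (24497 / 100000) / (31416 / 10000)) \<le> 49 / 160 / T1"
    using T1pos by (intro divide_left_mono) auto
  then have gain1: "88 / 100 \<le> 49 / 160 / T1" by simp
  have W_le: "W \<le> w" if "t \<le> b" "b \<le> 1" "arctan b \<le> B"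
    "0 < 2 * (45319 / 100000) - 487 / 1000 - (2 * B - b)"
    "3 / 8 * (2812 / 10000)\<^sup>2 * (31416 / 10000) / (2 * (45319 / 100000) - 487 / 1000 - (2 * B - b)) \<le> w" for b B w
  proof -
    have "2 * (45319 / 100000) - 487 / 1000 - (2 * B - b) \<le> Psi u - Psi t"
      using Psi_diff_lower[OF _ that(1,2) _ u487 u(2) that(3) arctan_lower_values(12)] t by simp
    from parabola_loss_le[OF that(4) this s(2,3)] show ?thesis using that(5) by (simp add: W_def)
  qed
  have "1 + 312 / 10000 < 49 / 160 / T1 + 9 / 32 / T - W"
  proof -
    consider "t \<le> 126 / 1000" | "126 / 1000 \<le> t" "t \<le> 213 / 1000" | "213 / 1000 \<le> t" by linarith
    then show ?thesis
    proof cases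
      case 1
      have "W \<le> 36 / 100"
        by (rule W_le[OF 1 _ arctan_upper_values(1)]) (simp_all add: power2_eq_square)
      moreover have "9 / 32 / (1 / 2) \<le> 9 / 32 / T" using T0 T2 by (intro divide_left_mono) auto
      ultimately show ?thesis using gain1 by simp
    next
      case 2
      have "W \<le> 47 / 100"
        by (rule W_le[OF 2(2) _ arctan_upper_values(4)]) (simp_all add: power2_eq_square)
      moreover have "T \<le> 1 / 2 - 2 * (12533 / 100000) / (31416 / 10000)"
        unfolding T_def by (rule tau_upper[OF _ arctan_lower_values(2) 2(1)]) simp
      then have "9 / 32 / (1 / 2 - 2 * (12533 / 100000) / (31416 / 10000)) \<le> 9 / 32 / T"
        using T0 by (intro divide_left_mono) auto
      then have "66 / 100 \<le> 9 / 32 / T" by simp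
      ultimately show ?thesis using gain1 by simp
    next
      case 3
      have G74: "7 / 4 \<le> M / pi * gam t" using G assms(5) unfolding GMgam by linarith
      then have G34: "3 / 4 \<le> M / pi * gam t" by linarith
      have t211: "211 / 1000 \<le> t" using 3 by simp
      have "3 \<le> M"
      proof -
        \<comment> \<open>Scaling by 3/7 turns the bound 7/4 into the 3/4 expected by
          \<open>radius_lower\<close>.\<close>
        have "M * (3 / 7) / pi * gam t = 3 / 7 * (M / pi * gam t)" by simp
        then have "3 / 4 \<le> M * (3 / 7) / pi * gam t" using G74 by linarith
        then have "21 / 10 \<le> M * (3 / 7)"
          using radius_lower[OF _ _ _ t211 arctan_upper_values(3), of "M * (3 / 7)" "21 / 10"] v
          by (simp add: power2_eq_square)
        then show ?thesis by simp
      qed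
      then have "5315 / 10000 + W < 27 / 80 / T"
        unfolding W_def T_def
        using gain_exceeds_loss[OF G34 _ _ t211 t(2) u(1,2) near s(2,3)] v assms by simp
      \<comment> \<open>The gain 27/80 of the numerical chain splits into 9/32, which layer
        \<open>k\<close> earns itself, and 9/160, lent by the first layer, whose slope
        \<open>T1\<close> is at most \<open>T\<close>.\<close>
      moreover have "1 / 2 \<le> 49 / 160 / T1 - 9 / 160 / T"
      proof -
        have "T1 \<le> T"
        proof -
          have "arccos (z / l) \<le> arccos (M / l)"
          proof (rule arccos_le_arccos)
            have "0 < M / l" using v l0 by simp
            then show "- 1 \<le> M / l" by linarith
          qed (use zM zl l0 in \<open>auto intro!: divide_right_mono\<close>)
          then have "arccos (z / l) / pi \<le> arccos (M / l) / pi" by (simp add: divide_right_mono)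
          then show ?thesis unfolding T1 tau_eq[OF ctx] T_def .
        qed
        then have "9 / 160 / T \<le> 9 / 160 / T1" using T1pos by (intro divide_left_mono) auto
        moreover have "49 / 160 / T1 = 40 / 160 / T1 + 9 / 160 / T1" by (simp add: add_divide_distrib[symmetric])
        moreover have "40 / 160 / T1 = 40 / 49 * (49 / 160 / T1)" by simp
        ultimately show ?thesis using gain1 by linarith
      qed
      moreover have "27 / 80 / T = 9 / 32 / T + 9 / 160 / T" by (simp add: add_divide_distrib[symmetric])
      ultimately show ?thesis by simp
    qed
  qed
  then show ?thesis using layer_1 layer_k by simp
qed

section \<open>Counting\<close>

text \<open>Consecutive levels force a gap in G_l: at M' it is at least k + 3/4, at a bad M < m at
  most k + 0.048. A gap of 0.702 exceeds 1.3 / 2, the most that slope 1/2 allows within the critical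
  range below \<open>m\<close>. If M' \<ge> m, monotonicity of G_l - G_m already contradicts badness
  at level k.\<close>

lemma bad_unique:
  assumes "0 \<le> m" "m \<le> 132" "m < l" "1 \<le> k" "k + 1 \<le> k'"
    "level l m k M" "bad l m k M" "level l m k' M'" "bad l m k' M'"
  shows False
proof -
  have l0: "0 < l" using assms by simp
  have M: "1 \<le> M" "G_fun l M - G_fun m M < k" and M': "1 \<le> M'" using assms by (auto simp: bad_def)
  have G': "k + 3 / 4 \<le> G_fun l M'" using assms(5,8) by (simp add: level_def)
  have edge: "m - N \<le> 13 / 10" "m \<le> N \<or> G_fun m N \<le> 48 / 1000"
    if bad: "1 \<le> j" "level l m j N" "bad l m j N" for j N
  proof -
    obtain v where v: "m \<le> v" "1 \<le> N" "N \<le> v" "G_fun v N \<le> 48 / 1000" "v - N \<le> 13 / 10"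
      by (rule bad_cases[OF assms(1,2,3) bad]) (rule that, assumption+)
    then show "m - N \<le> 13 / 10" by simp
    show "m \<le> N \<or> G_fun m N \<le> 48 / 1000"
      using G_fun_mono_radius[of m v N] v assms(1) by simp
  qed
  have half: "G_fun l x - G_fun l y \<le> y / 2 - x / 2" if "0 \<le> x" "x \<le> y" "x \<le> l" for x y
  proof -
    have "arccos (x / l) / pi * (y - x) \<le> 1 / 2 * (y - x)"
      using arccos_div_bounds(3)[of l x] that l0 by (intro mult_right_mono) auto
    moreover have "G_fun l x - arccos (x / l) / pi * (y - x) \<le> G_fun l y"
      using that l0 by (intro G_fun_tangent) auto
    moreover have "1 / 2 * (y - x) = y / 2 - x / 2" by (simp add: diff_divide_distrib)
    ultimately show ?thesis by linarith
  qed
  show False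
  proof (cases "m \<le> M'")
    case True
    then have p': "k + 3 / 4 \<le> G_fun l M' - G_fun m M'" using G' assms(1) by (simp add: G_fun_eq_0)
    show False
    proof (cases "m \<le> M")
      case True
      then have "G_fun l m - G_fun m m < k" using assms(7) by (simp add: bad_def)
      then show False using G_diff_antimono[of m l m M'] p' \<open>m \<le> M'\<close> assms l0 by simp
    next
      case False
      then show False using G_diff_antimono[of m l M M'] p' True M assms l0 by simp
    qed
  next
    case False
    have d: "m - M' \<le> 13 / 10" using edge(1)[OF _ assms(8,9)] assms by simp
    show False
    proof (cases "m \<le> M")
      case True
      then have "G_fun l m - G_fun m m < k" using assms(7) by (simp add: bad_def)
      then have "G_fun l m < k" using assms(1) by (simp add: G_fun_eq_0)
      moreover have "G_fun l M' - G_fun l m \<le> m / 2 - M' / 2" using False M' assms by (intro half) auto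
      ultimately show False using G' d by simp
    next
      case mM: False
      then have "G_fun m M \<le> 48 / 1000" using edge(2)[OF assms(4,6,7)] by simp
      then have GM: "G_fun l M < k + 48 / 1000" using M by simp
      show False
      proof (cases "M \<le> M'")
        case True
        then show False using G_fun_antimono[of l M M'] GM G' M l0 by simp
      next
        case False
        then have "G_fun l M' - G_fun l M \<le> M / 2 - M' / 2" using M' mM assms by (intro half) auto
        then show False using GM G' d mM by simp
      qed
    qed
  qed
qed

text \<open>For negative \<open>x\<close> the sum is 0 and the floor negative, hence only an
  inequality.\<close>

lemma floor_eq_sum_levels:
  assumes "x \<le> real N"
  shows "real_of_int \<lfloor>x\<rfloor> \<le> (\<Sum>k=1..N. if real k \<le> x then 1 else 0)"
proof -
  have "(\<Sum>k=1..n. if real k \<le> x then 1 else 0) = real_of_int (max 0 (min (int n) \<lfloor>x\<rfloor>))" for n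
  proof (induction n)
    case (Suc n)
    have "real (Suc n) \<le> x \<longleftrightarrow> int (Suc n) \<le> \<lfloor>x\<rfloor>" by (simp add: le_floor_iff)
    then show ?case using Suc by (auto simp: max_def min_def)
  qed simp
  moreover have "\<lfloor>x\<rfloor> \<le> int N" using assms by (simp add: floor_le_iff)
  ultimately show ?thesis by (simp add: max_def)
qed

text \<open>Interior points belong to two trapezoids and 0 to one; the right end contributes nothing
  by assumption.\<close>

lemma trap_floor_nat:
  assumes "\<lfloor>g (real (Suc n))\<rfloor> = 0"
  shows "2 * trap_floor g 0 (int n + 1) = of_int \<lfloor>g 0\<rfloor> + 2 * (\<Sum>j=1..n. of_int \<lfloor>g (real j)\<rfloor>)"
proof -
  define f where "f = (\<lambda>j::nat. real_of_int \<lfloor>g (real j)\<rfloor>)"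
  have "2 * trap_floor g 0 (int n + 1) = (\<Sum>i\<in>{0..int n}. real_of_int (\<lfloor>g (real_of_int i)\<rfloor> + \<lfloor>g (real_of_int (i + 1))\<rfloor>))"
    by (simp add: trap_floor_def)
  also have "\<dots> = (\<Sum>j\<in>{0..n}. f j + f (Suc j))"
  proof (rule sum.reindex_bij_witness[of _ int nat])
    show "f (nat i) + f (Suc (nat i)) = real_of_int (\<lfloor>g (real_of_int i)\<rfloor> + \<lfloor>g (real_of_int (i + 1))\<rfloor>)"
      if "i \<in> {0..int n}" for i
      using that by (simp add: f_def add.commute)
  qed auto
  also have "\<dots> = (\<Sum>j=0..n. f j) + (\<Sum>j=0..n. f (Suc j))" by (rule sum.distrib)
  also have "(\<Sum>j=0..n. f j) = f 0 + (\<Sum>j=1..n. f j)" by (simp add: sum.atLeast_Suc_atMost)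
  also have "(\<Sum>j=0..n. f (Suc j)) = (\<Sum>j=1..n. f j) + f (Suc n)"
    using sum.shift_bounds_cl_Suc_ivl[of f 0 n] by simp
  also have "f (Suc n) = 0" using assms by (simp add: f_def)
  finally show ?thesis by (simp add: f_def)
qed

theorem mainTheorem13:
  fixes l \<mu> :: real
  assumes "5 / 2 \<le> l" and "l \<le> 150"
    and "0 \<le> \<mu>" and "\<mu> \<le> 22 / 25 * l"
  shows "P_fun l \<mu> < (l\<^sup>2 - \<mu>\<^sup>2) / 4"
proof -
  define g where "g = (\<lambda>z. G_fun l z - F_fun \<mu> z)"
  define n where "n = nat \<lfloor>l\<rfloor>"
  define N where "N = nat \<lceil>l\<rceil> + 1"
  have l0: "0 < l" and ml: "\<mu> < l" and m132: "\<mu> \<le> 132" using assms by auto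
  have n: "int n = \<lfloor>l\<rfloor>" using l0 by (simp add: n_def)
  then have nl: "real n \<le> l" "l < real (Suc n)" by linarith+
  \<comment> \<open>Beyond \<open>l\<close> and \<mu> only the cut-off of \<open>F_fun\<close>
    remains, and the floor of 1/4 is 0.\<close>
  have "g (real (Suc n)) = 1 / 4"
    using nl ml l0 by (simp add: g_def F_fun_def G_fun_eq_0)
  then have "\<lfloor>g (real (Suc n))\<rfloor> = 0" by (simp only:) simp
  then have P: "P_fun l \<mu> = of_int \<lfloor>g 0\<rfloor> + 2 * (\<Sum>j=1..n. of_int \<lfloor>g (real j)\<rfloor>)"
    using trap_floor_nat[of g n] unfolding P_fun_def g_def[symmetric] n by simp
  define I where "I = (\<lambda>j k::nat. if real k \<le> g (real j) then 1 else 0 :: real)"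
  have fl: "real_of_int \<lfloor>g (real j)\<rfloor> \<le> (\<Sum>k=1..N. I j k)" for j
    unfolding I_def
  proof (rule floor_eq_sum_levels)
    have "- 1 / 4 \<le> F_fun \<mu> (real j)" unfolding F_fun_def by (cases "real j < \<mu>") (auto intro: max.cobounded2)
    then have "g (real j) \<le> G_fun l (real j) + 1 / 4" by (simp add: g_def)
    also have "\<dots> \<le> G_fun l 0 + 1 / 4" using G_fun_antimono[of l 0 "real j"] l0 by simp
    also have "\<dots> = l / pi + 1 / 4" using l0 by (simp add: G_fun_def)
    also have "\<dots> \<le> l / 1 + 1"
      using l0 pi_gt3 by (intro add_mono divide_left_mono) auto
    also have "\<dots> \<le> real N" by (simp add: N_def) linarith
    finally show "g (real j) \<le> real N" .
  qed
  define c where "c = (\<lambda>k. I 0 k + 2 * (\<Sum>j=1..n. I j k))"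
  have "P_fun l \<mu> \<le> (\<Sum>k=1..N. I 0 k) + 2 * (\<Sum>j=1..n. \<Sum>k=1..N. I j k)"
    unfolding P using fl[of 0] by (intro add_mono mult_left_mono sum_mono fl) auto
  also have "(\<Sum>j=1..n. \<Sum>k=1..N. I j k) = (\<Sum>k=1..N. \<Sum>j=1..n. I j k)" by (rule sum.swap)
  finally have Pc: "P_fun l \<mu> \<le> (\<Sum>k=1..N. c k)"
    by (simp add: c_def sum.distrib sum_distrib_left)
  define L where "L = (\<lambda>k::nat. {j. j \<le> n \<and> real k \<le> g (real j)})"
  define M where "M = (\<lambda>k. Max (L k))"
  define A where "A = (\<lambda>k::nat. layer l \<mu> (real k))"
  \<comment> \<open>The surplus of level \<open>k\<close>: it can be negative only for a bad level
    with k \<ge> 2.\<close>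
  define e where "e = (\<lambda>k. 2 * A k - c k)"
  have finL: "finite (L k)" for k by (simp add: L_def)
  have inL: "M k \<in> L k" if "L k \<noteq> {}" for k
    unfolding M_def using that finL by (intro Max_in) auto
  have c_le: "c k \<le> 2 * real (M k) + 1" if "L k \<noteq> {}" for k
  proof -
    have "(\<Sum>j=1..n. I j k) \<le> (\<Sum>j=1..n. if j \<le> M k then 1 else 0)"
    proof (rule sum_mono)
      fix j assume "j \<in> {1..n}"
      then show "I j k \<le> (if j \<le> M k then 1 else 0)"
        using Max_ge[OF finL, of j k] by (auto simp: I_def L_def M_def)
    qed
    also have "\<dots> = real (card {j \<in> {1..n}. j \<le> M k})" by (simp add: sum.If_cases Int_def)
    also have "\<dots> \<le> real (card {1..M k})" by (intro of_nat_mono card_mono) auto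
    finally have "(\<Sum>j=1..n. I j k) \<le> real (M k)" by simp
    moreover have "I 0 k \<le> 1" by (simp add: I_def)
    ultimately show ?thesis by (simp add: c_def)
  qed
  have c_empty: "c k = 0" if "L k = {}" for k
  proof -
    have "I j k = 0" if "j \<le> n" for j using that \<open>L k = {}\<close> by (auto simp: I_def L_def)
    then show ?thesis by (simp add: c_def)
  qed
  have lev: "level l \<mu> (real k) (real (M k))" if "L k \<noteq> {}" for k
    using inL[OF that] by (intro level_of_F) (simp add: L_def g_def)
  define B where "B = (\<lambda>k. L k \<noteq> {} \<and> bad l \<mu> (real k) (real (M k)))"
  have e_nonneg: "0 \<le> e k" if "L k = {}" for k
    using c_empty[OF that] layer_nonneg[of \<mu> l "real k"] assms l0 by (simp add: e_def A_def)
  have e_pos: "0 < e k" if "L k \<noteq> {}" "\<not> B k" "1 \<le> k" for k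
  proof -
    have "real (M k) = 0 \<or> 1 \<le> real (M k)" by (cases "M k") auto
    then have "real (M k) + 1 / 2 < A k"
      unfolding A_def using layer_not_bad[of \<mu> l "real (M k)" "real k"] lev that assms l0
      by (simp add: B_def)
    then show ?thesis using c_le[OF that(1)] by (simp add: e_def)
  qed
  have e_first: "0 < e 1" if "B 1"
  proof -
    have "1 \<le> real (M 1)" using that by (simp add: B_def bad_def)
    then have "1 \<le> M 1" by simp
    then have "M 1 = 1 \<or> M 1 = 2 \<or> 3 \<le> M 1" by linarith
    then have "real (M 1) = 1 \<or> real (M 1) = 2 \<or> 3 \<le> real (M 1)" by auto
    then have "real (M 1) + 1 / 2 < A 1"
      unfolding A_def using layer_bad_first[of \<mu> l "real (M 1)"] that lev[of 1] assms m132 ml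
      by (simp add: B_def)
    then show ?thesis using c_le[of 1] that by (simp add: e_def B_def)
  qed
  have e_later: "0 < e 1 + e k" if "B k" "2 \<le> k" for k
  proof -
    have Lk: "L k \<noteq> {}" using that by (simp add: B_def)
    \<comment> \<open>A point reaching height k also reaches height 1, so the first level exists and
      can pay.\<close>
    have "M k \<in> L 1" using inL[OF Lk] that by (auto simp: L_def)
    then have L1: "L 1 \<noteq> {}" by auto
    have "3 / 4 \<le> G_fun l (real (M 1))" using lev[OF L1] by (simp add: level_def)
    then have "real (M 1) + real (M k) + 1 < A 1 + A k"
      unfolding A_def
      using layer_bad_later[of \<mu> l "real k" "real (M k)" "real (M 1)"] that lev[OF Lk] assms m132 ml
      by (simp add: B_def)
    then show ?thesis using c_le[OF Lk] c_le[OF L1] by (simp add: e_def)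
  qed
  have B_unique: "k = k'" if "B k" "B k'" "1 \<le> k" "1 \<le> k'" for k k'
  proof (rule ccontr)
    assume "k \<noteq> k'"
    then consider "k + 1 \<le> k'" | "k' + 1 \<le> k" by linarith
    then show False
    proof cases
      case 1
      then have "real k + 1 \<le> real k'" by linarith
      then show False
        using bad_unique[of \<mu> l "real k" "real k'" "real (M k)" "real (M k')"] that lev assms m132 ml
        by (simp add: B_def)
    next
      case 2
      then have "real k' + 1 \<le> real k" by linarith
      then show False
        using bad_unique[of \<mu> l "real k'" "real k" "real (M k')" "real (M k)"] that lev assms m132 ml
        by (simp add: B_def)
    qed
  qed
  have area: "2 * (\<Sum>k=1..N. A k) \<le> (l\<^sup>2 - \<mu>\<^sup>2) / 4"
    using sum_layer_le[of \<mu> l N] assms ml l0 by (simp add: A_def)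
  have esum: "(\<Sum>k=1..N. e k) = 2 * (\<Sum>k=1..N. A k) - (\<Sum>k=1..N. c k)"
    by (simp add: e_def sum_subtractf sum_distrib_left)
  show ?thesis
  proof (cases "\<exists>k\<in>{1..N}. L k \<noteq> {}")
    \<comment> \<open>With no point counted, strictness comes from \<mu> < l alone.\<close>
    case False
    then have "(\<Sum>k=1..N. c k) = 0" using c_empty by (intro sum.neutral) auto
    moreover have "\<mu>\<^sup>2 < l\<^sup>2" using ml assms by (intro power_strict_mono) auto
    ultimately show ?thesis using Pc by simp
  next
    case True
    then obtain k0 where k0: "k0 \<in> {1..N}" "L k0 \<noteq> {}" by (rule bexE)
    have "0 < (\<Sum>k=1..N. e k)"
    \<comment> \<open>By uniqueness at most one later level is bad; it is summed together with level
      1, and all other surpluses are nonnegative.\<close>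
    proof (cases "\<exists>k\<in>{2..N}. B k")
      case True
      then obtain k where k: "k \<in> {2..N}" "B k" by auto
      have "0 \<le> e j" if "j \<in> {1..N} - {1, k}" for j
      proof -
        have "\<not> B j" using B_unique[of j k] that k by auto
        then show ?thesis using e_nonneg[of j] e_pos[of j] that by fastforce
      qed
      then have "0 \<le> (\<Sum>j\<in>{1..N} - {1, k}. e j)" by (rule sum_nonneg)
      moreover have "(\<Sum>j=1..N. e j) = (\<Sum>j\<in>{1..N} - {1, k}. e j) + (\<Sum>j\<in>{1, k}. e j)"
        using k by (intro sum.subset_diff) auto
      moreover have "(\<Sum>j\<in>{1, k}. e j) = e 1 + e k" using k by (subst sum.insert) auto
      ultimately show ?thesis using e_later[of k] k by simp
    next
      case False
      have pos: "0 < e j" if "j \<in> {1..N}" "L j \<noteq> {}" for j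
      proof (cases "j = 1")
        case True
        then show ?thesis using e_first e_pos[of 1] that by (cases "B 1") auto
      next
        case j: False
        then have "\<not> B j" using False that by auto
        then show ?thesis using e_pos[of j] that by simp
      qed
      show ?thesis
      proof (rule sum_pos2[OF _ k0(1)])
        show "0 < e k0" using pos k0 by simp
        show "0 \<le> e j" if "j \<in> {1..N}" for j
          using pos[OF that] e_nonneg[of j] by fastforce
      qed simp
    qed
    then show ?thesis using esum area Pc by linarith
  qed
qed

end
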